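(* Let $\mathcal A\subset B(\mathcal H)$ be the operator algebra constructed in the context. Then its bidual $\mathcal A^{**}$ is semisimple.
   Context: $\mathbb N=\{1,2,\dots\}$, $\mathbb N_0=\mathbb N\cup\{0\}$; $a\mid b$ means $a$ divides $b$ (so every $a\in\mathbb N$ divides $0$). Let $S$ be the free unital semigroup on two generators $g,h$, with unit $1$, and $S^-=S\setminus\{1\}$. For $s=\gamma_n\gamma_{n-1}\cdots\gamma_1$ with $\gamma_i\in\{g,h\}$, the length is $l(s)=n$, the depth is $\rho(s)=\#\{i:\gamma_i=h\}$, and, if $n>0$, the predecessor is $p(s)=\gamma_{n-1}\cdots\gamma_1$ (delete the leftmost letter); $p^j$ is the $j$-fold iterate of $p$. Weights: $w(s)=2^{-\rho(s)}$ and $W(s)=\prod_{j=0}^{l(s)-1}w(p^js)$ (so $W(1)=1$). $\mathcal H=l^2(S,W)$ is the Hilbert space of formal sums $\sum_{s\in S}x_s\cdot s$, $x_s\in\mathbb C$, with $\|\sum x_s\cdot s\|^2=\sum_{s\in S}W(s)^2|x_s|^2<\infty$; thus $S$ is an orthogonal basis with $\|s\|=W(s)$. Colour set: $\mathcal C=\{g^k:k\in\mathbb N\}\cup\{g^khs:k\in\mathbb N_0,\ s\in S,\ 1+l(s)\mid k\}\subset S^-$. The colour map $\mu:S^-\to\mathcal C$ is defined recursively: $\mu(s)=s$ if $s\in\mathcal C$; otherwise $s=g^khy$ with $y\in S$, $l(y)=n$, $(n+1)\nmid k$, and $\mu(s)=\mu(p^{n-k'}y)$, where $1\le k'\le n$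 and $k\equiv k'\pmod{n+1}$. (For each $s\in S$, $\mu(gs)\ne\mu(hs)$.) For $c\in\mathcal C$, $T_c\in B(\mathcal H)$ is the bounded linear map with, for $s\in S$, $T_c(s)=gs$ if $\mu(gs)=c$, $T_c(s)=hs$ if $\mu(hs)=c$, and $T_c(s)=0$ otherwise. $\mathcal A_0$ is the non-unital subalgebra of $B(\mathcal H)$ generated by $\{T_c:c\in\mathcal C\}$, and $\mathcal A$ is its norm closure in $B(\mathcal H)$. $\mathcal A^{**}$ carries the Arens product (the two Arens products coincide because operator algebras are Arens regular). Semisimple means the Jacobson radical is $\{0\}$. *)

theory Defs
  imports "HOL-Analysis.Analysis"
begin

section \<open>Complex normed spaces and algebras\<close>

text \<open>The distribution only has real normed spaces; the classes below add a complex scalar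
  multiplication that extends the real one and is compatible with the norm.\<close>

class complex_normed_vector = real_normed_vector +
  fixes scaleC :: "complex \<Rightarrow> 'a \<Rightarrow> 'a"  (infixr \<open>*\<^sub>C\<close> 75)
  assumes scaleC_add_right: "c *\<^sub>C (x + y) = c *\<^sub>C x + c *\<^sub>C y"
    and scaleC_add_left: "(c + d) *\<^sub>C x = c *\<^sub>C x + d *\<^sub>C x"
    and scaleC_scaleC: "c *\<^sub>C d *\<^sub>C x = (c * d) *\<^sub>C x"
    and scaleR_scaleC: "r *\<^sub>R x = complex_of_real r *\<^sub>C x"
    and norm_scaleC: "norm (c *\<^sub>C x) = cmod c * norm x"

class complex_normed_algebra = complex_normed_vector + real_normed_algebra +
  assumes mult_scaleC_left: "(c *\<^sub>C x) * y = c *\<^sub>C (x * y)"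
    and mult_scaleC_right: "x * (c *\<^sub>C y) = c *\<^sub>C (x * y)"

instantiation complex :: complex_normed_algebra
begin
definition scaleC_complex :: "complex \<Rightarrow> complex \<Rightarrow> complex" where
  "scaleC_complex c x = c * x"
instance
  by standard (auto simp: scaleC_complex_def algebra_simps norm_mult scaleR_conv_of_real)
end

lemma bounded_linear_scaleC: "bounded_linear (\<lambda>x::'a::complex_normed_vector. c *\<^sub>C x)"
proof (rule bounded_linear_intro[where K = "cmod c"])
  fix r and x y :: 'a
  show "c *\<^sub>C (x + y) = c *\<^sub>C x + c *\<^sub>C y" by (rule scaleC_add_right)
  show "c *\<^sub>C r *\<^sub>R x = r *\<^sub>R c *\<^sub>C x"
    by (simp add: scaleR_scaleC scaleC_scaleC mult.commute)
  show "norm (c *\<^sub>C x) \<le> norm x * cmod c"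
    by (simp add: norm_scaleC mult.commute)
qed

lemma scaleC_zero_right [simp]: "c *\<^sub>C (0::'a::complex_normed_vector) = 0"
  using linear_0[OF bounded_linear.linear[OF bounded_linear_scaleC]] .

lemma scaleC_one [simp]: "1 *\<^sub>C (x::'a::complex_normed_vector) = x"
  by (metis of_real_1 scaleR_one scaleR_scaleC)

lemma scaleC_zero_left [simp]: "0 *\<^sub>C (x::'a::complex_normed_vector) = 0"
  by (metis of_real_0 scaleR_zero_left scaleR_scaleC)

definition bounded_clinear ::
  "('a::complex_normed_vector \<Rightarrow> 'b::complex_normed_vector) \<Rightarrow> bool" where
  "bounded_clinear f \<longleftrightarrow> bounded_linear f \<and> (\<forall>c x. f (c *\<^sub>C x) = c *\<^sub>C f x)"

lemma bounded_clinearI: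
  assumes "\<And>x y. f (x + y) = f x + f y" "\<And>c x. f (c *\<^sub>C x) = c *\<^sub>C f x"
    and "\<And>x. norm (f x) \<le> norm x * K"
  shows "bounded_clinear f"
  unfolding bounded_clinear_def
  using assms by (auto intro!: bounded_linear_intro[where K = K] simp: scaleR_scaleC)

lemma bounded_clinear_bl: "bounded_clinear f \<Longrightarrow> bounded_linear f"
  by (simp add: bounded_clinear_def)

lemma bounded_clinear_zero: "bounded_clinear (\<lambda>x. 0)"
  by (simp add: bounded_clinear_def)

lemma bounded_clinear_add:
  "bounded_clinear f \<Longrightarrow> bounded_clinear g \<Longrightarrow> bounded_clinear (\<lambda>x. f x + g x)"
  by (simp add: bounded_clinear_def bounded_linear_add scaleC_add_right)

lemma bounded_clinear_scaleC: "bounded_clinear f \<Longrightarrow> bounded_clinear (\<lambda>x. c *\<^sub>C f x)"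
  by (auto simp: bounded_clinear_def scaleC_scaleC mult.commute
      intro: bounded_linear_compose[OF bounded_linear_scaleC])

lemma bounded_clinear_scaleR: "bounded_clinear f \<Longrightarrow> bounded_clinear (\<lambda>x. r *\<^sub>R f x)"
  by (simp add: scaleR_scaleC bounded_clinear_scaleC)

lemma bounded_clinear_minus: "bounded_clinear f \<Longrightarrow> bounded_clinear (\<lambda>x. - f x)"
  using bounded_clinear_scaleR[of f "-1"] by simp

lemma bounded_clinear_diff:
  "bounded_clinear f \<Longrightarrow> bounded_clinear g \<Longrightarrow> bounded_clinear (\<lambda>x. f x - g x)"
  using bounded_clinear_add[OF _ bounded_clinear_minus, of f g] by simp

lemma bounded_clinear_compose:
  "bounded_clinear f \<Longrightarrow> bounded_clinear g \<Longrightarrow> bounded_clinear (\<lambda>x. f (g x))"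
  by (simp add: bounded_clinear_def bounded_linear_compose)

lemma onorm_scaleC_fun:
  assumes "bounded_clinear f"
  shows "onorm (\<lambda>x. c *\<^sub>C f x) = cmod c * onorm f"
proof (rule antisym)
  have bl: "bounded_linear f" by (rule bounded_clinear_bl[OF assms])
  show "onorm (\<lambda>x. c *\<^sub>C f x) \<le> cmod c * onorm f"
  proof (rule onorm_bound)
    show "0 \<le> cmod c * onorm f" by (simp add: onorm_pos_le[OF bl])
    show "norm (c *\<^sub>C f x) \<le> cmod c * onorm f * norm x" for x
      using mult_left_mono[OF onorm[OF bl, of x] norm_ge_zero[of c]]
      by (simp add: norm_scaleC mult.assoc)
  qed
  have bl2: "bounded_linear (\<lambda>x. c *\<^sub>C f x)"
    by (rule bounded_clinear_bl[OF bounded_clinear_scaleC[OF assms]])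
  show "cmod c * onorm f \<le> onorm (\<lambda>x. c *\<^sub>C f x)"
  proof (cases "c = 0")
    case True
    then show ?thesis by (simp add: onorm_zero)
  next
    case False
    have "onorm f \<le> onorm (\<lambda>x. c *\<^sub>C f x) / cmod c"
    proof (rule onorm_bound)
      show "0 \<le> onorm (\<lambda>x. c *\<^sub>C f x) / cmod c" by (simp add: onorm_pos_le[OF bl2])
      show "norm (f x) \<le> onorm (\<lambda>x. c *\<^sub>C f x) / cmod c * norm x" for x
        using onorm[OF bl2, of x] False by (simp add: norm_scaleC field_simps)
    qed
    with False show ?thesis by (simp add: field_simps)
  qed
qed


section \<open>Bounded operators\<close>

text \<open>\<open>B(X)\<close>: the bounded complex-linear operators on \<open>X\<close>, with the operator norm and
  composition as product.\<close>

typedef (overloaded) 'a bop = "{f :: 'a::complex_normed_vector \<Rightarrow> 'a. bounded_clinear f}"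
  morphisms bop_apply Bop
  using bounded_clinear_zero by blast

setup_lifting type_definition_bop

lemma bop_clinear: "bounded_clinear (bop_apply f)"
  using bop_apply by blast

lemmas bop_bl = bounded_clinear_bl[OF bop_clinear]

lemma bop_apply_Bop: "bounded_clinear f \<Longrightarrow> bop_apply (Bop f) = f"
  by (simp add: Bop_inverse)

lemma bop_eqI: "(\<And>x. bop_apply f x = bop_apply g x) \<Longrightarrow> f = g"
  by transfer auto

instantiation bop :: (complex_normed_vector) complex_normed_algebra
begin

lift_definition zero_bop :: "'a bop" is "\<lambda>x. 0" by (rule bounded_clinear_zero)
lift_definition plus_bop :: "'a bop \<Rightarrow> 'a bop \<Rightarrow> 'a bop" is "\<lambda>f g x. f x + g x"
  by (rule bounded_clinear_add)
lift_definition minus_bop :: "'a bop \<Rightarrow> 'a bop \<Rightarrow> 'a bop" is "\<lambda>f g x. f x - g x"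
  by (rule bounded_clinear_diff)
lift_definition uminus_bop :: "'a bop \<Rightarrow> 'a bop" is "\<lambda>f x. - f x"
  by (rule bounded_clinear_minus)
lift_definition scaleR_bop :: "real \<Rightarrow> 'a bop \<Rightarrow> 'a bop" is "\<lambda>r f x. r *\<^sub>R f x"
  by (rule bounded_clinear_scaleR)
lift_definition scaleC_bop :: "complex \<Rightarrow> 'a bop \<Rightarrow> 'a bop" is "\<lambda>c f x. c *\<^sub>C f x"
  by (rule bounded_clinear_scaleC)
lift_definition times_bop :: "'a bop \<Rightarrow> 'a bop \<Rightarrow> 'a bop" is "\<lambda>f g x. f (g x)"
  by (rule bounded_clinear_compose)
lift_definition norm_bop :: "'a bop \<Rightarrow> real" is onorm .
definition dist_bop :: "'a bop \<Rightarrow> 'a bop \<Rightarrow> real" where "dist_bop f g = norm (f - g)"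
definition sgn_bop :: "'a bop \<Rightarrow> 'a bop" where "sgn_bop f = inverse (norm f) *\<^sub>R f"
definition uniformity_bop :: "('a bop \<times> 'a bop) filter" where
  "uniformity_bop = (INF e\<in>{0<..}. principal {(x, y). dist x y < e})"
definition open_bop :: "'a bop set \<Rightarrow> bool" where
  "open_bop U = (\<forall>x\<in>U. \<forall>\<^sub>F (x', y) in uniformity. x' = x \<longrightarrow> y \<in> U)"

instance
proof
  fix f g h :: "'a bop" and r r' :: real and c d :: complex and U :: "'a bop set"
  show "f + g + h = f + (g + h)" "f + g = g + f" "0 + f = f" "- f + f = 0" "f - g = f + - g"
    by (transfer; simp add: algebra_simps)+
  show "r *\<^sub>R (f + g) = r *\<^sub>R f + r *\<^sub>R g" "(r + r') *\<^sub>R f = r *\<^sub>R f + r' *\<^sub>R f"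
    "r *\<^sub>R r' *\<^sub>R f = (r * r') *\<^sub>R f" "1 *\<^sub>R f = f"
    by (transfer; simp add: algebra_simps)+
  show "c *\<^sub>C (f + g) = c *\<^sub>C f + c *\<^sub>C g" "(c + d) *\<^sub>C f = c *\<^sub>C f + d *\<^sub>C f"
    "c *\<^sub>C d *\<^sub>C f = (c * d) *\<^sub>C f" "r *\<^sub>R f = complex_of_real r *\<^sub>C f"
    by (transfer; simp add: scaleC_add_right scaleC_add_left scaleC_scaleC scaleR_scaleC)+
  show "f * g * h = f * (g * h)" by transfer simp
  show "(f + g) * h = f * h + g * h" by transfer simp
  show "f * (g + h) = f * g + f * h"
    by transfer (simp add: linear_add[OF bounded_linear.linear[OF bounded_clinear_bl]])
  show "r *\<^sub>R f * g = r *\<^sub>R (f * g)" by transfer simp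
  show "f * r *\<^sub>R g = r *\<^sub>R (f * g)"
    by transfer (simp add: linear_cmul[OF bounded_linear.linear[OF bounded_clinear_bl]])
  show "c *\<^sub>C f * g = c *\<^sub>C (f * g)" by transfer simp
  show "f * c *\<^sub>C g = c *\<^sub>C (f * g)" by transfer (simp add: bounded_clinear_def)
  show "norm (c *\<^sub>C f) = cmod c * norm f" by transfer (rule onorm_scaleC_fun)
  show "norm (r *\<^sub>R f) = \<bar>r\<bar> * norm f"
    by transfer (simp add: onorm_scaleR bounded_clinear_bl)
  show "norm (f + g) \<le> norm f + norm g"
    by transfer (simp add: onorm_triangle bounded_clinear_bl)
  show "norm f = 0 \<longleftrightarrow> f = 0"
    by transfer (auto simp: onorm_eq_0 bounded_clinear_bl)
  show "norm (f * g) \<le> norm f * norm g"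
    using onorm_compose[OF bop_bl bop_bl, of f g]
    by (simp add: norm_bop.rep_eq times_bop.rep_eq comp_def)
qed (simp_all add: dist_bop_def sgn_bop_def uniformity_bop_def open_bop_def)

end


section \<open>Dual, bidual and the Arens product\<close>

typedef (overloaded) 'a cdual = "{f :: 'a::complex_normed_vector \<Rightarrow> complex. bounded_clinear f}"
  morphisms cdual_apply Cdual
  using bounded_clinear_zero by blast

setup_lifting type_definition_cdual

lemma cdual_clinear: "bounded_clinear (cdual_apply f)"
  using cdual_apply by blast

lemmas cdual_bl = bounded_clinear_bl[OF cdual_clinear]

lemma cdual_apply_Cdual: "bounded_clinear f \<Longrightarrow> cdual_apply (Cdual f) = f"
  by (simp add: Cdual_inverse)

lemma cdual_eqI: "(\<And>x. cdual_apply f x = cdual_apply g x) \<Longrightarrow> f = g"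
  by transfer auto

instantiation cdual :: (complex_normed_vector) complex_normed_vector
begin

lift_definition zero_cdual :: "'a cdual" is "\<lambda>x. 0" by (rule bounded_clinear_zero)
lift_definition plus_cdual :: "'a cdual \<Rightarrow> 'a cdual \<Rightarrow> 'a cdual" is "\<lambda>f g x. f x + g x"
  by (rule bounded_clinear_add)
lift_definition minus_cdual :: "'a cdual \<Rightarrow> 'a cdual \<Rightarrow> 'a cdual" is "\<lambda>f g x. f x - g x"
  by (rule bounded_clinear_diff)
lift_definition uminus_cdual :: "'a cdual \<Rightarrow> 'a cdual" is "\<lambda>f x. - f x"
  by (rule bounded_clinear_minus)
lift_definition scaleR_cdual :: "real \<Rightarrow> 'a cdual \<Rightarrow> 'a cdual" is "\<lambda>r f x. r *\<^sub>R f x"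
  by (rule bounded_clinear_scaleR)
lift_definition scaleC_cdual :: "complex \<Rightarrow> 'a cdual \<Rightarrow> 'a cdual" is "\<lambda>c f x. c *\<^sub>C f x"
  by (rule bounded_clinear_scaleC)
lift_definition norm_cdual :: "'a cdual \<Rightarrow> real" is onorm .
definition dist_cdual :: "'a cdual \<Rightarrow> 'a cdual \<Rightarrow> real" where "dist_cdual f g = norm (f - g)"
definition sgn_cdual :: "'a cdual \<Rightarrow> 'a cdual" where "sgn_cdual f = inverse (norm f) *\<^sub>R f"
definition uniformity_cdual :: "('a cdual \<times> 'a cdual) filter" where
  "uniformity_cdual = (INF e\<in>{0<..}. principal {(x, y). dist x y < e})"
definition open_cdual :: "'a cdual set \<Rightarrow> bool" where
  "open_cdual U = (\<forall>x\<in>U. \<forall>\<^sub>F (x', y) in uniformity. x' = x \<longrightarrow> y \<in> U)"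

instance
proof
  fix f g h :: "'a cdual" and r r' :: real and c d :: complex and U :: "'a cdual set"
  show "f + g + h = f + (g + h)" "f + g = g + f" "0 + f = f" "- f + f = 0" "f - g = f + - g"
    by (transfer; simp add: algebra_simps)+
  show "r *\<^sub>R (f + g) = r *\<^sub>R f + r *\<^sub>R g" "(r + r') *\<^sub>R f = r *\<^sub>R f + r' *\<^sub>R f"
    "r *\<^sub>R r' *\<^sub>R f = (r * r') *\<^sub>R f" "1 *\<^sub>R f = f"
    by (transfer; simp add: algebra_simps)+
  show "c *\<^sub>C (f + g) = c *\<^sub>C f + c *\<^sub>C g" "(c + d) *\<^sub>C f = c *\<^sub>C f + d *\<^sub>C f"
    "c *\<^sub>C d *\<^sub>C f = (c * d) *\<^sub>C f" "r *\<^sub>R f = complex_of_real r *\<^sub>C f"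
    by (transfer; simp add: scaleC_add_right scaleC_add_left scaleC_scaleC scaleR_scaleC)+
  show "norm (c *\<^sub>C f) = cmod c * norm f" by transfer (rule onorm_scaleC_fun)
  show "norm (r *\<^sub>R f) = \<bar>r\<bar> * norm f"
    by transfer (simp add: onorm_scaleR bounded_clinear_bl)
  show "norm (f + g) \<le> norm f + norm g"
    by transfer (simp add: onorm_triangle bounded_clinear_bl)
  show "norm f = 0 \<longleftrightarrow> f = 0"
    by transfer (auto simp: onorm_eq_0 bounded_clinear_bl)
qed (simp_all add: dist_cdual_def sgn_cdual_def uniformity_cdual_def open_cdual_def)

end

lemma cdual_bound: "cmod (cdual_apply f x) \<le> norm f * norm x"
  unfolding norm_cdual.rep_eq by (rule onorm[OF cdual_bl])

lemma norm_cdual_le: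
  assumes "0 \<le> K" "\<And>x. cmod (cdual_apply f x) \<le> K * norm x"
  shows "norm f \<le> K"
  unfolding norm_cdual.rep_eq using assms by (rule onorm_bound)

lemmas cdual_add_arg = linear_add[OF bounded_linear.linear[OF cdual_bl]]
lemma cdual_scaleC_arg: "cdual_apply f (c *\<^sub>C x) = c * cdual_apply f x"
  using cdual_clinear[of f] by (simp add: bounded_clinear_def scaleC_complex_def)

text \<open>First Arens product: \<open>\<langle>b, f \<cdot> a\<rangle> = \<langle>a b, f\<rangle>\<close>, \<open>\<langle>a, \<Psi> \<cdot> f\<rangle> = \<langle>f \<cdot> a, \<Psi>\<rangle>\<close> and
  \<open>\<langle>f, \<Phi> \<Psi>\<rangle> = \<langle>\<Psi> \<cdot> f, \<Phi>\<rangle>\<close>.\<close>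

definition dual_act :: "'a::complex_normed_algebra cdual \<Rightarrow> 'a \<Rightarrow> 'a cdual" where
  "dual_act f a = Cdual (\<lambda>b. cdual_apply f (a * b))"

definition bidual_act ::
  "'a::complex_normed_algebra cdual cdual \<Rightarrow> 'a cdual \<Rightarrow> 'a cdual" where
  "bidual_act \<Psi> f = Cdual (\<lambda>a. cdual_apply \<Psi> (dual_act f a))"

definition arens ::
  "'a::complex_normed_algebra cdual cdual \<Rightarrow> 'a cdual cdual \<Rightarrow> 'a cdual cdual" where
  "arens \<Phi> \<Psi> = Cdual (\<lambda>f. cdual_apply \<Phi> (bidual_act \<Psi> f))"

lemma dual_act_apply [simp]: "cdual_apply (dual_act f a) b = cdual_apply f (a * b)"
proof -
  have "bounded_clinear (\<lambda>b. cdual_apply f (a * b))"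
  proof (rule bounded_clinearI[where K = "norm f * norm a"])
    show "cmod (cdual_apply f (a * b)) \<le> norm b * (norm f * norm a)" for b
      using order_trans[OF cdual_bound[of f "a * b"]
          mult_left_mono[OF norm_mult_ineq[of a b] norm_ge_zero[of f]]]
      by (simp add: mult_ac)
  qed (simp_all add: distrib_left cdual_add_arg mult_scaleC_right cdual_scaleC_arg
      scaleC_complex_def)
  then show ?thesis by (simp add: dual_act_def cdual_apply_Cdual)
qed

lemma norm_dual_act: "norm (dual_act f a) \<le> norm f * norm a"
proof (rule norm_cdual_le)
  show "cmod (cdual_apply (dual_act f a) b) \<le> norm f * norm a * norm b" for b
    using order_trans[OF cdual_bound[of f "a * b"]
        mult_left_mono[OF norm_mult_ineq[of a b] norm_ge_zero[of f]]]
    by (simp add: mult_ac)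
qed simp

lemma dual_act_add_right: "dual_act f (a + b) = dual_act f a + dual_act f b"
  by (rule cdual_eqI) (simp add: plus_cdual.rep_eq distrib_right cdual_add_arg)

lemma dual_act_scaleC_right: "dual_act f (c *\<^sub>C a) = c *\<^sub>C dual_act f a"
  by (rule cdual_eqI)
    (simp add: scaleC_cdual.rep_eq mult_scaleC_left cdual_scaleC_arg scaleC_complex_def)

lemma dual_act_add_left: "dual_act (f + g) a = dual_act f a + dual_act g a"
  by (rule cdual_eqI) (simp add: plus_cdual.rep_eq)

lemma dual_act_scaleC_left: "dual_act (c *\<^sub>C f) a = c *\<^sub>C dual_act f a"
  by (rule cdual_eqI) (simp add: scaleC_cdual.rep_eq)

lemma bidual_act_bound: "cmod (cdual_apply \<Psi> (dual_act f a)) \<le> norm \<Psi> * norm f * norm a"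
  using order_trans[OF cdual_bound[of \<Psi> "dual_act f a"]
      mult_left_mono[OF norm_dual_act[of f a] norm_ge_zero[of \<Psi>]]]
  by (simp add: mult_ac)

lemma bidual_act_apply [simp]: "cdual_apply (bidual_act \<Psi> f) a = cdual_apply \<Psi> (dual_act f a)"
proof -
  have "bounded_clinear (\<lambda>a. cdual_apply \<Psi> (dual_act f a))"
  proof (rule bounded_clinearI[where K = "norm \<Psi> * norm f"])
    show "cmod (cdual_apply \<Psi> (dual_act f a)) \<le> norm a * (norm \<Psi> * norm f)" for a
      using bidual_act_bound[of \<Psi> f a] by (simp add: mult_ac)
  qed (simp_all add: dual_act_add_right cdual_add_arg dual_act_scaleC_right cdual_scaleC_arg
      scaleC_complex_def)
  then show ?thesis by (simp add: bidual_act_def cdual_apply_Cdual)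
qed

lemma norm_bidual_act: "norm (bidual_act \<Psi> f) \<le> norm \<Psi> * norm f"
  by (rule norm_cdual_le) (simp_all add: bidual_act_bound)

lemma bidual_act_add_right: "bidual_act \<Psi> (f + g) = bidual_act \<Psi> f + bidual_act \<Psi> g"
  by (rule cdual_eqI) (simp add: plus_cdual.rep_eq dual_act_add_left cdual_add_arg)

lemma bidual_act_scaleC_right: "bidual_act \<Psi> (c *\<^sub>C f) = c *\<^sub>C bidual_act \<Psi> f"
  by (rule cdual_eqI)
    (simp add: scaleC_cdual.rep_eq dual_act_scaleC_left cdual_scaleC_arg scaleC_complex_def)

lemma bidual_act_add_left: "bidual_act (\<Phi> + \<Psi>) f = bidual_act \<Phi> f + bidual_act \<Psi> f"
  by (rule cdual_eqI) (simp add: plus_cdual.rep_eq)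

lemma bidual_act_scaleC_left: "bidual_act (c *\<^sub>C \<Psi>) f = c *\<^sub>C bidual_act \<Psi> f"
  by (rule cdual_eqI) (simp add: scaleC_cdual.rep_eq)

lemma arens_bound:
  "cmod (cdual_apply \<Phi> (bidual_act \<Psi> f)) \<le> norm \<Phi> * norm \<Psi> * norm f"
  using order_trans[OF cdual_bound[of \<Phi> "bidual_act \<Psi> f"]
      mult_left_mono[OF norm_bidual_act[of \<Psi> f] norm_ge_zero[of \<Phi>]]]
  by (simp add: mult_ac)

lemma arens_apply [simp]: "cdual_apply (arens \<Phi> \<Psi>) f = cdual_apply \<Phi> (bidual_act \<Psi> f)"
proof -
  have "bounded_clinear (\<lambda>f. cdual_apply \<Phi> (bidual_act \<Psi> f))"
  proof (rule bounded_clinearI[where K = "norm \<Phi> * norm \<Psi>"])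
    show "cmod (cdual_apply \<Phi> (bidual_act \<Psi> f)) \<le> norm f * (norm \<Phi> * norm \<Psi>)" for f
      using arens_bound[of \<Phi> \<Psi> f] by (simp add: mult_ac)
  qed (simp_all add: bidual_act_add_right cdual_add_arg bidual_act_scaleC_right cdual_scaleC_arg
      scaleC_complex_def)
  then show ?thesis by (simp add: arens_def cdual_apply_Cdual)
qed

lemma norm_arens: "norm (arens \<Phi> \<Psi>) \<le> norm \<Phi> * norm \<Psi>"
  by (rule norm_cdual_le) (simp_all add: arens_bound)

lemma dual_act_mult: "dual_act (dual_act f a) b = dual_act f (a * b)"
  by (rule cdual_eqI) (simp add: mult.assoc)

lemma dual_act_bidual_act: "dual_act (bidual_act \<Psi> f) a = bidual_act \<Psi> (dual_act f a)"
  by (rule cdual_eqI) (simp add: dual_act_mult)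

lemma bidual_act_arens: "bidual_act (arens \<Phi> \<Psi>) f = bidual_act \<Phi> (bidual_act \<Psi> f)"
  by (rule cdual_eqI) (simp add: dual_act_bidual_act)

text \<open>A copy of the type \<open>'a cdual cdual\<close>, so that it can be made an algebra.\<close>

typedef (overloaded) 'a bidual = "UNIV :: 'a::complex_normed_algebra cdual cdual set"
  morphisms of_bidual Bidual ..

setup_lifting type_definition_bidual

instantiation bidual :: (complex_normed_algebra) complex_normed_algebra
begin

lift_definition zero_bidual :: "'a bidual" is 0 .
lift_definition plus_bidual :: "'a bidual \<Rightarrow> 'a bidual \<Rightarrow> 'a bidual" is "(+)" .
lift_definition minus_bidual :: "'a bidual \<Rightarrow> 'a bidual \<Rightarrow> 'a bidual" is "(-)" .
lift_definition uminus_bidual :: "'a bidual \<Rightarrow> 'a bidual" is uminus .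
lift_definition scaleR_bidual :: "real \<Rightarrow> 'a bidual \<Rightarrow> 'a bidual" is scaleR .
lift_definition scaleC_bidual :: "complex \<Rightarrow> 'a bidual \<Rightarrow> 'a bidual" is scaleC .
lift_definition times_bidual :: "'a bidual \<Rightarrow> 'a bidual \<Rightarrow> 'a bidual" is arens .
lift_definition norm_bidual :: "'a bidual \<Rightarrow> real" is norm .
definition dist_bidual :: "'a bidual \<Rightarrow> 'a bidual \<Rightarrow> real" where
  "dist_bidual f g = norm (f - g)"
definition sgn_bidual :: "'a bidual \<Rightarrow> 'a bidual" where
  "sgn_bidual f = inverse (norm f) *\<^sub>R f"
definition uniformity_bidual :: "('a bidual \<times> 'a bidual) filter" where
  "uniformity_bidual = (INF e\<in>{0<..}. principal {(x, y). dist x y < e})"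
definition open_bidual :: "'a bidual set \<Rightarrow> bool" where
  "open_bidual U = (\<forall>x\<in>U. \<forall>\<^sub>F (x', y) in uniformity. x' = x \<longrightarrow> y \<in> U)"

instance
proof
  fix f g h :: "'a bidual" and r r' :: real and c d :: complex and U :: "'a bidual set"
  show "f + g + h = f + (g + h)" "f + g = g + f" "0 + f = f" "- f + f = 0" "f - g = f + - g"
    by (transfer; simp add: algebra_simps)+
  show "r *\<^sub>R (f + g) = r *\<^sub>R f + r *\<^sub>R g" "(r + r') *\<^sub>R f = r *\<^sub>R f + r' *\<^sub>R f"
    "r *\<^sub>R r' *\<^sub>R f = (r * r') *\<^sub>R f" "1 *\<^sub>R f = f"
    by (transfer; simp add: algebra_simps)+
  show "c *\<^sub>C (f + g) = c *\<^sub>C f + c *\<^sub>C g" "(c + d) *\<^sub>C f = c *\<^sub>C f + d *\<^sub>C f"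
    "c *\<^sub>C d *\<^sub>C f = (c * d) *\<^sub>C f" "r *\<^sub>R f = complex_of_real r *\<^sub>C f"
    by (transfer; simp add: scaleC_add_right scaleC_add_left scaleC_scaleC scaleR_scaleC)+
  show "f * g * h = f * (g * h)"
    by transfer (rule cdual_eqI, simp add: bidual_act_arens)
  show "(f + g) * h = f * h + g * h"
    by transfer (rule cdual_eqI, simp add: plus_cdual.rep_eq)
  show "f * (g + h) = f * g + f * h"
    by transfer (rule cdual_eqI, simp add: plus_cdual.rep_eq bidual_act_add_left cdual_add_arg)
  show C1: "c *\<^sub>C f * g = c *\<^sub>C (f * g)" for c
    by transfer (rule cdual_eqI, simp add: scaleC_cdual.rep_eq)
  show C2: "f * c *\<^sub>C g = c *\<^sub>C (f * g)" for c
    by transfer (rule cdual_eqI,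
        simp add: scaleC_cdual.rep_eq bidual_act_scaleC_left cdual_scaleC_arg scaleC_complex_def)
  have R: "r *\<^sub>R f = complex_of_real r *\<^sub>C f" for f :: "'a bidual"
    by transfer (simp add: scaleR_scaleC)
  show "r *\<^sub>R f * g = r *\<^sub>R (f * g)" "f * r *\<^sub>R g = r *\<^sub>R (f * g)"
    by (simp_all add: R C1 C2)
  show "norm (c *\<^sub>C f) = cmod c * norm f" by transfer (rule norm_scaleC)
  show "norm (r *\<^sub>R f) = \<bar>r\<bar> * norm f" by transfer simp
  show "norm (f + g) \<le> norm f + norm g" by transfer (rule norm_triangle_ineq)
  show "norm f = 0 \<longleftrightarrow> f = 0" by transfer simp
  show "norm (f * g) \<le> norm f * norm g" by transfer (rule norm_arens)
qed (simp_all add: dist_bidual_def sgn_bidual_def uniformity_bidual_def open_bidual_def)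

end


section \<open>Subalgebras and the Jacobson radical\<close>

definition csubspace :: "'a::complex_normed_vector set \<Rightarrow> bool" where
  "csubspace L \<longleftrightarrow> 0 \<in> L \<and> (\<forall>x\<in>L. \<forall>y\<in>L. x + y \<in> L) \<and> (\<forall>c. \<forall>x\<in>L. c *\<^sub>C x \<in> L)"

definition csubalgebra :: "'a::complex_normed_algebra set \<Rightarrow> bool" where
  "csubalgebra L \<longleftrightarrow> csubspace L \<and> (\<forall>x\<in>L. \<forall>y\<in>L. x * y \<in> L)"

definition left_ideal :: "'a::complex_normed_algebra set \<Rightarrow> bool" where
  "left_ideal L \<longleftrightarrow> csubspace L \<and> (\<forall>a. \<forall>x\<in>L. a * x \<in> L)"

text \<open>The algebras are not assumed to have a unit: the Jacobson radical is the intersection of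
  all maximal modular left ideals, which is the whole algebra if there are none.\<close>

definition modular_left_ideal :: "'a::complex_normed_algebra set \<Rightarrow> bool" where
  "modular_left_ideal L \<longleftrightarrow> left_ideal L \<and> (\<exists>u. \<forall>a. a - a * u \<in> L)"

definition maximal_modular_left_ideal :: "'a::complex_normed_algebra set \<Rightarrow> bool" where
  "maximal_modular_left_ideal L \<longleftrightarrow> modular_left_ideal L \<and> L \<noteq> UNIV \<and>
     (\<forall>M. left_ideal M \<and> L \<subseteq> M \<longrightarrow> M = L \<or> M = UNIV)"

definition jacobson_radical :: "'a::complex_normed_algebra set" where
  "jacobson_radical = \<Inter>{L. maximal_modular_left_ideal L}"

definition semisimple :: "'a::complex_normed_algebra itself \<Rightarrow> bool" where
  "semisimple (_ :: 'a itself) \<longleftrightarrow> (jacobson_radical :: 'a set) = {0}"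

lemma csubalgebra_hull: "csubalgebra (csubalgebra hull X)"
  by (rule hull_in) (auto simp: csubalgebra_def csubspace_def)

lemma csubalgebra_closure:
  assumes "csubalgebra B"
  shows "csubalgebra (closure B)"
  unfolding csubalgebra_def csubspace_def
proof (intro conjI ballI allI)
  have B: "0 \<in> B" "\<And>x y. x \<in> B \<Longrightarrow> y \<in> B \<Longrightarrow> x + y \<in> B" "\<And>c x. x \<in> B \<Longrightarrow> c *\<^sub>C x \<in> B"
    "\<And>x y. x \<in> B \<Longrightarrow> y \<in> B \<Longrightarrow> x * y \<in> B"
    using assms by (auto simp: csubalgebra_def csubspace_def)
  show "0 \<in> closure B" using B closure_subset by blast
  have lim: "x \<in> closure B" if "\<And>n. X n \<in> B" "X \<longlonglongrightarrow> x" for X :: "nat \<Rightarrow> 'a" and x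
    using that closure_sequential[of x B] by auto
  fix x assume "x \<in> closure B"
  then obtain X where "\<forall>n. X n \<in> B" and Xx: "X \<longlonglongrightarrow> x"
    using closure_sequential[of x B] by auto
  then have XB: "X n \<in> B" for n by simp
  show "c *\<^sub>C x \<in> closure B" for c
    by (rule lim[OF _ bounded_linear.tendsto[OF bounded_linear_scaleC Xx]]) (rule B(3)[OF XB])
  fix y assume "y \<in> closure B"
  then obtain Y where "\<forall>n. Y n \<in> B" and Yy: "Y \<longlonglongrightarrow> y"
    using closure_sequential[of y B] by auto
  then have YB: "Y n \<in> B" for n by simp
  show "x + y \<in> closure B"
    by (rule lim[OF _ tendsto_add[OF Xx Yy]]) (rule B(2)[OF XB YB])
  show "x * y \<in> closure B"
    by (rule lim[OF _ tendsto_mult[OF Xx Yy]]) (rule B(4)[OF XB YB])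
qed


section \<open>The free semigroup, its weights and its colouring\<close>

datatype gen = gen_g | gen_h

text \<open>The word \<open>\<gamma>\<^sub>n \<gamma>\<^sub>n\<^sub>-\<^sub>1 \<dots> \<gamma>\<^sub>1\<close> is the list \<open>[\<gamma>\<^sub>n, \<dots>, \<gamma>\<^sub>1]\<close>: the unit is \<open>[]\<close>, the product is
  \<open>@\<close>, and the predecessor is \<open>tl\<close>.\<close>

type_synonym word = "gen list"

definition depth :: "word \<Rightarrow> nat" where
  "depth s = count_list s gen_h"

definition wt :: "word \<Rightarrow> real" where
  "wt s = 1 / 2 ^ depth s"

definition Wt :: "word \<Rightarrow> real" where
  "Wt s = (\<Prod>j<length s. wt ((tl ^^ j) s))"

definition colours :: "word set" where
  "colours = {replicate k gen_g |k. 1 \<le> k} \<union>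
     {replicate k gen_g @ gen_h # s |k s. (1 + length s) dvd k}"

text \<open>A word outside \<^const>\<open>colours\<close> other than the unit is \<open>g\<^sup>k h y\<close>, where \<open>k\<close> is the length of
  its longest prefix of letters \<open>g\<close>. The value at the unit is irrelevant.\<close>

function colour :: "word \<Rightarrow> word" where
  "colour s = (if s = [] \<or> s \<in> colours then s else
     let k = length (takeWhile (\<lambda>x. x = gen_g) s);
         y = tl (dropWhile (\<lambda>x. x = gen_g) s);
         n = length y;
         k' = k mod (n + 1)
     in colour ((tl ^^ (n - k')) y))"
  by auto

lemma tl_funpow: "(tl ^^ j) xs = drop j xs"
  by (induction j arbitrary: xs) (simp_all add: drop_Suc tl_drop)

lemma length_funpow_tl: "length ((tl ^^ j) xs) \<le> length xs"
  by (simp add: tl_funpow)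

termination colour
proof (relation "Wellfounded.measure length")
  fix s :: word and k y n k'
  assume s: "\<not> (s = [] \<or> s \<in> colours)"
    and y: "y = tl (dropWhile (\<lambda>x. x = gen_g) s)"
  have "length y < length s"
    using s y length_dropWhile_le[of "\<lambda>x. x = gen_g" s] by (cases s) auto
  then show "((tl ^^ (n - k')) y, s) \<in> Wellfounded.measure length"
    using length_funpow_tl[of "n - k'" y] by simp
qed simp

declare colour.simps [simp del]

lemma colour_in_colours [simp]: "s \<in> colours \<Longrightarrow> colour s = s"
  by (subst colour.simps) simp

lemma gen_not_g [simp]: "x \<noteq> gen_g \<longleftrightarrow> x = gen_h"
  by (cases x) auto

lemma replicate_h_eq_iff:
  "replicate k gen_g @ gen_h # y = replicate k' gen_g @ gen_h # y' \<longleftrightarrow> k = k' \<and> y = y'"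
proof (induction k arbitrary: k')
  case 0
  then show ?case by (cases k') auto
next
  case (Suc k)
  then show ?case by (cases k') auto
qed

lemma replicate_h_neq: "replicate k gen_g @ gen_h # y \<noteq> replicate k' gen_g"
  by (metis gen.distinct(1) in_set_conv_decomp in_set_replicate)

lemma replicate_h_in_colours_iff:
  "replicate k gen_g @ gen_h # y \<in> colours \<longleftrightarrow> (1 + length y) dvd k"
  unfolding colours_def using replicate_h_eq_iff replicate_h_neq by auto

lemma colour_recursion:
  assumes "\<not> (length y + 1) dvd k"
  shows "colour (replicate k gen_g @ gen_h # y) =
    colour ((tl ^^ (length y - k mod (length y + 1))) y)"
proof -
  have "takeWhile (\<lambda>x. x = gen_g) (replicate k gen_g @ gen_h # y) = replicate k gen_g"
    by (induction k) auto
  moreover have "dropWhile (\<lambda>x. x = gen_g) (replicate k gen_g @ gen_h # y) = gen_h # y"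
    by (induction k) auto
  ultimately show ?thesis
    using assms by (subst colour.simps) (simp add: replicate_h_in_colours_iff Let_def)
qed

lemma word_cases:
  obtains k where "s = replicate k gen_g" | k y where "s = replicate k gen_g @ gen_h # y"
proof (induction s arbitrary: thesis)
  case Nil
  then show ?case by (metis replicate_0)
next
  case (Cons x s)
  show ?case
  proof (cases x)
    case gen_g
    then show ?thesis using Cons by (metis append_Cons replicate_Suc)
  next
    case gen_h
    then show ?thesis using Cons(3)[of 0 s] by simp
  qed
qed

lemma colour_step_length:
  fixes y :: word
  assumes "\<not> (length y + 1) dvd k"
  shows "(tl ^^ (length y - k mod (length y + 1))) y \<noteq> []"
    and "length ((tl ^^ (length y - k mod (length y + 1))) y) \<le> length y"
proof -
  have "0 < k mod (length y + 1)" using assms by (simp add: dvd_eq_mod_eq_0)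
  moreover have "k mod (length y + 1) \<le> length y"
    using mod_less_divisor[of "length y + 1" k] by linarith
  ultimately have "length ((tl ^^ (length y - k mod (length y + 1))) y) > 0"
    unfolding tl_funpow length_drop by linarith
  then show "(tl ^^ (length y - k mod (length y + 1))) y \<noteq> []" by blast
qed (rule length_funpow_tl)

lemma colour_mem: "s \<noteq> [] \<Longrightarrow> colour s \<in> colours \<and> length (colour s) \<le> length s"
proof (induction s rule: length_induct)
  case (1 s)
  show ?case
  proof (cases "s \<in> colours")
    case False
    obtain k y where s: "s = replicate k gen_g @ gen_h # y"
      using word_cases[of s] False 1(2) by (force simp: colours_def Suc_le_eq)
    have nd: "\<not> (length y + 1) dvd k" using False s replicate_h_in_colours_iff by simp
    define z where "z = (tl ^^ (length y - k mod (length y + 1))) y"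
    have "z \<noteq> []" "length z < length s" using colour_step_length[OF nd] s by (auto simp: z_def)
    moreover have "colour s = colour z" using colour_recursion[OF nd] s z_def by simp
    ultimately show ?thesis using 1 by fastforce
  qed simp
qed

lemma gen_h_Cons_colour: "colour (gen_h # s) = gen_h # s"
  using replicate_h_in_colours_iff[of 0 s] by simp

lemma colour_g_neq_h: "colour (gen_g # s) \<noteq> colour (gen_h # s)"
proof
  assume eq: "colour (gen_g # s) = colour (gen_h # s)"
  then have e: "colour (gen_g # s) = gen_h # s" by (simp add: gen_h_Cons_colour)
  show False
  proof (cases "gen_g # s \<in> colours")
    case True
    then show ?thesis using e by simp
  next
    case False
    obtain k y where s: "gen_g # s = replicate k gen_g @ gen_h # y"
      using word_cases[of "gen_g # s"] False by (force simp: colours_def Suc_le_eq)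
    have nd: "\<not> (length y + 1) dvd k" using False s replicate_h_in_colours_iff by simp
    define z where "z = (tl ^^ (length y - k mod (length y + 1))) y"
    have "z \<noteq> []" "length z < length (gen_g # s)"
      using colour_step_length[OF nd] s by (auto simp: z_def)
    moreover have "colour (gen_g # s) = colour z"
      using colour_recursion[OF nd] s z_def by simp
    ultimately have "length (gen_h # s) < length (gen_h # s)"
      using colour_mem[of z] e by (metis le_less_trans length_Cons)
    then show ?thesis by simp
  qed
qed

lemma wt_pos: "0 < wt s" and wt_le_1: "wt s \<le> 1"
  by (simp_all add: wt_def)

lemma Wt_Nil [simp]: "Wt [] = 1"
  by (simp add: Wt_def)

lemma Wt_Cons: "Wt (x # s) = wt (x # s) * Wt s"
  by (simp add: Wt_def tl_funpow prod.lessThan_Suc_shift del: prod.lessThan_Suc)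

lemma Wt_pos: "0 < Wt s"
  by (simp add: Wt_def prod_pos wt_pos)

lemma Wt_le_tl: "s \<noteq> [] \<Longrightarrow> Wt s \<le> Wt (tl s)"
  using Wt_pos[of "tl s"] wt_le_1[of s]
  by (cases s) (simp_all add: Wt_Cons mult_le_cancel_right1)


section \<open>The weighted Hilbert space\<close>

typedef hsp = "{x :: word \<Rightarrow> complex. (\<lambda>s. (Wt s)\<^sup>2 * (cmod (x s))\<^sup>2) summable_on UNIV}"
  morphisms hcoeff Hsp
  by (rule exI[of _ "\<lambda>_. 0"]) simp

setup_lifting type_definition_hsp

lemma weighted_mult_summable:
  fixes x y :: "word \<Rightarrow> complex"
  assumes x: "(\<lambda>s. (Wt s)\<^sup>2 * (cmod (x s))\<^sup>2) summable_on UNIV"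
    and y: "(\<lambda>s. (Wt s)\<^sup>2 * (cmod (y s))\<^sup>2) summable_on UNIV"
  shows "(\<lambda>s. (Wt s)\<^sup>2 * (x s \<bullet> y s)) summable_on UNIV"
proof (rule abs_summable_summable, rule Infinite_Sum.abs_summable_on_comparison_test')
  show "(\<lambda>s. (Wt s)\<^sup>2 * (cmod (x s))\<^sup>2 + (Wt s)\<^sup>2 * (cmod (y s))\<^sup>2) summable_on UNIV"
    by (rule summable_on_add[OF x y])
  fix s
  have "\<bar>x s \<bullet> y s\<bar> \<le> cmod (x s) * cmod (y s)" by (rule Cauchy_Schwarz_ineq2)
  also have "\<dots> \<le> (cmod (x s))\<^sup>2 + (cmod (y s))\<^sup>2"
    using sum_squares_bound[of "cmod (x s)" "cmod (y s)"]
      mult_nonneg_nonneg[OF norm_ge_zero[of "x s"] norm_ge_zero[of "y s"]]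
    by linarith
  finally have "(Wt s)\<^sup>2 * \<bar>x s \<bullet> y s\<bar> \<le> (Wt s)\<^sup>2 * ((cmod (x s))\<^sup>2 + (cmod (y s))\<^sup>2)"
    by (rule mult_left_mono) simp
  then show "norm ((Wt s)\<^sup>2 * (x s \<bullet> y s)) \<le> (Wt s)\<^sup>2 * (cmod (x s))\<^sup>2 + (Wt s)\<^sup>2 * (cmod (y s))\<^sup>2"
    by (simp add: abs_mult distrib_left)
qed

lemma weighted_add_summable:
  fixes x y :: "word \<Rightarrow> complex"
  assumes x: "(\<lambda>s. (Wt s)\<^sup>2 * (cmod (x s))\<^sup>2) summable_on UNIV"
    and y: "(\<lambda>s. (Wt s)\<^sup>2 * (cmod (y s))\<^sup>2) summable_on UNIV"
  shows "(\<lambda>s. (Wt s)\<^sup>2 * (cmod (x s + y s))\<^sup>2) summable_on UNIV"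
proof -
  have "(\<lambda>s. (Wt s)\<^sup>2 * (cmod (x s))\<^sup>2 + (2 * ((Wt s)\<^sup>2 * (x s \<bullet> y s)) + (Wt s)\<^sup>2 * (cmod (y s))\<^sup>2))
      summable_on UNIV"
    by (intro summable_on_add summable_on_cmult_right x y weighted_mult_summable)
  moreover have "(Wt s)\<^sup>2 * (cmod (x s + y s))\<^sup>2 =
      (Wt s)\<^sup>2 * (cmod (x s))\<^sup>2 + (2 * ((Wt s)\<^sup>2 * (x s \<bullet> y s)) + (Wt s)\<^sup>2 * (cmod (y s))\<^sup>2)" for s
    by (simp add: power2_norm_eq_inner inner_add_left inner_add_right inner_commute algebra_simps)
  ultimately show ?thesis by simp
qed

lemma weighted_scale_summable:
  fixes x :: "word \<Rightarrow> complex"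
  assumes "(\<lambda>s. (Wt s)\<^sup>2 * (cmod (x s))\<^sup>2) summable_on UNIV"
  shows "(\<lambda>s. (Wt s)\<^sup>2 * (cmod (c * x s))\<^sup>2) summable_on UNIV"
  using summable_on_cmult_right[OF assms, of "(cmod c)\<^sup>2"]
  by (simp add: norm_mult power_mult_distrib mult_ac)

lemma weighted_minus_summable:
  fixes x y :: "word \<Rightarrow> complex"
  assumes "(\<lambda>s. (Wt s)\<^sup>2 * (cmod (x s))\<^sup>2) summable_on UNIV"
    and "(\<lambda>s. (Wt s)\<^sup>2 * (cmod (y s))\<^sup>2) summable_on UNIV"
  shows "(\<lambda>s. (Wt s)\<^sup>2 * (cmod (x s - y s))\<^sup>2) summable_on UNIV"
  using weighted_add_summable[of x "\<lambda>s. - y s"] assms by simp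

text \<open>The inner product is the real part of the weighted complex one
  (note \<open>z \<bullet> w = Re (z * cnj w)\<close> on \<^typ>\<open>complex\<close>); it induces the norm of \<open>l\<^sup>2(S, W)\<close>,
  see \<open>norm_hsp_sq\<close> below.\<close>

instantiation hsp :: real_inner
begin

lift_definition zero_hsp :: hsp is "\<lambda>_. 0" by simp
lift_definition plus_hsp :: "hsp \<Rightarrow> hsp \<Rightarrow> hsp" is "\<lambda>x y s. x s + y s"
  by (rule weighted_add_summable)
lift_definition minus_hsp :: "hsp \<Rightarrow> hsp \<Rightarrow> hsp" is "\<lambda>x y s. x s - y s"
  by (rule weighted_minus_summable)
lift_definition uminus_hsp :: "hsp \<Rightarrow> hsp" is "\<lambda>x s. - x s" by simp
lift_definition scaleR_hsp :: "real \<Rightarrow> hsp \<Rightarrow> hsp" is "\<lambda>r x s. complex_of_real r * x s"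
  by (rule weighted_scale_summable)
lift_definition inner_hsp :: "hsp \<Rightarrow> hsp \<Rightarrow> real" is
  "\<lambda>x y. \<Sum>\<^sub>\<infinity>s. (Wt s)\<^sup>2 * (x s \<bullet> y s)" .
definition norm_hsp :: "hsp \<Rightarrow> real" where "norm_hsp x = sqrt (x \<bullet> x)"
definition dist_hsp :: "hsp \<Rightarrow> hsp \<Rightarrow> real" where "dist_hsp x y = norm (x - y)"
definition sgn_hsp :: "hsp \<Rightarrow> hsp" where "sgn_hsp x = inverse (norm x) *\<^sub>R x"
definition uniformity_hsp :: "(hsp \<times> hsp) filter" where
  "uniformity_hsp = (INF e\<in>{0<..}. principal {(x, y). dist x y < e})"
definition open_hsp :: "hsp set \<Rightarrow> bool" where
  "open_hsp U = (\<forall>x\<in>U. \<forall>\<^sub>F (x', y) in uniformity. x' = x \<longrightarrow> y \<in> U)"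

instance
proof
  fix x y z :: hsp and r r' :: real and U :: "hsp set"
  show "x + y + z = x + (y + z)" "x + y = y + x" "0 + x = x" "- x + x = 0" "x - y = x + - y"
    by (transfer; simp add: algebra_simps)+
  show "r *\<^sub>R (x + y) = r *\<^sub>R x + r *\<^sub>R y" "(r + r') *\<^sub>R x = r *\<^sub>R x + r' *\<^sub>R x"
    "r *\<^sub>R r' *\<^sub>R x = (r * r') *\<^sub>R x" "1 *\<^sub>R x = x"
    by (transfer; simp add: algebra_simps)+
  show "x \<bullet> y = y \<bullet> x" by transfer (simp add: inner_commute)
  show "(x + y) \<bullet> z = x \<bullet> z + y \<bullet> z"
    by transfer (simp add: inner_add_left distrib_left infsum_add weighted_mult_summable)
  show "(r *\<^sub>R x) \<bullet> y = r * (x \<bullet> y)"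
  proof transfer
    fix r and x y :: "word \<Rightarrow> complex"
    have "(Wt s)\<^sup>2 * ((complex_of_real r * x s) \<bullet> y s) = r * ((Wt s)\<^sup>2 * (x s \<bullet> y s))" for s
      using inner_scaleR_left[of r "x s" "y s"] by (simp add: scaleR_conv_of_real mult_ac)
    then show "(\<Sum>\<^sub>\<infinity>s. (Wt s)\<^sup>2 * ((complex_of_real r * x s) \<bullet> y s)) =
        r * (\<Sum>\<^sub>\<infinity>s. (Wt s)\<^sup>2 * (x s \<bullet> y s))"
      by (simp only: infsum_cmult_right')
  qed
  show "0 \<le> x \<bullet> x" by transfer (simp add: infsum_nonneg)
  show "x \<bullet> x = 0 \<longleftrightarrow> x = 0"
  proof transfer
    fix x :: "word \<Rightarrow> complex"
    assume x: "(\<lambda>s. (Wt s)\<^sup>2 * (cmod (x s))\<^sup>2) summable_on UNIV"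
    show "(\<Sum>\<^sub>\<infinity>s. (Wt s)\<^sup>2 * (x s \<bullet> x s)) = 0 \<longleftrightarrow> x = (\<lambda>_. 0)"
    proof
      assume 0: "(\<Sum>\<^sub>\<infinity>s. (Wt s)\<^sup>2 * (x s \<bullet> x s)) = 0"
      show "x = (\<lambda>_. 0)"
      proof
        fix s
        have "(Wt s)\<^sup>2 * (x s \<bullet> x s) = 0"
          using nonneg_infsum_le_0D[of "\<lambda>s. (Wt s)\<^sup>2 * (x s \<bullet> x s)" UNIV s] 0
            weighted_mult_summable[OF x x] by simp
        then show "x s = 0" using Wt_pos[of s] by simp
      qed
    qed simp
  qed
qed (simp_all add: norm_hsp_def dist_hsp_def sgn_hsp_def uniformity_hsp_def open_hsp_def)

end

lemma norm_hsp_sq: "(norm x)\<^sup>2 = (\<Sum>\<^sub>\<infinity>s. (Wt s)\<^sup>2 * (cmod (hcoeff x s))\<^sup>2)"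
  by (simp add: power2_norm_eq_inner inner_hsp.rep_eq)

instantiation hsp :: complex_normed_vector
begin

lift_definition scaleC_hsp :: "complex \<Rightarrow> hsp \<Rightarrow> hsp" is "\<lambda>c x s. c * x s"
  by (rule weighted_scale_summable)

instance
proof
  fix x y :: hsp and c d :: complex and r :: real
  show "c *\<^sub>C (x + y) = c *\<^sub>C x + c *\<^sub>C y" "(c + d) *\<^sub>C x = c *\<^sub>C x + d *\<^sub>C x"
    "c *\<^sub>C d *\<^sub>C x = (c * d) *\<^sub>C x" "r *\<^sub>R x = complex_of_real r *\<^sub>C x"
    by (transfer; simp add: algebra_simps)+
  have "(Wt s)\<^sup>2 * (cmod (hcoeff (c *\<^sub>C x) s))\<^sup>2 = (cmod c)\<^sup>2 * ((Wt s)\<^sup>2 * (cmod (hcoeff x s))\<^sup>2)" for s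
    by (simp add: scaleC_hsp.rep_eq norm_mult power_mult_distrib mult_ac)
  then have "(norm (c *\<^sub>C x))\<^sup>2 = (cmod c * norm x)\<^sup>2"
    unfolding power_mult_distrib norm_hsp_sq by (simp only: infsum_cmult_right')
  then show "norm (c *\<^sub>C x) = cmod c * norm x"
    by (simp add: power2_eq_iff_nonneg)
qed

end

lift_definition basis :: "word \<Rightarrow> hsp" is "\<lambda>s t. if t = s then 1 else 0"
proof -
  fix s :: word
  have "(\<lambda>t. (Wt t)\<^sup>2 * (cmod (if t = s then 1 else 0))\<^sup>2) summable_on {s}" by simp
  then show "(\<lambda>t. (Wt t)\<^sup>2 * (cmod (if t = s then 1 else 0))\<^sup>2) summable_on UNIV"
    by (rule summable_on_cong_neutral[THEN iffD1, rotated -1]) auto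
qed

lemma norm_basis: "norm (basis s) = Wt s"
proof -
  have "(norm (basis s))\<^sup>2 = (\<Sum>\<^sub>\<infinity>t\<in>{s}. (Wt t)\<^sup>2 * (cmod (hcoeff (basis s) t))\<^sup>2)"
    unfolding norm_hsp_sq by (rule infsum_cong_neutral) (auto simp: basis.rep_eq)
  also have "\<dots> = (Wt s)\<^sup>2" by (simp add: basis.rep_eq)
  finally show ?thesis using Wt_pos[of s] by (simp add: power2_eq_iff_nonneg)
qed

lemma hsp_eqI: "(\<And>s. hcoeff x s = hcoeff y s) \<Longrightarrow> x = y"
  by transfer auto

lemma hsp_summable: "(\<lambda>s. (Wt s)\<^sup>2 * (cmod (hcoeff x s))\<^sup>2) summable_on UNIV"
  using hcoeff by blast

lemma coeff_sum: "hcoeff (\<Sum>i\<in>F. f i) s = (\<Sum>i\<in>F. hcoeff (f i) s)"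
  by (induction F rule: infinite_finite_induct) (simp_all add: zero_hsp.rep_eq plus_hsp.rep_eq)

lemma has_sum_basis: "((\<lambda>s. hcoeff x s *\<^sub>C basis s) has_sum x) UNIV"
proof -
  let ?q = "\<lambda>s. (Wt s)\<^sup>2 * (cmod (hcoeff x s))\<^sup>2"
  let ?p = "\<lambda>F. \<Sum>s\<in>F. hcoeff x s *\<^sub>C basis s"
  have n: "(norm (?p F - x))\<^sup>2 = infsum ?q UNIV - sum ?q F" if F: "finite F" for F
  proof -
    have co: "hcoeff (?p F - x) s = (if s \<in> F then 0 else - hcoeff x s)" for s
      using F by (simp add: minus_hsp.rep_eq coeff_sum scaleC_hsp.rep_eq basis.rep_eq if_distrib
          cong: if_cong)
    have "(norm (?p F - x))\<^sup>2 = infsum ?q (- F)"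
      unfolding norm_hsp_sq by (rule infsum_cong_neutral) (auto simp: co)
    moreover have "infsum ?q UNIV = infsum ?q F + infsum ?q (- F)"
      using infsum_Un_disjoint[of ?q F "- F"] F summable_on_subset_banach[OF hsp_summable[of x], of "- F"]
      by simp
    ultimately show ?thesis using F by simp
  qed
  have "((\<lambda>F. infsum ?q UNIV - sum ?q F) \<longlongrightarrow> infsum ?q UNIV - infsum ?q UNIV)
      (finite_subsets_at_top UNIV)"
    by (intro tendsto_diff tendsto_const infsum_tendsto hsp_summable)
  then have "((\<lambda>F. sqrt (infsum ?q UNIV - sum ?q F)) \<longlongrightarrow> 0) (finite_subsets_at_top UNIV)"
    using tendsto_real_sqrt by fastforce
  moreover have "\<forall>\<^sub>F F in finite_subsets_at_top UNIV.
      sqrt (infsum ?q UNIV - sum ?q F) = norm (?p F - x)"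
    using real_sqrt_unique[OF n norm_ge_zero]
    by (intro eventually_finite_subsets_at_top_weakI) blast
  ultimately have "((\<lambda>F. norm (?p F - x)) \<longlongrightarrow> 0) (finite_subsets_at_top UNIV)"
    by (rule Lim_transform_eventually)
  then show ?thesis
    unfolding has_sum_def by (simp add: tendsto_norm_zero_iff LIM_zero_iff)
qed

lemma bop_eq_basisI:
  assumes "\<And>s. bop_apply T (basis s) = bop_apply U (basis s)"
  shows "T = U"
proof (rule bop_eqI)
  fix x
  have "((\<lambda>s. hcoeff x s *\<^sub>C bop_apply V (basis s)) has_sum bop_apply V x) UNIV" for V
    using has_sum_bounded_linear[OF bop_bl[of V] has_sum_basis[of x]] bop_clinear[of V]
    by (simp add: comp_def bounded_clinear_def)
  from this[of T] this[of U] show "bop_apply T x = bop_apply U x"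
    using assms by (auto intro: has_sum_unique)
qed


section \<open>The operators and the algebra\<close>

text \<open>Existence and uniqueness of the operator are \<open>Top_eq\<close> and \<open>bop_eq_basisI\<close>.\<close>

definition Top :: "word \<Rightarrow> hsp bop" where
  "Top c = (THE T. \<forall>s. bop_apply T (basis s) =
     (if colour (gen_g # s) = c then basis (gen_g # s)
      else if colour (gen_h # s) = c then basis (gen_h # s)
      else 0))"

lemma shift_summable:
  fixes x :: "word \<Rightarrow> complex"
  defines "y \<equiv> \<lambda>c t. if t \<noteq> [] \<and> colour t = c then x (tl t) else 0"
  assumes x: "(\<lambda>s. (Wt s)\<^sup>2 * (cmod (x s))\<^sup>2) summable_on UNIV"
  shows "(\<lambda>s. (Wt s)\<^sup>2 * (cmod (y c s))\<^sup>2) summable_on UNIV"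
    and "(\<Sum>\<^sub>\<infinity>s. (Wt s)\<^sup>2 * (cmod (y c s))\<^sup>2) \<le> (\<Sum>\<^sub>\<infinity>s. (Wt s)\<^sup>2 * (cmod (x s))\<^sup>2)"
proof -
  define A where "A = {t. t \<noteq> [] \<and> colour t = c}"
  let ?q = "\<lambda>s. (Wt s)\<^sup>2 * (cmod (x s))\<^sup>2"
  let ?r = "\<lambda>s. (Wt s)\<^sup>2 * (cmod (y c s))\<^sup>2"
  have inj: "inj_on tl A"
  proof (rule inj_onI)
    fix s t assume "s \<in> A" "t \<in> A" "tl s = tl t"
    then show "s = t"
      unfolding A_def using colour_g_neq_h
      by (cases s; cases t) (auto, metis gen.exhaust)
  qed
  have q: "?q summable_on tl ` A" by (rule summable_on_subset_banach[OF x]) simp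
  then have qA: "(?q \<circ> tl) summable_on A" using summable_on_reindex[OF inj] by blast
  have le: "?r s \<le> (?q \<circ> tl) s" if "s \<in> A" for s
  proof -
    have "(Wt s)\<^sup>2 \<le> (Wt (tl s))\<^sup>2"
      using that Wt_le_tl[of s] Wt_pos[of s] by (intro power_mono) (auto simp: A_def)
    then show ?thesis using that by (simp add: y_def A_def mult_right_mono)
  qed
  have rA: "?r summable_on A"
    by (rule summable_on_comparison_test[OF qA le]) auto
  have eq: "?r summable_on UNIV \<longleftrightarrow> ?r summable_on A"
    by (rule summable_on_cong_neutral) (auto simp: y_def A_def)
  show "?r summable_on UNIV" using rA eq by blast
  have "infsum ?r UNIV = infsum ?r A"
    by (rule infsum_cong_neutral) (auto simp: y_def A_def)
  also have "\<dots> \<le> infsum (?q \<circ> tl) A"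
    by (rule infsum_mono[OF rA qA le])
  also have "\<dots> = infsum ?q (tl ` A)" using infsum_reindex[OF inj, of ?q] by simp
  also have "\<dots> \<le> infsum ?q UNIV" by (rule infsum_mono2[OF q x]) auto
  finally show "infsum ?r UNIV \<le> infsum ?q UNIV" .
qed

lift_definition shift :: "word \<Rightarrow> hsp \<Rightarrow> hsp" is
  "\<lambda>c x t. if t \<noteq> [] \<and> colour t = c then x (tl t) else 0"
  by (rule shift_summable)

lemma shift_clinear: "bounded_clinear (shift c)"
proof (rule bounded_clinearI[where K = 1])
  show "shift c (x + y) = shift c x + shift c y" for x y by transfer auto
  show "shift c (d *\<^sub>C x) = d *\<^sub>C shift c x" for d x by transfer auto
  fix x
  have "(norm (shift c x))\<^sup>2 \<le> (norm x)\<^sup>2"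
    unfolding norm_hsp_sq shift.rep_eq by (rule shift_summable(2)[OF hsp_summable])
  then show "norm (shift c x) \<le> norm x * 1"
    using power2_le_imp_le norm_ge_zero by (metis mult.right_neutral)
qed

lemma shift_basis: "shift c (basis s) =
    (if colour (gen_g # s) = c then basis (gen_g # s)
     else if colour (gen_h # s) = c then basis (gen_h # s) else 0)"
proof (rule hsp_eqI)
  fix t
  show "hcoeff (shift c (basis s)) t = hcoeff
    (if colour (gen_g # s) = c then basis (gen_g # s)
     else if colour (gen_h # s) = c then basis (gen_h # s) else 0) t"
  proof (cases t)
    case Nil
    then show ?thesis by (simp add: shift.rep_eq basis.rep_eq zero_hsp.rep_eq)
  next
    case (Cons a u)
    then show ?thesis using colour_g_neq_h[of s]
      by (cases a) (auto simp: shift.rep_eq basis.rep_eq zero_hsp.rep_eq)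
  qed
qed

lemma Top_eq: "Top c = Bop (shift c)"
  unfolding Top_def
proof (rule the_equality)
  show "\<forall>s. bop_apply (Bop (shift c)) (basis s) =
     (if colour (gen_g # s) = c then basis (gen_g # s)
      else if colour (gen_h # s) = c then basis (gen_h # s) else 0)"
    by (simp add: bop_apply_Bop[OF shift_clinear] shift_basis)
  show "T = Bop (shift c)" if "\<forall>s. bop_apply T (basis s) =
     (if colour (gen_g # s) = c then basis (gen_g # s)
      else if colour (gen_h # s) = c then basis (gen_h # s) else 0)" for T
    by (rule bop_eq_basisI) (simp add: that bop_apply_Bop[OF shift_clinear] shift_basis)
qed

lemma Top_basis: "bop_apply (Top c) (basis s) =
    (if colour (gen_g # s) = c then basis (gen_g # s)
     else if colour (gen_h # s) = c then basis (gen_h # s) else 0)"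
  by (simp add: Top_eq bop_apply_Bop[OF shift_clinear] shift_basis)

lemma coeff_Top:
  "hcoeff (bop_apply (Top c) x) t = (if t \<noteq> [] \<and> colour t = c then hcoeff x (tl t) else 0)"
  by (simp add: Top_eq bop_apply_Bop[OF shift_clinear] shift.rep_eq)

definition alg0 :: "hsp bop set" where
  "alg0 = csubalgebra hull (Top ` colours)"

lemma csubalgebra_alg: "csubalgebra (closure alg0)"
  unfolding alg0_def by (intro csubalgebra_closure csubalgebra_hull)

typedef alg = "closure alg0"
  morphisms of_alg Alg
  using csubalgebra_alg by (auto simp: csubalgebra_def csubspace_def)

setup_lifting type_definition_alg

instantiation alg :: complex_normed_algebra
begin

lift_definition zero_alg :: alg is 0
  using csubalgebra_alg by (simp add: csubalgebra_def csubspace_def)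
lift_definition plus_alg :: "alg \<Rightarrow> alg \<Rightarrow> alg" is "(+)"
  using csubalgebra_alg by (simp add: csubalgebra_def csubspace_def)
lift_definition scaleC_alg :: "complex \<Rightarrow> alg \<Rightarrow> alg" is scaleC
  using csubalgebra_alg by (simp add: csubalgebra_def csubspace_def)
lift_definition times_alg :: "alg \<Rightarrow> alg \<Rightarrow> alg" is "(*)"
  using csubalgebra_alg by (simp add: csubalgebra_def csubspace_def)
lift_definition scaleR_alg :: "real \<Rightarrow> alg \<Rightarrow> alg" is scaleR
  using csubalgebra_alg by (simp add: csubalgebra_def csubspace_def scaleR_scaleC)
lift_definition uminus_alg :: "alg \<Rightarrow> alg" is uminus
proof -
  fix f assume "f \<in> closure alg0"
  then have "(-1) *\<^sub>C f \<in> closure alg0"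
    using csubalgebra_alg by (simp add: csubalgebra_def csubspace_def)
  then show "- f \<in> closure alg0"
    using scaleR_scaleC[of "-1" f] by simp
qed
lift_definition minus_alg :: "alg \<Rightarrow> alg \<Rightarrow> alg" is "(-)"
proof -
  fix f g assume "f \<in> closure alg0" "g \<in> closure alg0"
  then have "f + (-1) *\<^sub>C g \<in> closure alg0"
    using csubalgebra_alg by (simp add: csubalgebra_def csubspace_def)
  moreover have "- g = (-1) *\<^sub>C g"
    using scaleR_scaleC[of "-1" g] by simp
  ultimately show "f - g \<in> closure alg0"
    by (simp only: diff_conv_add_uminus)
qed
lift_definition norm_alg :: "alg \<Rightarrow> real" is norm .
definition dist_alg :: "alg \<Rightarrow> alg \<Rightarrow> real" where "dist_alg f g = norm (f - g)"
definition sgn_alg :: "alg \<Rightarrow> alg" where "sgn_alg f = inverse (norm f) *\<^sub>R f"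
definition uniformity_alg :: "(alg \<times> alg) filter" where
  "uniformity_alg = (INF e\<in>{0<..}. principal {(x, y). dist x y < e})"
definition open_alg :: "alg set \<Rightarrow> bool" where
  "open_alg U = (\<forall>x\<in>U. \<forall>\<^sub>F (x', y) in uniformity. x' = x \<longrightarrow> y \<in> U)"

instance
proof
  fix f g h :: alg and r r' :: real and c d :: complex and U :: "alg set"
  show "f + g + h = f + (g + h)" "f + g = g + f" "0 + f = f" "- f + f = 0" "f - g = f + - g"
    by (transfer; simp add: algebra_simps)+
  show "r *\<^sub>R (f + g) = r *\<^sub>R f + r *\<^sub>R g" "(r + r') *\<^sub>R f = r *\<^sub>R f + r' *\<^sub>R f"
    "r *\<^sub>R r' *\<^sub>R f = (r * r') *\<^sub>R f" "1 *\<^sub>R f = f"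
    by (transfer; simp add: algebra_simps)+
  show "c *\<^sub>C (f + g) = c *\<^sub>C f + c *\<^sub>C g" "(c + d) *\<^sub>C f = c *\<^sub>C f + d *\<^sub>C f"
    "c *\<^sub>C d *\<^sub>C f = (c * d) *\<^sub>C f" "r *\<^sub>R f = complex_of_real r *\<^sub>C f"
    by (transfer; simp add: scaleC_add_right scaleC_add_left scaleC_scaleC scaleR_scaleC)+
  show "f * g * h = f * (g * h)" "(f + g) * h = f * h + g * h" "f * (g + h) = f * g + f * h"
    "r *\<^sub>R f * g = r *\<^sub>R (f * g)" "f * r *\<^sub>R g = r *\<^sub>R (f * g)"
    by (transfer; simp add: algebra_simps)+
  show "c *\<^sub>C f * g = c *\<^sub>C (f * g)" by transfer (rule mult_scaleC_left)
  show "f * c *\<^sub>C g = c *\<^sub>C (f * g)" by transfer (rule mult_scaleC_right)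
  show "norm (c *\<^sub>C f) = cmod c * norm f" by transfer (rule norm_scaleC)
  show "norm (r *\<^sub>R f) = \<bar>r\<bar> * norm f" by transfer simp
  show "norm (f + g) \<le> norm f + norm g" by transfer (rule norm_triangle_ineq)
  show "norm f = 0 \<longleftrightarrow> f = 0" by transfer simp
  show "norm (f * g) \<le> norm f * norm g" by transfer (rule norm_mult_ineq)
qed (simp_all add: dist_alg_def sgn_alg_def uniformity_alg_def open_alg_def)

end

end

theory Submission
  imports Defs
begin

text \<open>An operator in the algebra is a matrix indexed by pairs consisting of a word and a proper suffix
  of it, and the entry depends only on the colours met between the two words. A path that meets no
  element of \<^const>\<open>colours\<close> lies in a run of letters \<open>g\<close> and copies a path nearer to the unit, with a
  weight smaller by at least a factor \<open>2\<^sup>k\<close>, where \<open>k\<close> is the number of steps. So, up to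
  equivalence of norms, the algebra is a space of compact operators spanned by matrix units, its dual is the closed span of the matrix coefficients,
  and a nonzero \<open>\<Phi>\<close> in the bidual has a nonzero matrix coefficient \<open>\<alpha>\<close>, on a path that ends at \<open>u\<close>,
  say. Above \<open>h u\<close> the run \<open>g\<^sup>i h u\<close> shows the colours of the way from the unit to \<open>u\<close> over and over,
  separated by new colours. The bidual contains signed sums \<open>\<Psi>\<close> of the operators crossing the
  separators, and along the run the weights decay only geometrically. With suitable signs and a large
  scalar \<open>\<mu>\<close>, the matrix of a quasi-inverse of \<open>\<mu> \<Psi> \<Phi>\<close> grows faster than the reciprocal weights, so there
  is no quasi-inverse and some maximal modular left ideal misses \<open>\<Phi>\<close>.\<close>

section \<open>Quasi-regularity and the radical\<close>

lemma left_ideal_add: "left_ideal L \<Longrightarrow> x \<in> L \<Longrightarrow> y \<in> L \<Longrightarrow> x + y \<in> L"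
  by (simp add: left_ideal_def csubspace_def)

lemma left_ideal_mult: "left_ideal L \<Longrightarrow> x \<in> L \<Longrightarrow> a * x \<in> L"
  by (simp add: left_ideal_def)

lemma left_ideal_scaleC: "left_ideal L \<Longrightarrow> x \<in> L \<Longrightarrow> c *\<^sub>C x \<in> L"
  by (simp add: left_ideal_def csubspace_def)

lemma left_ideal_zero: "left_ideal L \<Longrightarrow> 0 \<in> L"
  by (simp add: left_ideal_def csubspace_def)

text \<open>This is \<open>A(1 - q)\<close> written without a unit. Modulo it \<open>q\<close> acts
  as a right identity, so every left ideal containing it is modular.\<close>

lemma left_ideal_range_quasi:
  fixes q :: "'a::complex_normed_algebra"
  shows "left_ideal (range (\<lambda>b. b - b * q))"
  unfolding left_ideal_def csubspace_def
proof (intro conjI ballI allI)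
  show "0 \<in> range (\<lambda>b. b - b * q)" by (rule range_eqI[of _ _ 0]) simp
  fix x assume "x \<in> range (\<lambda>b. b - b * q)"
  then obtain b where b: "x = b - b * q" by blast
  show "a * x \<in> range (\<lambda>b. b - b * q)" for a
    by (rule range_eqI[of _ _ "a * b"]) (simp add: b right_diff_distrib mult.assoc)
  show "c *\<^sub>C x \<in> range (\<lambda>b. b - b * q)" for c
    by (rule range_eqI[of _ _ "c *\<^sub>C b"])
      (simp add: b mult_scaleC_left bounded_linear.linear[OF bounded_linear_scaleC] linear_diff)
  fix y assume "y \<in> range (\<lambda>b. b - b * q)"
  then obtain d where d: "y = d - d * q" by blast
  show "x + y \<in> range (\<lambda>b. b - b * q)"
    by (rule range_eqI[of _ _ "b + d"]) (simp add: b d algebra_simps)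
qed

lemma left_ideal_Union_chain:
  assumes "\<And>L. L \<in> C \<Longrightarrow> left_ideal L" "C \<noteq> {}" "subset.chain A C"
  shows "left_ideal (\<Union>C)"
  unfolding left_ideal_def csubspace_def
proof (intro conjI ballI allI)
  show "0 \<in> \<Union>C" using assms(1,2) left_ideal_zero by blast
  fix x assume "x \<in> \<Union>C"
  then obtain L where L: "L \<in> C" "x \<in> L" by blast
  show "a * x \<in> \<Union>C" for a using L assms(1) left_ideal_mult by blast
  show "c *\<^sub>C x \<in> \<Union>C" for c using L assms(1) left_ideal_scaleC by blast
  fix y assume "y \<in> \<Union>C"
  then obtain M where M: "M \<in> C" "y \<in> M" by blast
  have "L \<subseteq> M \<or> M \<subseteq> L" using assms(3) L(1) M(1) by (auto simp: subset.chain_def)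
  then show "x + y \<in> \<Union>C" using L M assms(1) left_ideal_add by blast
qed

text \<open>The hypothesis says that \<open>q = y * x\<close> has no left quasi-inverse, that is,
  \<open>q\<close> lies outside \<open>L = A(1 - q)\<close>. Zorn gives a left ideal
  \<open>M\<close> maximal among those that contain \<open>L\<close> and omit \<open>q\<close>; it
  is maximal modular, and \<open>x\<close> in \<open>M\<close> would force \<open>q\<close> in
  \<open>M\<close>.\<close>

lemma not_in_jacobson_radical:
  fixes x y :: "'a::complex_normed_algebra"
  assumes "\<And>b. b - b * (y * x) \<noteq> y * x"
  shows "x \<notin> jacobson_radical"
proof -
  define q where "q = y * x"
  define L where "L = range (\<lambda>b. b - b * q)"
  have L: "left_ideal L" unfolding L_def by (rule left_ideal_range_quasi)
  have qL: "q \<notin> L" using assms[symmetric] unfolding L_def q_def by (simp add: image_iff)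
  define \<A> where "\<A> = {M. left_ideal M \<and> L \<subseteq> M \<and> q \<notin> M}"
  have "\<exists>M\<in>\<A>. \<forall>X\<in>\<A>. M \<subseteq> X \<longrightarrow> X = M"
  proof (rule subset_Zorn_nonempty)
    show "\<A> \<noteq> {}" using L qL unfolding \<A>_def by blast
    fix C assume C: "C \<noteq> {}" "subset.chain \<A> C"
    then have "C \<subseteq> \<A>" by (simp add: subset.chain_def)
    then show "\<Union>C \<in> \<A>"
      using left_ideal_Union_chain[of C \<A>] C unfolding \<A>_def by blast
  qed
  then obtain M where M: "M \<in> \<A>" and max: "\<And>X. X \<in> \<A> \<Longrightarrow> M \<subseteq> X \<Longrightarrow> X = M" by blast
  \<comment> \<open>Since \<open>a = (a - a * q) + a * q\<close>, a left ideal above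
    \<open>L\<close> is proper exactly when it omits \<open>q\<close>.\<close>
  have lift: "X = UNIV" if "left_ideal X" "L \<subseteq> X" "q \<in> X" for X
  proof -
    have "(a - a * q) + a * q \<in> X" for a
      using that by (intro left_ideal_add left_ideal_mult) (auto simp: L_def)
    then show ?thesis by auto
  qed
  have "maximal_modular_left_ideal M"
    unfolding maximal_modular_left_ideal_def modular_left_ideal_def
  proof (intro conjI allI impI)
    show "left_ideal M" "M \<noteq> UNIV" using M by (auto simp: \<A>_def)
    show "\<exists>u. \<forall>a. a - a * u \<in> M" using M by (auto simp: \<A>_def L_def)
    fix X assume "left_ideal X \<and> M \<subseteq> X"
    then show "X = M \<or> X = UNIV"
      using M max[of X] lift[of X] unfolding \<A>_def by blast
  qed
  moreover have "x \<notin> M" using M left_ideal_mult[of M x y] by (auto simp: \<A>_def q_def)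
  ultimately show ?thesis unfolding jacobson_radical_def by blast
qed


section \<open>Matrix entries of operators\<close>

text \<open>Operators in the algebra move a basis vector only to words having it as a proper suffix, so
  a matrix entry is indexed by the target \<open>t\<close> and the number \<open>k\<close> of letters added.\<close>

definition entry :: "hsp bop \<Rightarrow> nat \<Rightarrow> word \<Rightarrow> complex" where
  "entry a k t = hcoeff (bop_apply a (basis (drop k t))) t"

definition strictly_lower :: "hsp bop \<Rightarrow> bool" where
  "strictly_lower a \<longleftrightarrow>
    (\<forall>s t. (\<forall>k\<in>{1..length t}. s \<noteq> drop k t) \<longrightarrow> hcoeff (bop_apply a (basis s)) t = 0)"

text \<open>For \<open>k \<le> length t\<close> this is \<open>Wt t / Wt (drop k t)\<close>, the
  norm of the matrix unit sending \<open>basis (drop k t)\<close> to \<open>basis t\<close>.\<close>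

definition path_weight :: "nat \<Rightarrow> word \<Rightarrow> real" where
  "path_weight k t = (\<Prod>i<k. wt (drop i t))"

lemma path_weight_nonneg: "0 \<le> path_weight k t"
  by (simp add: path_weight_def prod_nonneg wt_pos less_imp_le)

lemma path_weight_le_1: "path_weight k t \<le> 1"
  by (simp add: path_weight_def prod_le_1 wt_pos wt_le_1 less_imp_le)

lemma Wt_drop: "k \<le> length t \<Longrightarrow> Wt t = path_weight k t * Wt (drop k t)"
proof (induction k)
  case 0
  then show ?case by (simp add: path_weight_def)
next
  case (Suc k)
  then obtain x u where u: "drop k t = x # u" by (metis Cons_nth_drop_Suc Suc_le_lessD)
  then have "drop (Suc k) t = u" by (metis drop_Suc list.sel(3) tl_drop)
  then show ?case using Suc u by (simp add: path_weight_def Wt_Cons)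
qed

lemma hcoeff_bound: "Wt t * cmod (hcoeff x t) \<le> norm x"
proof -
  have "(Wt t * cmod (hcoeff x t))\<^sup>2 = (\<Sum>s\<in>{t}. (Wt s)\<^sup>2 * (cmod (hcoeff x s))\<^sup>2)"
    by (simp add: power_mult_distrib)
  also have "\<dots> \<le> (norm x)\<^sup>2"
    unfolding norm_hsp_sq by (rule finite_sum_le_infsum[OF hsp_summable]) auto
  finally show ?thesis using power2_le_imp_le norm_ge_zero by blast
qed

lemma hcoeff_clinear: "bounded_clinear (\<lambda>x. hcoeff x t)"
proof (rule bounded_clinearI)
  show "norm (hcoeff x t) \<le> norm x * (1 / Wt t)" for x
    using hcoeff_bound[of t x] Wt_pos[of t] by (simp add: field_simps)
qed (simp_all add: plus_hsp.rep_eq scaleC_hsp.rep_eq scaleC_complex_def)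

lemma bop_norm_bound: "norm (bop_apply a x) \<le> norm a * norm x"
  unfolding norm_bop.rep_eq by (rule onorm[OF bop_bl])

lemma matrix_coeff_clinear: "bounded_clinear (\<lambda>a. hcoeff (bop_apply a (basis s)) t)"
proof (rule bounded_clinear_compose[OF hcoeff_clinear], rule bounded_clinearI)
  show "norm (bop_apply a (basis s)) \<le> norm a * Wt s" for a
    using bop_norm_bound[of a "basis s"] by (simp add: norm_basis)
qed (simp_all add: plus_bop.rep_eq scaleC_bop.rep_eq)

lemma entry_clinear: "bounded_clinear (\<lambda>a. entry a k t)"
  unfolding entry_def by (rule matrix_coeff_clinear)

lemma entry_add: "entry (a + b) k t = entry a k t + entry b k t"
  by (simp add: entry_def plus_bop.rep_eq plus_hsp.rep_eq)

lemma entry_diff: "entry (a - b) k t = entry a k t - entry b k t"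
  by (simp add: entry_def minus_bop.rep_eq minus_hsp.rep_eq)

lemma entry_scaleC: "entry (c *\<^sub>C a) k t = c * entry a k t"
  by (simp add: entry_def scaleC_bop.rep_eq scaleC_hsp.rep_eq)

lemma entry_zero: "entry 0 k t = 0"
  by (simp add: entry_def zero_bop.rep_eq zero_hsp.rep_eq)

lemma entry_sum: "entry (\<Sum>i\<in>F. a i) k t = (\<Sum>i\<in>F. entry (a i) k t)"
  by (induction F rule: infinite_finite_induct) (simp_all add: entry_add entry_zero)

lemma entry_bound:
  assumes "k \<le> length t"
  shows "cmod (entry a k t) * path_weight k t \<le> norm a"
proof -
  have "Wt t * cmod (entry a k t) \<le> norm a * Wt (drop k t)"
    unfolding entry_def
    using hcoeff_bound[of t "bop_apply a (basis (drop k t))"]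
      bop_norm_bound[of a "basis (drop k t)"]
    by (simp add: norm_basis)
  then show ?thesis
    using Wt_pos[of "drop k t"] by (simp add: Wt_drop[OF assms] mult_ac)
qed

lemma strictly_lowerD:
  "strictly_lower a \<Longrightarrow> (\<And>k. k \<in> {1..length t} \<Longrightarrow> s \<noteq> drop k t) \<Longrightarrow>
    hcoeff (bop_apply a (basis s)) t = 0"
  by (simp add: strictly_lower_def)

lemma strictly_lower_add: "strictly_lower a \<Longrightarrow> strictly_lower b \<Longrightarrow> strictly_lower (a + b)"
  by (simp add: strictly_lower_def plus_bop.rep_eq plus_hsp.rep_eq)

lemma strictly_lower_diff: "strictly_lower a \<Longrightarrow> strictly_lower b \<Longrightarrow> strictly_lower (a - b)"
  by (simp add: strictly_lower_def minus_bop.rep_eq minus_hsp.rep_eq)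

lemma strictly_lower_zero: "strictly_lower 0"
  by (simp add: strictly_lower_def zero_bop.rep_eq zero_hsp.rep_eq)

lemma strictly_lower_scaleC: "strictly_lower a \<Longrightarrow> strictly_lower (c *\<^sub>C a)"
  by (simp add: strictly_lower_def scaleC_bop.rep_eq scaleC_hsp.rep_eq)

lemma strictly_lower_sum: "(\<And>i. i \<in> F \<Longrightarrow> strictly_lower (a i)) \<Longrightarrow> strictly_lower (\<Sum>i\<in>F. a i)"
  by (induction F rule: infinite_finite_induct) (simp_all add: strictly_lower_add strictly_lower_zero)

lemma inj_on_drop: "inj_on (\<lambda>k. drop k t) {..length t}"
proof (rule inj_onI)
  fix i j assume "i \<in> {..length t}" "j \<in> {..length t}" "drop i t = drop j t"
  then have "length t - i = length t - j" by (metis length_drop)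
  then show "i = j" using \<open>i \<in> _\<close> \<open>j \<in> _\<close> by auto
qed

text \<open>A word has finitely many suffixes, so every row of the matrix is finite and the operator
  acts by finite sums.\<close>

lemma hcoeff_apply:
  assumes "strictly_lower a"
  shows "hcoeff (bop_apply a x) t = (\<Sum>k=1..length t. entry a k t * hcoeff x (drop k t))"
proof -
  let ?K = "(\<lambda>k. drop k t) ` {1..length t}"
  let ?f = "\<lambda>s. hcoeff x s * hcoeff (bop_apply a (basis s)) t"
  have "bounded_clinear (\<lambda>x. hcoeff (bop_apply a x) t)"
    by (rule bounded_clinear_compose[OF hcoeff_clinear bop_clinear])
  then have "(?f has_sum hcoeff (bop_apply a x) t) UNIV"
    using has_sum_bounded_linear[OF _ has_sum_basis[of x], of "\<lambda>x. hcoeff (bop_apply a x) t"]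
    by (simp add: comp_def bounded_clinear_def scaleC_complex_def)
  moreover have "(?f has_sum sum ?f ?K) UNIV"
    by (rule has_sum_finite_neutralI) (auto intro!: strictly_lowerD[OF assms])
  ultimately have "hcoeff (bop_apply a x) t = sum ?f ?K" by (rule has_sum_unique)
  also have "\<dots> = (\<Sum>k=1..length t. entry a k t * hcoeff x (drop k t))"
    by (subst sum.reindex[OF inj_on_subset[OF inj_on_drop]]) (auto simp: entry_def mult.commute)
  finally show ?thesis .
qed

lemma sum_half_powers_le: "(\<Sum>k=1..n. 1 / 2 ^ k) \<le> (1::real)"
proof -
  have "(\<Sum>k=1..n. 1 / 2 ^ k) = 1 - 1 / (2::real) ^ n"
    by (induction n) (simp_all add: field_simps)
  then show ?thesis by simp
qed

text \<open>Cauchy-Schwarz with the weights \<open>1 / 2 ^ k\<close>, whose total mass is at most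
  \<open>1\<close>.\<close>

lemma square_sum_half_powers_le:
  fixes p :: "nat \<Rightarrow> real"
  shows "(\<Sum>k=1..n. 1 / 2 ^ k * p k)\<^sup>2 \<le> (\<Sum>k=1..n. 1 / 2 ^ k * (p k)\<^sup>2)"
proof -
  let ?r = "\<lambda>k::nat. sqrt (1 / 2 ^ k)"
  have r: "?r k * ?r k = 1 / 2 ^ k" for k by (simp flip: power2_eq_square)
  have "(\<Sum>k=1..n. 1 / 2 ^ k * p k)\<^sup>2 = (\<Sum>k=1..n. ?r k * (?r k * p k))\<^sup>2"
    by (simp only: mult.assoc[symmetric] r)
  also have "\<dots> \<le> (\<Sum>k=1..n. (?r k)\<^sup>2) * (\<Sum>k=1..n. (?r k * p k)\<^sup>2)"
    by (rule Cauchy_Schwarz_ineq_sum)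
  also have "\<dots> = (\<Sum>k=1..n. 1 / 2 ^ k) * (\<Sum>k=1..n. 1 / 2 ^ k * (p k)\<^sup>2)"
    by (simp add: power_mult_distrib)
  also have "\<dots> \<le> 1 * (\<Sum>k=1..n. 1 / 2 ^ k * (p k)\<^sup>2)"
    by (intro mult_right_mono sum_half_powers_le sum_nonneg) simp
  finally show ?thesis by simp
qed

text \<open>On a fixed diagonal \<open>k\<close> the operator acts by \<open>s \<mapsto> g\<^sup>k s\<close>, which is injective, so its norm
  is the supremum of the normalised entries; the diagonals sum up geometrically.\<close>

lemma norm_le_of_g_runs:
  assumes low: "strictly_lower a" and K: "0 \<le> K"
    and run: "\<And>k t. 1 \<le> k \<Longrightarrow> k \<le> length t \<Longrightarrow> entry a k t \<noteq> 0 \<Longrightarrow>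
      take k t = replicate k gen_g"
    and bound: "\<And>k t. 1 \<le> k \<Longrightarrow> k \<le> length t \<Longrightarrow>
      cmod (entry a k t) * path_weight k t \<le> K / 2 ^ k"
  shows "norm a \<le> K"
  unfolding norm_bop.rep_eq
proof (rule onorm_bound[OF K])
  fix x
  define q where "q s = (Wt s)\<^sup>2 * (cmod (hcoeff x s))\<^sup>2" for s
  define G where "G k = {t. k \<le> length t \<and> take k t = replicate k gen_g}" for k
  have q0: "0 \<le> q s" for s by (simp add: q_def)
  have qsum: "q summable_on UNIV" unfolding q_def by (rule hsp_summable)
  \<comment> \<open>\<open>bound\<close> turns each row into a sum with weights
    \<open>1 / 2 ^ k\<close>, to which the weighted Cauchy-Schwarz inequality applies.\<close>
  have pt: "(Wt t)\<^sup>2 * (cmod (hcoeff (bop_apply a x) t))\<^sup>2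
      \<le> K\<^sup>2 * (\<Sum>k=1..length t. 1 / 2 ^ k * (if t \<in> G k then q (drop k t) else 0))" for t
  proof -
    let ?p = "\<lambda>k. if t \<in> G k then Wt (drop k t) * cmod (hcoeff x (drop k t)) else 0"
    have summand: "Wt t * (cmod (entry a k t) * cmod (hcoeff x (drop k t))) \<le> K * (1 / 2 ^ k * ?p k)"
      if k: "k \<in> {1..length t}" for k
    proof (cases "t \<in> G k")
      case True
      have "cmod (entry a k t) * path_weight k t * (Wt (drop k t) * cmod (hcoeff x (drop k t)))
          \<le> K / 2 ^ k * (Wt (drop k t) * cmod (hcoeff x (drop k t)))"
        using k bound[of k t] Wt_pos[of "drop k t"] by (intro mult_right_mono) auto
      then show ?thesis using k True by (simp add: Wt_drop[of k t] mult_ac)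
    next
      case False
      then have "entry a k t = 0" using k run[of k t] unfolding G_def by auto
      then show ?thesis using K False by simp
    qed
    have "Wt t * cmod (hcoeff (bop_apply a x) t)
        \<le> Wt t * (\<Sum>k=1..length t. cmod (entry a k t) * cmod (hcoeff x (drop k t)))"
      unfolding hcoeff_apply[OF low] norm_mult[symmetric]
      using Wt_pos[of t] by (intro mult_left_mono norm_sum) auto
    also have "\<dots> \<le> K * (\<Sum>k=1..length t. 1 / 2 ^ k * ?p k)"
      unfolding sum_distrib_left by (rule sum_mono) (rule summand)
    finally have "(Wt t * cmod (hcoeff (bop_apply a x) t))\<^sup>2
        \<le> (K * (\<Sum>k=1..length t. 1 / 2 ^ k * ?p k))\<^sup>2"
      using Wt_pos[of t] by (intro power_mono) auto
    also have "\<dots> \<le> K\<^sup>2 * (\<Sum>k=1..length t. 1 / 2 ^ k * (?p k)\<^sup>2)"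
      unfolding power_mult_distrib by (intro mult_left_mono square_sum_half_powers_le) simp
    also have "\<dots> = K\<^sup>2 * (\<Sum>k=1..length t. 1 / 2 ^ k * (if t \<in> G k then q (drop k t) else 0))"
      by (intro arg_cong2[of _ _ _ _ "(*)"] sum.cong refl) (simp add: q_def power_mult_distrib)
    finally show ?thesis by (simp add: power_mult_distrib)
  qed
  have fin: "(\<Sum>t\<in>F. (Wt t)\<^sup>2 * (cmod (hcoeff (bop_apply a x) t))\<^sup>2) \<le> K\<^sup>2 * (norm x)\<^sup>2"
    if F: "finite F" for F
  proof -
    define L where "L = Max (insert 0 (length ` F))"
    have L: "length t \<le> L" if "t \<in> F" for t unfolding L_def using F that by (intro Max_ge) auto
    \<comment> \<open>On \<open>G k\<close> the deleted letters are all \<open>gen_g\<close>, so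
      \<open>drop k\<close> is injective there and each \<open>q s\<close> is counted at most once
      per diagonal.\<close>
    have col: "(\<Sum>t\<in>F. if t \<in> G k then q (drop k t) else 0) \<le> infsum q UNIV" for k
    proof -
      have inj: "inj_on (drop k) (F \<inter> G k)"
      proof (rule inj_onI)
        fix s t assume "s \<in> F \<inter> G k" "t \<in> F \<inter> G k" "drop k s = drop k t"
        then show "s = t"
          using append_take_drop_id[of k s] append_take_drop_id[of k t] by (simp add: G_def)
      qed
      have "(\<Sum>t\<in>F. if t \<in> G k then q (drop k t) else 0) = (\<Sum>t\<in>F \<inter> G k. q (drop k t))"
        using F by (simp add: sum.inter_restrict)
      also have "\<dots> = sum q (drop k ` (F \<inter> G k))" by (simp add: sum.reindex[OF inj])
      also have "\<dots> \<le> infsum q UNIV"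
        using F by (intro finite_sum_le_infsum qsum) (auto intro: q0)
      finally show ?thesis .
    qed
    have "(\<Sum>t\<in>F. (Wt t)\<^sup>2 * (cmod (hcoeff (bop_apply a x) t))\<^sup>2)
        \<le> (\<Sum>t\<in>F. K\<^sup>2 * (\<Sum>k=1..L. 1 / 2 ^ k * (if t \<in> G k then q (drop k t) else 0)))"
    proof (rule sum_mono)
      fix t assume t: "t \<in> F"
      have "(\<Sum>k=1..length t. 1 / 2 ^ k * (if t \<in> G k then q (drop k t) else 0))
          \<le> (\<Sum>k=1..L. 1 / 2 ^ k * (if t \<in> G k then q (drop k t) else 0))"
        using L[OF t] by (intro sum_mono2) (auto simp: q0)
      then show "(Wt t)\<^sup>2 * (cmod (hcoeff (bop_apply a x) t))\<^sup>2
          \<le> K\<^sup>2 * (\<Sum>k=1..L. 1 / 2 ^ k * (if t \<in> G k then q (drop k t) else 0))"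
        using pt[of t] by (meson mult_left_mono order_trans zero_le_power2)
    qed
    also have "\<dots> = K\<^sup>2 * (\<Sum>k=1..L. 1 / 2 ^ k * (\<Sum>t\<in>F. if t \<in> G k then q (drop k t) else 0))"
      unfolding sum_distrib_left by (rule sum.swap)
    also have "\<dots> \<le> K\<^sup>2 * (\<Sum>k=1..L. 1 / 2 ^ k * infsum q UNIV)"
      by (intro mult_left_mono sum_mono col) auto
    also have "\<dots> = K\<^sup>2 * ((\<Sum>k=1..L. 1 / 2 ^ k) * infsum q UNIV)"
      by (simp only: sum_distrib_right)
    also have "\<dots> \<le> K\<^sup>2 * (1 * infsum q UNIV)"
      by (intro mult_left_mono mult_right_mono sum_half_powers_le infsum_nonneg q0) simp
    also have "\<dots> = K\<^sup>2 * (norm x)\<^sup>2" by (simp add: norm_hsp_sq q_def[abs_def])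
    finally show ?thesis .
  qed
  have "(norm (bop_apply a x))\<^sup>2 \<le> (K * norm x)\<^sup>2"
    unfolding norm_hsp_sq[of "bop_apply a x"] power_mult_distrib
    by (rule infsum_le_finite_sums[OF hsp_summable fin])
  then show "norm (bop_apply a x) \<le> K * norm x"
    by (rule power2_le_imp_le) (simp add: K)
qed


section \<open>Colours along a path\<close>

text \<open>Read from the target towards the unit, which is the order of the factors in a product of
  operators \<open>Top c\<close>.\<close>

definition path_colours :: "nat \<Rightarrow> word \<Rightarrow> word list" where
  "path_colours k t = map (\<lambda>i. colour (drop i t)) [0..<k]"

text \<open>A fresh path is one whose colour word determines it, because it meets \<^const>\<open>colours\<close>.\<close>

definition fresh :: "nat \<Rightarrow> word \<Rightarrow> bool" where
  "fresh k t \<longleftrightarrow> (\<exists>i<k. drop i t \<in> colours)"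

lemma path_colours_Suc: "path_colours (Suc k) t = colour t # path_colours k (tl t)"
  unfolding path_colours_def upt_conv_Cons[OF zero_less_Suc] map_Suc_upt[symmetric]
  by (simp add: drop_Suc comp_def)

lemma length_path_colours [simp]: "length (path_colours k t) = k"
  by (simp add: path_colours_def)

lemma path_colours_eq_iff:
  "path_colours k s = path_colours k t \<longleftrightarrow> (\<forall>i<k. colour (drop i s) = colour (drop i t))"
  by (auto simp: path_colours_def)

lemma path_colours_eqD:
  "path_colours k s = path_colours j t \<Longrightarrow> k = j \<and> (\<forall>i<k. colour (drop i s) = colour (drop i t))"
  using path_colours_eq_iff length_path_colours by metis

text \<open>Off \<open>colours\<close> the recursion discards the leading run together with its
  \<open>gen_h\<close>, so the colour is strictly shorter than the word.\<close>

lemma length_colour_eq_imp_mem: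
  assumes "s \<noteq> []" "length (colour s) = length s"
  shows "s \<in> colours"
proof (rule ccontr)
  assume s: "s \<notin> colours"
  obtain k y where sk: "s = replicate k gen_g @ gen_h # y"
    using word_cases[of s] s assms(1) by (force simp: colours_def Suc_le_eq)
  have nd: "\<not> (length y + 1) dvd k" using s sk replicate_h_in_colours_iff by simp
  have "length (colour s) \<le> length ((tl ^^ (length y - k mod (length y + 1))) y)"
    using colour_mem[OF colour_step_length(1)[OF nd]] colour_recursion[OF nd] sk by simp
  also have "\<dots> \<le> length y" by (rule length_funpow_tl)
  finally show False using assms(2) sk by simp
qed

text \<open>At a fresh step the colour is the remaining word itself. A colour is never longer than
  the word bearing it, so no shorter target can show the same colours.\<close>

lemma fresh_length_le:
  assumes "fresh k t" "k \<le> length t" "k \<le> length t'" "path_colours k t = path_colours k t'"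
  shows "length t \<le> length t'"
proof -
  obtain i where i: "i < k" "drop i t \<in> colours" using assms(1) by (auto simp: fresh_def)
  have "colour (drop i t') = drop i t"
    using assms(4) i by (metis colour_in_colours path_colours_eq_iff)
  then have "length (drop i t) \<le> length (drop i t')"
    using colour_mem[of "drop i t'"] i assms(3) by simp
  then show ?thesis using i assms(2,3) by simp
qed

text \<open>Equal lengths make the colour at a fresh step name the same remaining word for both
  paths. Above that step the letters are recovered one by one, because \<open>gen_g # s\<close> and
  \<open>gen_h # s\<close> have different colours.\<close>

lemma fresh_path_unique:
  assumes "fresh k t" "fresh k t'" "k \<le> length t" "k \<le> length t'"
    and eq: "path_colours k t = path_colours k t'"
  shows "t = t'"
proof -
  have len: "length t = length t'"
    using fresh_length_le[of k t t'] fresh_length_le[of k t' t] assms by simp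
  obtain i where i: "i < k" "drop i t \<in> colours" using assms(1) by (auto simp: fresh_def)
  have ci: "colour (drop i t') = drop i t"
    using eq i by (metis colour_in_colours path_colours_eq_iff)
  have "drop i t' \<in> colours"
    using i assms(4) len by (intro length_colour_eq_imp_mem) (simp_all add: ci)
  then have base: "drop i t = drop i t'" using ci by simp
  have "drop (i - j) t = drop (i - j) t'" if "j \<le> i" for j
    using that
  proof (induction j)
    case 0
    then show ?case using base by simp
  next
    case (Suc j)
    define m where "m = i - Suc j"
    have m: "m < k" "i - j = Suc m" using Suc(2) i by (auto simp: m_def)
    obtain x where x: "drop m t = x # drop (Suc m) t"
      using m assms(3) by (metis Cons_nth_drop_Suc order_less_le_trans)
    obtain y where y: "drop m t' = y # drop (Suc m) t'"
      using m assms(4) by (metis Cons_nth_drop_Suc order_less_le_trans)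
    have e: "drop (Suc m) t = drop (Suc m) t'" using Suc m by simp
    have "colour (drop m t) = colour (drop m t')" using eq m by (simp add: path_colours_eq_iff)
    then have "x = y"
      using colour_g_neq_h[of "drop (Suc m) t"] unfolding x y e by (cases x; cases y) auto
    then show ?case using x y e unfolding m_def by simp
  qed
  from this[of i] show ?thesis by simp
qed

section \<open>Runs of letters g and paths that are not fresh\<close>

lemma drop_replicate_append: "i \<le> m \<Longrightarrow> drop i (replicate m x @ u) = replicate (m - i) x @ u"
  by simp

lemma depth_drop_le: "depth (drop i u) \<le> depth u"
  unfolding depth_def by (metis append_take_drop_id count_list_append le_add2)

lemma depth_run: "depth (replicate m gen_g @ gen_h # u) = Suc (depth u)"
  by (induction m) (simp_all add: depth_def)

text \<open>The run \<open>g\<^sup>m h u\<close> repeats the colours met on the way from the unit to \<open>u\<close>.\<close>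

lemma colour_run:
  assumes "m mod (length u + 1) \<noteq> 0"
  shows "colour (replicate m gen_g @ gen_h # u) =
    colour (drop (length u - m mod (length u + 1)) u)"
  using colour_recursion[of u m] assms by (simp add: tl_funpow dvd_eq_mod_eq_0)

text \<open>Under the bound on \<open>k\<close> the exponents pass through consecutive positive
  residues, so the path stays inside one period of the run and repeats a single path in
  \<open>u\<close>.\<close>

lemma path_colours_run:
  assumes "k \<le> m mod (length u + 1)"
  shows "path_colours k (replicate m gen_g @ gen_h # u) =
    path_colours k (drop (length u - m mod (length u + 1)) u)"
  unfolding path_colours_eq_iff
proof (intro allI impI)
  fix i assume i: "i < k"
  let ?n = "length u + 1"
  have im: "i < m mod ?n" using i assms by simp
  then have le: "i \<le> m" using mod_less_eq_dividend[of m ?n] by linarith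
  have md: "(m - i) mod ?n = m mod ?n - i"
  proof -
    have "m - i = m mod ?n - i + ?n * (m div ?n)"
      using im mod_mult_div_eq[of m ?n] by linarith
    then have "(m - i) mod ?n = (m mod ?n - i) mod ?n" by (simp only: mod_mult_self2)
    also have "\<dots> = m mod ?n - i"
      using mod_less_divisor[of ?n m] by (intro mod_less) linarith
    finally show ?thesis .
  qed
  have "m mod ?n \<le> length u" using mod_less_divisor[of ?n m] by linarith
  then have sub: "length u - (m mod ?n - i) = i + (length u - m mod ?n)" using im by linarith
  have "colour (replicate (m - i) gen_g @ gen_h # u) =
      colour (drop (length u - (m - i) mod ?n) u)"
    by (rule colour_run) (use md im in linarith)
  then show "colour (drop i (replicate m gen_g @ gen_h # u)) =
      colour (drop i (drop (length u - m mod ?n) u))"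
    unfolding drop_replicate_append[OF le] md sub drop_drop .
qed

text \<open>A path avoiding \<open>colours\<close> can neither leave its run of letters
  \<open>gen_g\<close> nor meet an exponent divisible by \<open>length u + 1\<close>. So it repeats
  the colours of a path in \<open>u\<close>, and each of its \<open>k\<close> words has at least one
  more \<open>gen_h\<close> than the matching word there.\<close>

lemma not_fresh_reduce:
  assumes "\<not> fresh k t" "1 \<le> k" "k \<le> length t"
  obtains t' where "length t' < length t" "k \<le> length t'"
    "path_colours k t' = path_colours k t" "path_weight k t \<le> path_weight k t' / 2 ^ k"
    "take k t = replicate k gen_g"
proof -
  have nc: "drop i t \<notin> colours" if "i < k" for i using assms(1) that by (auto simp: fresh_def)
  have "t \<noteq> []" using assms by auto
  then obtain m u where t: "t = replicate m gen_g @ gen_h # u"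
    using word_cases[of t] nc[of 0] assms(2) by (force simp: colours_def Suc_le_eq)
  let ?n = "length u + 1"
  have mn: "m mod ?n \<le> length u" using mod_less_divisor[of ?n m] by linarith
  \<comment> \<open>Otherwise, after \<open>m mod (length u + 1)\<close> steps, the path would stand
    at a word of \<open>colours\<close>.\<close>
  have km: "k \<le> m mod ?n"
  proof (rule ccontr)
    assume "\<not> k \<le> m mod ?n"
    then have i: "m mod ?n < k" by simp
    have "m mod ?n \<le> m" by simp
    then have "drop (m mod ?n) t = replicate (m - m mod ?n) gen_g @ gen_h # u"
      unfolding t by (rule drop_replicate_append)
    moreover have "?n dvd m - m mod ?n" by (rule dvd_minus_mod)
    ultimately show False using nc[OF i] by (simp add: replicate_h_in_colours_iff)
  qed
  then have kle: "k \<le> m" using mod_less_eq_dividend[of m ?n] by linarith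
  define t' where "t' = drop (length u - m mod ?n) u"
  have len: "length t' = m mod ?n" using mn by (simp add: t'_def)
  have "path_weight k t \<le> (\<Prod>i<k. wt (drop i t') * (1 / 2))"
    unfolding path_weight_def
  proof (rule prod_mono)
    fix i assume "i \<in> {..<k}"
    then have "drop i t = replicate (m - i) gen_g @ gen_h # u" using kle by (simp add: t)
    moreover have "depth (drop i t') \<le> depth u"
      unfolding t'_def drop_drop by (rule depth_drop_le)
    ultimately show "0 \<le> wt (drop i t) \<and> wt (drop i t) \<le> wt (drop i t') * (1 / 2)"
      by (simp add: wt_def depth_run frac_le)
  qed
  also have "\<dots> = path_weight k t' / 2 ^ k"
    unfolding prod.distrib by (simp add: path_weight_def power_one_over)
  finally have w: "path_weight k t \<le> path_weight k t' / 2 ^ k" .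
  show ?thesis
  proof (rule that[OF _ _ _ w])
    show "length t' < length t"
    proof -
      have "length u < length t" by (simp add: t)
      then show ?thesis using mn len by linarith
    qed
    show "k \<le> length t'" using len km by simp
    show "path_colours k t' = path_colours k t"
      unfolding t t'_def by (rule path_colours_run[OF km, symmetric])
    show "take k t = replicate k gen_g" using kle by (simp add: t)
  qed
qed

text \<open>Reduce until the path is fresh, which happens because the lengths decrease. The estimate
  keeps the factor \<open>1 / 2 ^ k\<close> of one reduction.\<close>

lemma not_fresh_origin:
  assumes "\<not> fresh k t" "1 \<le> k" "k \<le> length t"
  obtains t0 where "fresh k t0" "k \<le> length t0" "path_colours k t0 = path_colours k t"
    "path_weight k t \<le> path_weight k t0 / 2 ^ k" "take k t = replicate k gen_g"
proof -
  have "\<exists>t0. fresh k t0 \<and> k \<le> length t0 \<and> path_colours k t0 = path_colours k t \<and>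
      path_weight k t \<le> path_weight k t0 / 2 ^ k"
    using assms
  proof (induction t rule: length_induct)
    case (1 t)
    obtain t' where t': "length t' < length t" "k \<le> length t'"
      "path_colours k t' = path_colours k t" "path_weight k t \<le> path_weight k t' / 2 ^ k"
      using not_fresh_reduce[OF 1(2-4)] by metis
    show ?case
    proof (cases "fresh k t'")
      case True
      then show ?thesis using t' by blast
    next
      case False
      then obtain t0 where t0: "fresh k t0" "k \<le> length t0"
        "path_colours k t0 = path_colours k t'" "path_weight k t' \<le> path_weight k t0 / 2 ^ k"
        using 1(1,3) t'(1,2) by blast
      have "path_weight k t \<le> path_weight k t'"
        using order_trans[OF t'(4), of "path_weight k t'"] path_weight_nonneg[of k t']
        by (simp add: divide_le_eq mult_left_le_one_le mult_le_cancel_left1)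
      then show ?thesis using t0 t'(3) by (metis order_trans)
    qed
  qed
  then show ?thesis using that not_fresh_reduce[OF assms] by metis
qed

section \<open>Monomials in the generators\<close>

text \<open>The identity is not strictly lower, so the empty list gets the value \<open>0\<close>;
  concatenation corresponds to the product for nonempty lists.\<close>

fun monomial :: "word list \<Rightarrow> hsp bop" where
  "monomial [] = 0"
| "monomial [c] = Top c"
| "monomial (c # d # ws) = Top c * monomial (d # ws)"

lemma monomial_append:
  "ws \<noteq> [] \<Longrightarrow> us \<noteq> [] \<Longrightarrow> monomial (ws @ us) = monomial ws * monomial us"
proof (induction ws rule: monomial.induct)
  case (2 c)
  then show ?case by (cases us) auto
qed (auto simp: mult.assoc)

lemma hcoeff_monomial:
  "ws \<noteq> [] \<Longrightarrow> hcoeff (bop_apply (monomial ws) x) t =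
    (if length ws \<le> length t \<and> path_colours (length ws) t = ws
     then hcoeff x (drop (length ws) t) else 0)"
proof (induction ws arbitrary: t rule: monomial.induct)
  case (2 c)
  then show ?case
    by (cases t) (simp_all add: coeff_Top path_colours_Suc path_colours_def[of 0])
next
  case (3 c d ws)
  then show ?case
    by (cases t) (simp_all add: times_bop.rep_eq coeff_Top path_colours_Suc)
qed simp

text \<open>A monomial is a matrix of zeros and ones, and different colour lists have disjoint
  supports. So the monomials realised by paths are dual to the entries.\<close>

lemma entry_monomial:
  assumes "ws \<noteq> []" "k \<le> length t"
  shows "entry (monomial ws) k t = (if path_colours k t = ws then 1 else 0)"
proof (cases "k = length ws")
  case True
  then show ?thesis using assms by (simp add: entry_def hcoeff_monomial basis.rep_eq)
next
  case False
  then have "drop (length ws) t \<noteq> drop k t" if "length ws \<le> length t"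
    using inj_onD[OF inj_on_drop[of t], of "length ws" k] assms(2) that by auto
  moreover have "path_colours k t \<noteq> ws" using False length_path_colours by metis
  ultimately show ?thesis using assms by (simp add: entry_def hcoeff_monomial basis.rep_eq)
qed

lemma strictly_lower_monomial: "strictly_lower (monomial ws)"
  unfolding strictly_lower_def
proof (intro allI impI)
  fix s t :: word assume s: "\<forall>k\<in>{1..length t}. s \<noteq> drop k t"
  show "hcoeff (bop_apply (monomial ws) (basis s)) t = 0"
  proof (cases "ws = []")
    case True
    then show ?thesis by (simp add: zero_bop.rep_eq zero_hsp.rep_eq)
  next
    case False
    then have "length ws \<ge> 1" by (simp add: Suc_le_eq)
    then show ?thesis using False s by (auto simp: hcoeff_monomial basis.rep_eq)
  qed
qed

section \<open>Truncation to finitely many colour lists\<close>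

definition paths :: "nat \<Rightarrow> word list set" where
  "paths n = {path_colours k t |k t. 1 \<le> k \<and> k \<le> length t \<and> length t < n}"

lemma pathsI: "1 \<le> k \<Longrightarrow> k \<le> length t \<Longrightarrow> length t < n \<Longrightarrow> path_colours k t \<in> paths n"
  by (auto simp: paths_def)

lemma paths_mono: "m \<le> n \<Longrightarrow> paths m \<subseteq> paths n"
  unfolding paths_def using order_less_le_trans by blast

lemma Nil_notin_paths: "ws \<in> paths n \<Longrightarrow> ws \<noteq> []"
  by (auto simp: paths_def path_colours_def)

lemma finite_words: "finite {t :: word. length t \<le> n}"
proof -
  have "finite (UNIV :: gen set)" by (rule finite_subset[of _ "{gen_g, gen_h}"]) auto
  from finite_lists_length_le[OF this, of n] show ?thesis by simp
qed

lemma finite_paths: "finite (paths n)"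
proof (rule finite_subset)
  show "paths n \<subseteq> (\<lambda>(k, t). path_colours k t) ` ({..n} \<times> {t. length t \<le> n})"
    unfolding paths_def by force
  show "finite ((\<lambda>(k, t). path_colours k t) ` ({..n} \<times> {t. length t \<le> n}))"
    by (intro finite_imageI finite_cartesian_product finite_words) simp
qed

text \<open>Among the paths with given colours a fresh one has the shortest target, so its own
  length decides membership.\<close>

lemma fresh_mem_paths_iff:
  assumes "fresh k t" "1 \<le> k" "k \<le> length t"
  shows "path_colours k t \<in> paths n \<longleftrightarrow> length t < n"
proof
  assume "path_colours k t \<in> paths n"
  then obtain j t' where t': "path_colours k t = path_colours j t'" "j \<le> length t'" "length t' < n"
    by (auto simp: paths_def)
  then have "j = k" using path_colours_eqD by metis
  then show "length t < n" using fresh_length_le[of k t t'] assms t' by simp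
qed (use assms pathsI in blast)

text \<open>An arbitrary path with these colours; for operators of the algebra the entry does not
  depend on the choice, see \<open>path_invariant\<close>.\<close>

definition origin :: "word list \<Rightarrow> word" where
  "origin ws = (SOME t. length ws \<le> length t \<and> path_colours (length ws) t = ws)"

lemma origin:
  assumes "ws \<in> paths n"
  shows "length ws \<le> length (origin ws)" "path_colours (length ws) (origin ws) = ws"
proof -
  obtain k t where "ws = path_colours k t" "k \<le> length t" using assms by (auto simp: paths_def)
  then have "\<exists>t. length ws \<le> length t \<and> path_colours (length ws) t = ws" by auto
  from someI_ex[OF this] show "length ws \<le> length (origin ws)"
    "path_colours (length ws) (origin ws) = ws"
    by (simp_all add: origin_def)
qed

text \<open>Projection onto the span of the monomials indexed by \<open>paths n\<close>, with the
  coefficients read off at the chosen representatives.\<close>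

definition truncate :: "nat \<Rightarrow> hsp bop \<Rightarrow> hsp bop" where
  "truncate n a = (\<Sum>ws\<in>paths n. entry a (length ws) (origin ws) *\<^sub>C monomial ws)"

lemma truncate_add: "truncate n (a + b) = truncate n a + truncate n b"
  by (simp add: truncate_def entry_add scaleC_add_left sum.distrib)

lemma truncate_scaleC: "truncate n (c *\<^sub>C a) = c *\<^sub>C truncate n a"
  by (simp add: truncate_def entry_scaleC scaleC_scaleC[symmetric]
      linear_sum[OF bounded_linear.linear[OF bounded_linear_scaleC]])

lemma truncate_zero: "truncate n 0 = 0"
  by (simp add: truncate_def entry_zero)

lemma truncate_monomial:
  assumes "ws \<noteq> []"
  shows "truncate n (monomial ws) = (if ws \<in> paths n then monomial ws else 0)"
proof -
  have "truncate n (monomial ws) = (\<Sum>us\<in>paths n. if us = ws then monomial ws else 0)"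
    unfolding truncate_def
    by (rule sum.cong) (auto simp: entry_monomial[OF assms] origin)
  then show ?thesis by (simp add: finite_paths)
qed

lemma monomial_eq_0:
  assumes "ws \<noteq> []" "\<And>n. ws \<notin> paths n"
  shows "monomial ws = 0"
proof (rule bop_eqI, rule hsp_eqI)
  fix x t
  have "1 \<le> length ws" using assms(1) by (simp add: Suc_le_eq)
  then have "\<not> (length ws \<le> length t \<and> path_colours (length ws) t = ws)"
    using assms(2)[of "Suc (length t)"] pathsI[of "length ws" t "Suc (length t)"] by auto
  then show "hcoeff (bop_apply (monomial ws) x) t = hcoeff (bop_apply 0 x) t"
    using assms(1) by (auto simp: hcoeff_monomial zero_bop.rep_eq zero_hsp.rep_eq)
qed

text \<open>This is the linear span of the monomials, described through truncation; the index
  \<open>m\<close> later supplies the cut-offs of a gliding hump.\<close>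

definition finite_support :: "hsp bop set" where
  "finite_support = {a. \<exists>m. \<forall>n\<ge>m. truncate n a = a}"

lemma monomial_finite_support:
  assumes "ws \<noteq> []"
  shows "monomial ws \<in> finite_support"
proof (cases "\<exists>m. ws \<in> paths m")
  case True
  then obtain m where "ws \<in> paths m" by blast
  then have "\<forall>n\<ge>m. truncate n (monomial ws) = monomial ws"
    using paths_mono by (auto simp: truncate_monomial[OF assms])
  then show ?thesis unfolding finite_support_def by blast
next
  case False
  then show ?thesis
    using monomial_eq_0[OF assms] by (simp add: finite_support_def truncate_zero)
qed

lemma csubspace_finite_support: "csubspace finite_support"
  unfolding csubspace_def
proof (intro conjI ballI allI)
  show "0 \<in> finite_support" by (simp add: finite_support_def truncate_zero)
  fix a assume "a \<in> finite_support"
  then obtain m where m: "\<And>n. n \<ge> m \<Longrightarrow> truncate n a = a" by (auto simp: finite_support_def)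
  show "c *\<^sub>C a \<in> finite_support" for c
    unfolding finite_support_def
    by (rule CollectI, rule exI[of _ m]) (simp add: m truncate_scaleC)
  fix b assume "b \<in> finite_support"
  then obtain l where "\<And>n. n \<ge> l \<Longrightarrow> truncate n b = b" by (auto simp: finite_support_def)
  then have "\<forall>n\<ge>max m l. truncate n (a + b) = a + b" using m by (simp add: truncate_add)
  then show "a + b \<in> finite_support" unfolding finite_support_def by blast
qed

lemma csubspace_sum:
  assumes "csubspace V" "\<And>i. i \<in> F \<Longrightarrow> f i \<in> V"
  shows "sum f F \<in> V"
  using assms(2)
  by (induction F rule: infinite_finite_induct) (use assms(1) in \<open>auto simp: csubspace_def\<close>)

lemma csubspace_scaleC: "csubspace V \<Longrightarrow> x \<in> V \<Longrightarrow> c *\<^sub>C x \<in> V"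
  by (simp add: csubspace_def)

lemma csubalgebra_finite_support: "csubalgebra finite_support"
  unfolding csubalgebra_def
proof (intro conjI ballI csubspace_finite_support)
  fix a b assume "a \<in> finite_support" "b \<in> finite_support"
  then obtain m n where "truncate m a = a" "truncate n b = b"
    by (auto simp: finite_support_def)
  then have "a * b = truncate m a * truncate n b" by simp
  also have "\<dots> = (\<Sum>ws\<in>paths m. \<Sum>us\<in>paths n. entry a (length ws) (origin ws) *\<^sub>C
      entry b (length us) (origin us) *\<^sub>C monomial (ws @ us))"
    unfolding truncate_def sum_product
    by (intro sum.cong refl)
      (simp add: monomial_append Nil_notin_paths mult_scaleC_left mult_scaleC_right scaleC_scaleC
        mult.commute)
  also have "\<dots> \<in> finite_support"
    by (intro csubspace_sum csubspace_scaleC csubspace_finite_support monomial_finite_support)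
      (auto dest: Nil_notin_paths)
  finally show "a * b \<in> finite_support" .
qed

lemma alg0_finite_support: "alg0 \<subseteq> finite_support"
  unfolding alg0_def
proof (rule hull_minimal)
  have "Top c \<in> finite_support" for c using monomial_finite_support[of "[c]"] by simp
  then show "Top ` colours \<subseteq> finite_support" by blast
qed (rule csubalgebra_finite_support)

lemma csubalgebra_alg0: "csubalgebra alg0"
  unfolding alg0_def by (rule csubalgebra_hull)

lemma csubspace_alg0: "csubspace alg0"
  using csubalgebra_alg0 by (simp add: csubalgebra_def)

lemma Top_in_alg0: "c \<in> colours \<Longrightarrow> Top c \<in> alg0"
  unfolding alg0_def by (rule hull_inc) simp

lemma monomial_in_alg0: "ws \<noteq> [] \<Longrightarrow> set ws \<subseteq> colours \<Longrightarrow> monomial ws \<in> alg0"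
proof (induction ws rule: monomial.induct)
  case (3 c d ws)
  have "monomial (d # ws) \<in> alg0" by (rule 3(1)) (use 3(3) in auto)
  moreover have "Top c \<in> alg0" by (rule Top_in_alg0) (use 3(3) in simp)
  ultimately show ?case using csubalgebra_alg0 by (simp add: csubalgebra_def)
qed (simp_all add: Top_in_alg0)

lemma paths_colours: "ws \<in> paths n \<Longrightarrow> set ws \<subseteq> colours"
  by (auto simp: paths_def path_colours_def intro!: conjunct1[OF colour_mem])

lemma path_monomial_in_alg0: "ws \<in> paths n \<Longrightarrow> monomial ws \<in> alg0"
  using monomial_in_alg0 Nil_notin_paths paths_colours by blast

section \<open>Invariance of the entries under equality of colours\<close>

definition path_invariant :: "hsp bop \<Rightarrow> bool" where
  "path_invariant a \<longleftrightarrow> strictly_lower a \<and>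
    (\<forall>k t t'. k \<le> length t \<longrightarrow> k \<le> length t' \<longrightarrow> path_colours k t = path_colours k t' \<longrightarrow>
      entry a k t = entry a k t')"

lemma path_invariantD:
  "path_invariant a \<Longrightarrow> k \<le> length t \<Longrightarrow> k \<le> length t' \<Longrightarrow>
    path_colours k t = path_colours k t' \<Longrightarrow> entry a k t = entry a k t'"
  by (rule path_invariant_def[THEN iffD1, THEN conjunct2, rule_format])

lemma path_invariant_strictly_lower: "path_invariant a \<Longrightarrow> strictly_lower a"
  by (rule path_invariant_def[THEN iffD1, THEN conjunct1])

lemma path_invariantI:
  assumes "strictly_lower a"
    and "\<And>k t t'. k \<le> length t \<Longrightarrow> k \<le> length t' \<Longrightarrow>
      path_colours k t = path_colours k t' \<Longrightarrow> entry a k t = entry a k t'"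
  shows "path_invariant a"
  unfolding path_invariant_def by (intro conjI allI impI assms)

lemma path_invariant_alg0:
  assumes "a \<in> alg0"
  shows "path_invariant a"
proof -
  have "a \<in> finite_support" using assms alg0_finite_support by blast
  then obtain n where n: "truncate n a = a" unfolding finite_support_def by blast
  have "path_invariant (truncate n a)"
  proof (rule path_invariantI)
    show "strictly_lower (truncate n a)"
      unfolding truncate_def
      by (intro strictly_lower_sum strictly_lower_scaleC strictly_lower_monomial)
    fix k t t'
    assume "k \<le> length t" "k \<le> length t'" "path_colours k t = path_colours k t'"
    then have "entry (monomial ws) k t = entry (monomial ws) k t'" if "ws \<in> paths n" for ws
      using that by (simp add: entry_monomial Nil_notin_paths)
    then show "entry (truncate n a) k t = entry (truncate n a) k t'"
      by (simp add: truncate_def entry_sum entry_scaleC)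
  qed
  then show ?thesis unfolding n .
qed

text \<open>Single matrix coefficients are continuous in the operator norm, so both conditions pass
  to limits.\<close>

lemma path_invariant_closure:
  assumes "a \<in> closure alg0"
  shows "path_invariant a"
proof -
  obtain X where X: "\<forall>n. X n \<in> alg0" "X \<longlonglongrightarrow> a" using iffD1[OF closure_sequential assms] by blast
  then have inv: "path_invariant (X n)" for n using path_invariant_alg0 by blast
  have mlim: "(\<lambda>n. hcoeff (bop_apply (X n) (basis s)) t) \<longlonglongrightarrow> hcoeff (bop_apply a (basis s)) t" for s t
    by (rule bounded_linear.tendsto[OF bounded_clinear_bl[OF matrix_coeff_clinear] X(2)])
  have elim: "(\<lambda>n. entry (X n) k t) \<longlonglongrightarrow> entry a k t" for k t
    unfolding entry_def by (rule mlim)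
  show ?thesis
  proof (rule path_invariantI)
    show "strictly_lower a"
      unfolding strictly_lower_def
    proof (intro allI impI)
      fix s t :: word assume st: "\<forall>k\<in>{1..length t}. s \<noteq> drop k t"
      have "hcoeff (bop_apply (X n) (basis s)) t = 0" for n
        using strictly_lowerD[OF path_invariant_strictly_lower[OF inv]] st by blast
      then show "hcoeff (bop_apply a (basis s)) t = 0"
        using mlim[of s t] by (simp add: LIMSEQ_const_iff)
    qed
    fix k t t'
    assume "k \<le> length t" "k \<le> length t'" "path_colours k t = path_colours k t'"
    from path_invariantD[OF inv this]
    have "(\<lambda>n. entry (X n) k t) \<longlonglongrightarrow> entry a k t'" using elim[of k t'] by simp
    then show "entry a k t = entry a k t'" using elim[of k t] LIMSEQ_unique by blast
  qed
qed

lemma entry_truncate: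
  assumes "path_invariant a" "k \<le> length t"
  shows "entry (truncate n a) k t = (if path_colours k t \<in> paths n then entry a k t else 0)"
proof -
  have "entry (truncate n a) k t = (\<Sum>ws\<in>paths n. if ws = path_colours k t then entry a k t else 0)"
    unfolding truncate_def entry_sum entry_scaleC
  proof (rule sum.cong[OF refl])
    fix ws assume ws: "ws \<in> paths n"
    have "entry a (length ws) (origin ws) = entry a k t" if e: "ws = path_colours k t"
    proof -
      have "length ws = k" using e by simp
      then show ?thesis
        using path_invariantD[OF assms(1), of k "origin ws" t] origin[OF ws] e assms(2) by metis
    qed
    then show "entry a (length ws) (origin ws) * entry (monomial ws) k t =
        (if ws = path_colours k t then entry a k t else 0)"
      using ws assms(2) by (auto simp: entry_monomial Nil_notin_paths)
  qed
  then show ?thesis by (simp add: finite_paths)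
qed

text \<open>Matrix multiplication. Both factors add at least one letter, so the intermediate word
  lies strictly between source and target.\<close>

lemma entry_mult:
  assumes "path_invariant a" "path_invariant b" "k \<le> length t"
  shows "entry (a * b) k t = (\<Sum>i=1..<k. entry a i t * entry b (k - i) (drop i t))"
proof -
  have b0: "hcoeff (bop_apply b (basis (drop k t))) (drop i t) =
      (if i < k then entry b (k - i) (drop i t) else 0)" if i: "i \<in> {1..length t}" for i
  proof (cases "i < k")
    case True
    then show ?thesis by (simp add: entry_def)
  next
    case False
    have "drop k t \<noteq> drop j (drop i t)" if j: "j \<in> {1..length (drop i t)}" for j
    proof -
      have "k \<noteq> j + i" "j + i \<le> length t" using j i False by auto
      then show ?thesis using inj_onD[OF inj_on_drop[of t], of k "j + i"] assms(3) by auto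
    qed
    then have "hcoeff (bop_apply b (basis (drop k t))) (drop i t) = 0"
      by (rule strictly_lowerD[OF path_invariant_strictly_lower[OF assms(2)]])
    then show ?thesis using False by simp
  qed
  have "entry (a * b) k t = (\<Sum>i=1..length t. entry a i t *
      (if i < k then entry b (k - i) (drop i t) else 0))"
    unfolding entry_def[of "a * b"] times_bop.rep_eq
      hcoeff_apply[OF path_invariant_strictly_lower[OF assms(1)]]
    by (intro sum.cong refl) (simp only: b0)
  also have "\<dots> = (\<Sum>i=1..<k. entry a i t * entry b (k - i) (drop i t))"
    using assms(3) by (intro sum.mono_neutral_cong_right) auto
  finally show ?thesis .
qed

section \<open>Sums of operators with separated rows\<close>

lift_definition restrict_rows :: "word set \<Rightarrow> hsp \<Rightarrow> hsp" is "\<lambda>A x s. if s \<in> A then x s else 0"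
proof -
  fix A and x :: "word \<Rightarrow> complex"
  assume "(\<lambda>s. (Wt s)\<^sup>2 * (cmod (x s))\<^sup>2) summable_on UNIV"
  then show "(\<lambda>s. (Wt s)\<^sup>2 * (cmod (if s \<in> A then x s else 0))\<^sup>2) summable_on UNIV"
    by (rule summable_on_comparison_test) auto
qed

lemma norm_restrict_rows: "norm (restrict_rows A x) \<le> norm x"
proof (rule power2_le_imp_le)
  show "(norm (restrict_rows A x))\<^sup>2 \<le> (norm x)\<^sup>2"
    unfolding norm_hsp_sq
    by (rule infsum_mono[OF hsp_summable hsp_summable]) (simp add: restrict_rows.rep_eq)
qed simp

lemma restrict_rows_clinear: "bounded_clinear (restrict_rows A)"
proof (rule bounded_clinearI[where K = 1])
  show "restrict_rows A (x + y) = restrict_rows A x + restrict_rows A y" for x y by transfer auto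
  show "restrict_rows A (c *\<^sub>C x) = c *\<^sub>C restrict_rows A x" for c x by transfer auto
  show "norm (restrict_rows A x) \<le> norm x * 1" for x using norm_restrict_rows by simp
qed

lemma orthogonal_restrict_rows:
  assumes "A \<inter> B = {}"
  shows "orthogonal (restrict_rows A x) (restrict_rows B y)"
proof -
  have "hcoeff (restrict_rows A x) s \<bullet> hcoeff (restrict_rows B y) s = 0" for s
    using assms by (auto simp: restrict_rows.rep_eq)
  then show ?thesis by (simp add: orthogonal_def inner_hsp.rep_eq)
qed

definition row_block :: "word set \<Rightarrow> hsp bop \<Rightarrow> hsp bop" where
  "row_block A a = Bop (\<lambda>x. restrict_rows A (bop_apply a x))"

lemma row_block_apply: "bop_apply (row_block A a) x = restrict_rows A (bop_apply a x)"
  unfolding row_block_def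
  by (subst bop_apply_Bop) (rule bounded_clinear_compose[OF restrict_rows_clinear bop_clinear], rule refl)

lemma entry_row_block: "entry (row_block A a) k t = (if t \<in> A then entry a k t else 0)"
  by (simp add: entry_def row_block_apply restrict_rows.rep_eq)

lemma strictly_lower_row_block: "strictly_lower a \<Longrightarrow> strictly_lower (row_block A a)"
  by (simp add: strictly_lower_def row_block_apply restrict_rows.rep_eq)

lemma bop_sum_apply: "bop_apply (\<Sum>i\<in>F. a i) x = (\<Sum>i\<in>F. bop_apply (a i) x)"
  by (induction F rule: infinite_finite_induct) (simp_all add: zero_bop.rep_eq plus_bop.rep_eq)

text \<open>The blocks have orthogonal ranges, so Pythagoras gives \<open>sqrt N\<close> where the
  triangle inequality gives \<open>N\<close>.\<close>

lemma norm_sum_row_blocks_le: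
  assumes "\<And>i j. i < N \<Longrightarrow> j < N \<Longrightarrow> i \<noteq> j \<Longrightarrow> A i \<inter> A j = {}"
    and "\<And>i. i < N \<Longrightarrow> norm (a i) \<le> 1"
  shows "norm (\<Sum>i<N. row_block (A i) (a i)) \<le> sqrt (real N)"
  unfolding norm_bop.rep_eq
proof (rule onorm_bound)
  fix x
  have "(norm (bop_apply (\<Sum>i<N. row_block (A i) (a i)) x))\<^sup>2 =
      (norm (\<Sum>i<N. restrict_rows (A i) (bop_apply (a i) x)))\<^sup>2"
    by (simp add: bop_sum_apply row_block_apply)
  also have "\<dots> = (\<Sum>i<N. (norm (restrict_rows (A i) (bop_apply (a i) x)))\<^sup>2)"
    by (rule norm_sum_Pythagorean)
      (simp_all add: pairwise_def orthogonal_restrict_rows assms(1))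
  also have "\<dots> \<le> (\<Sum>i<N. (norm x)\<^sup>2)"
  proof (rule sum_mono, rule power_mono)
    fix i assume "i \<in> {..<N}"
    then have "norm (a i) * norm x \<le> 1 * norm x" using assms(2) by (intro mult_right_mono) auto
    then show "norm (restrict_rows (A i) (bop_apply (a i) x)) \<le> norm x"
      using norm_restrict_rows[of "A i" "bop_apply (a i) x"] bop_norm_bound[of "a i" x] by linarith
  qed simp
  also have "\<dots> = (sqrt (real N) * norm x)\<^sup>2" by (simp add: power_mult_distrib)
  finally show "norm (bop_apply (\<Sum>i<N. row_block (A i) (a i)) x) \<le> sqrt (real N) * norm x"
    by (rule power2_le_imp_le) simp
qed simp

text \<open>Entries on paths that are not fresh copy an entry on a fresh path nearer to the unit, with a
  weight that is smaller at least by the factor \<open>2\<^sup>k\<close>; hence they are controlled by the fresh entries.\<close>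

lemma entry_not_fresh_le:
  assumes "path_invariant a" "\<not> fresh k t" "1 \<le> k" "k \<le> length t"
    and "\<And>t0. fresh k t0 \<Longrightarrow> k \<le> length t0 \<Longrightarrow> cmod (entry a k t0) * path_weight k t0 \<le> C"
  shows "cmod (entry a k t) * path_weight k t \<le> C / 2 ^ k"
proof -
  obtain t0 where t0: "fresh k t0" "k \<le> length t0" "path_colours k t0 = path_colours k t"
    "path_weight k t \<le> path_weight k t0 / 2 ^ k"
    using not_fresh_origin[OF assms(2-4)] by metis
  have "cmod (entry a k t) * path_weight k t \<le> cmod (entry a k t0) * (path_weight k t0 / 2 ^ k)"
    using path_invariantD[OF assms(1) t0(2) assms(4) t0(3)]
      mult_left_mono[OF t0(4) norm_ge_zero[of "entry a k t"]] by simp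
  also have "\<dots> \<le> C / 2 ^ k"
    using assms(5)[OF t0(1,2)] by (simp add: divide_right_mono)
  finally show ?thesis .
qed

lemma not_fresh_run: "\<not> fresh k t \<Longrightarrow> 1 \<le> k \<Longrightarrow> k \<le> length t \<Longrightarrow> take k t = replicate k gen_g"
  by (erule not_fresh_reduce) auto

text \<open>Growth slower than \<open>N\<close> is what the gliding hump below needs. The sum of the
  \<open>y i\<close> is compared with the sum \<open>Z\<close> of row blocks of the
  \<open>x i\<close>: fresh entries agree, and the others decay like \<open>1 / 2 ^ k\<close> in
  both and lie on runs of \<open>gen_g\<close>, so the difference has norm at most
  \<open>2\<close>.\<close>

lemma norm_sum_row_separated_le:
  assumes x: "\<And>i. path_invariant (x i)" "\<And>i. norm (x i) \<le> 1"
    and y: "\<And>i. path_invariant (y i)" and n: "incseq n"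
    and xy: "\<And>i k t. fresh k t \<Longrightarrow> 1 \<le> k \<Longrightarrow> k \<le> length t \<Longrightarrow> entry (y i) k t =
      (if n i \<le> length t \<and> length t < n (Suc i) then entry (x i) k t else 0)"
  shows "norm (\<Sum>i<N. y i) \<le> sqrt (real N) + 2"
proof -
  define A where "A i = {t :: word. n i \<le> length t \<and> length t < n (Suc i)}" for i
  have disj: "A i \<inter> A j = {}" if "i \<noteq> j" for i j
  proof -
    have "A i \<inter> A j = {}" if "i < j" for i j
      using incseqD[OF n, of "Suc i" j] that by (auto simp: A_def)
    then show ?thesis using that by (metis Int_commute linorder_neqE_nat)
  qed
  define Z where "Z = (\<Sum>i<N. row_block (A i) (x i))"
  define z where "z = (\<Sum>i<N. y i)"
  have Z: "entry Z k t = (\<Sum>i<N. if t \<in> A i then entry (x i) k t else 0)" for k t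
    by (simp add: Z_def entry_sum entry_row_block)
  have zZ: "entry z k t = entry Z k t" if "fresh k t" "1 \<le> k" "k \<le> length t" for k t
    unfolding Z z_def entry_sum using that by (simp add: xy A_def)
  \<comment> \<open>The row sets are disjoint, so an entry of \<open>Z\<close> is zero or the entry
    of a single \<open>x i\<close>.\<close>
  have Z1: "cmod (entry Z k t) * path_weight k t \<le> C"
    if "\<And>i. cmod (entry (x i) k t) * path_weight k t \<le> C" for k t C
  proof (cases "\<exists>i<N. t \<in> A i")
    case True
    then obtain i where i: "i < N" "t \<in> A i" by blast
    have "entry Z k t = (\<Sum>j<N. if j = i then entry (x j) k t else 0)"
      unfolding Z using i(2) disj by (intro sum.cong refl if_cong) auto
    then show ?thesis using i(1) that by simp
  next
    case False
    then have "entry Z k t = 0" unfolding Z by (intro sum.neutral) auto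
    moreover have "0 \<le> C"
      using that[of 0] mult_nonneg_nonneg[OF norm_ge_zero path_weight_nonneg] order_trans by blast
    ultimately show ?thesis by simp
  qed
  have xb: "cmod (entry (x i) k t) * path_weight k t \<le> 1" if "k \<le> length t" for i k t
    using entry_bound[OF that, of "x i"] x(2)[of i] by linarith
  have inv: "path_invariant z"
  proof (rule path_invariantI)
    show "strictly_lower z"
      unfolding z_def by (intro strictly_lower_sum path_invariant_strictly_lower y)
    fix k t t'
    assume "k \<le> length t" "k \<le> length t'" "path_colours k t = path_colours k t'"
    from path_invariantD[OF y this] show "entry z k t = entry z k t'"
      by (simp add: z_def entry_sum)
  qed
  have "norm (z - Z) \<le> 2"
  proof (rule norm_le_of_g_runs)
    show "strictly_lower (z - Z)"
      unfolding Z_def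
      by (intro strictly_lower_diff strictly_lower_sum strictly_lower_row_block
          path_invariant_strictly_lower inv x)
    fix k and t :: word assume k: "1 \<le> k" "k \<le> length t"
    show "take k t = replicate k gen_g" if "entry (z - Z) k t \<noteq> 0"
      using that zZ[of k t] k not_fresh_run[of k t] by (auto simp: entry_diff)
    show "cmod (entry (z - Z) k t) * path_weight k t \<le> 2 / 2 ^ k"
    proof (cases "fresh k t")
      case True
      then show ?thesis using zZ k by (simp add: entry_diff)
    next
      case False
      \<comment> \<open>\<open>z\<close> is path invariant, so its entry copies a fresh one, where
        it agrees with \<open>Z\<close>. \<open>Z\<close> itself need not be path invariant and is
        estimated through the single \<open>x i\<close>.\<close>
      have "cmod (entry z k t) * path_weight k t \<le> 1 / 2 ^ k"
      proof (rule entry_not_fresh_le[OF inv False k])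
        fix t0 assume t0: "fresh k t0" "k \<le> length t0"
        show "cmod (entry z k t0) * path_weight k t0 \<le> 1"
          unfolding zZ[OF t0(1) k(1) t0(2)] by (rule Z1) (rule xb[OF t0(2)])
      qed
      moreover have "cmod (entry Z k t) * path_weight k t \<le> 1 / 2 ^ k"
        by (rule Z1) (rule entry_not_fresh_le[OF x(1) False k], rule xb)
      moreover have "cmod (entry (z - Z) k t) * path_weight k t
          \<le> (cmod (entry z k t) + cmod (entry Z k t)) * path_weight k t"
        unfolding entry_diff by (intro mult_right_mono norm_triangle_ineq4 path_weight_nonneg)
      ultimately show ?thesis by (simp add: distrib_right)
    qed
  qed simp
  moreover have "norm Z \<le> sqrt (real N)"
    unfolding Z_def by (rule norm_sum_row_blocks_le[OF disj x(2)])
  ultimately show ?thesis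
    using norm_triangle_ineq[of "z - Z" Z] by (simp add: z_def)
qed

section \<open>Coordinate functionals span a dense subspace of the dual\<close>

lemma of_alg_clinear: "bounded_clinear of_alg"
  by (rule bounded_clinearI[where K = 1]) (simp_all add: plus_alg.rep_eq scaleC_alg.rep_eq norm_alg.rep_eq)

lemma path_invariant_of_alg: "path_invariant (of_alg a)"
  using path_invariant_closure of_alg by blast

definition coord :: "nat \<Rightarrow> word \<Rightarrow> alg cdual" where
  "coord k t = Cdual (\<lambda>a. entry (of_alg a) k t)"

lemma coord_apply [simp]: "cdual_apply (coord k t) a = entry (of_alg a) k t"
  unfolding coord_def
  by (subst cdual_apply_Cdual) (rule bounded_clinear_compose[OF entry_clinear of_alg_clinear], rule refl)

lemma cdual_sum: "cdual_apply (\<Sum>i\<in>F. f i) x = (\<Sum>i\<in>F. cdual_apply (f i) x)"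
  by (induction F rule: infinite_finite_induct) (simp_all add: zero_cdual.rep_eq plus_cdual.rep_eq)

lemma cdual_sum_arg: "cdual_apply f (\<Sum>i\<in>F. x i) = (\<Sum>i\<in>F. cdual_apply f (x i))"
  by (rule linear_sum[OF bounded_linear.linear[OF cdual_bl]])

lemma of_alg_sum: "of_alg (\<Sum>i\<in>F. a i) = (\<Sum>i\<in>F. of_alg (a i))"
  by (rule linear_sum[OF bounded_linear.linear[OF bounded_clinear_bl[OF of_alg_clinear]]])

lemma alg0_dense:
  assumes "0 < e"
  obtains b where "of_alg b \<in> alg0" "norm (a - b) < e"
proof -
  have "of_alg a \<in> closure alg0" by (rule of_alg)
  then obtain c where c: "c \<in> alg0" "dist c (of_alg a) < e"
    using assms closure_approachable by blast
  then have "c \<in> closure alg0" using closure_subset by blast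
  then have "of_alg (Alg c) = c" by (rule Alg_inverse)
  then show ?thesis
    using that[of "Alg c"] c
    by (simp add: norm_alg.rep_eq minus_alg.rep_eq dist_norm norm_minus_commute)
qed

lemma norm_cdual_le_dense:
  assumes K: "0 \<le> K" and le: "\<And>a. of_alg a \<in> alg0 \<Longrightarrow> cmod (cdual_apply f a) \<le> K * norm a"
  shows "norm f \<le> K"
proof (rule norm_cdual_le[OF K])
  fix a
  show "cmod (cdual_apply f a) \<le> K * norm a"
  proof (rule field_le_epsilon)
    fix e :: real assume "0 < e"
    define d where "d = e / (norm f + K + 1)"
    have pos: "0 < norm f + K + 1" using K norm_ge_zero[of f] by linarith
    then have "0 < d" using \<open>0 < e\<close> by (simp add: d_def)
    then obtain b where b: "of_alg b \<in> alg0" "norm (a - b) < d" by (rule alg0_dense)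
    have "cdual_apply f a = cdual_apply f (a - b) + cdual_apply f b"
      using cdual_add_arg[of f "a - b" b] by simp
    then have "cmod (cdual_apply f a) \<le> cmod (cdual_apply f (a - b)) + cmod (cdual_apply f b)"
      by (simp only: norm_triangle_ineq)
    also have "\<dots> \<le> norm f * norm (a - b) + K * norm b"
      by (intro add_mono cdual_bound le b(1))
    also have "\<dots> \<le> norm f * norm (a - b) + K * (norm a + norm (a - b))"
      using K norm_triangle_sub[of b a] by (intro add_left_mono mult_left_mono) (simp_all add: norm_minus_commute)
    also have "\<dots> = K * norm a + (norm f + K) * norm (a - b)" by (simp add: algebra_simps)
    also have "\<dots> \<le> K * norm a + (norm f + K + 1) * d"
      using b(2) K by (intro add_left_mono mult_mono) auto
    also have "\<dots> = K * norm a + e" using pos by (simp add: d_def)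
    finally show "cmod (cdual_apply f a) \<le> K * norm a + e" .
  qed
qed

text \<open>\<open>Alg\<close> is specified only on the closure of \<open>alg0\<close>, so this is
  meaningful for the colour lists of paths.\<close>

definition alg_monomial :: "word list \<Rightarrow> alg" where
  "alg_monomial ws = Alg (monomial ws)"

lemma alg0_subset_range: "a \<in> alg0 \<Longrightarrow> of_alg (Alg a) = a"
  using closure_subset by (intro Alg_inverse) blast

lemma of_alg_monomial: "ws \<in> paths n \<Longrightarrow> of_alg (alg_monomial ws) = monomial ws"
  unfolding alg_monomial_def by (rule alg0_subset_range[OF path_monomial_in_alg0])

section \<open>Approximation of functionals by truncation\<close>

definition alg_truncate :: "nat \<Rightarrow> alg \<Rightarrow> alg" where
  "alg_truncate n a = (\<Sum>ws\<in>paths n. entry (of_alg a) (length ws) (origin ws) *\<^sub>C alg_monomial ws)"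

lemma of_alg_truncate: "of_alg (alg_truncate n a) = truncate n (of_alg a)"
  by (simp add: alg_truncate_def truncate_def of_alg_sum scaleC_alg.rep_eq of_alg_monomial)

text \<open>The transpose of \<open>alg_truncate\<close>, hence a finite combination of coordinate
  functionals.\<close>

definition cdual_truncate :: "nat \<Rightarrow> alg cdual \<Rightarrow> alg cdual" where
  "cdual_truncate n f =
    (\<Sum>ws\<in>paths n. cdual_apply f (alg_monomial ws) *\<^sub>C coord (length ws) (origin ws))"

lemma cdual_truncate_apply: "cdual_apply (cdual_truncate n f) a = cdual_apply f (alg_truncate n a)"
  by (simp add: cdual_truncate_def alg_truncate_def cdual_sum cdual_sum_arg scaleC_cdual.rep_eq
      cdual_scaleC_arg scaleC_complex_def mult.commute)

lemma norming_element:
  assumes "0 \<le> e" "e < norm f"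
  obtains a where "of_alg a \<in> alg0" "norm a \<le> 1" "e \<le> Re (cdual_apply f a)"
proof -
  obtain b where b: "of_alg b \<in> alg0" "e * norm b < cmod (cdual_apply f b)"
    using norm_cdual_le_dense[OF assms(1), of f] assms(2) by (meson not_le)
  define z where "z = cdual_apply f b"
  have z0: "z \<noteq> 0"
    using b(2) mult_nonneg_nonneg[OF assms(1) norm_ge_zero[of b]] by (auto simp: z_def)
  then have b0: "0 < norm b"
    using cdual_bound[of f b] by (auto simp: z_def)
  \<comment> \<open>\<open>c\<close> rotates the value at \<open>b\<close> to the positive axis and
    scales \<open>b\<close> to norm one.\<close>
  define c where "c = cnj z / complex_of_real (cmod z * norm b)"
  have "cmod c = 1 / norm b" using z0 by (simp add: c_def norm_divide norm_mult)
  then have "norm (c *\<^sub>C b) \<le> 1" using b0 by (simp add: norm_scaleC)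
  moreover have "of_alg (c *\<^sub>C b) \<in> alg0"
    unfolding scaleC_alg.rep_eq by (rule csubspace_scaleC[OF csubspace_alg0 b(1)])
  moreover have "e \<le> Re (cdual_apply f (c *\<^sub>C b))"
  proof -
    have "c * z = complex_of_real (cmod z / norm b)"
      using z0 b0 complex_norm_square[of z] by (simp add: c_def field_simps power2_eq_square)
    then have "Re (cdual_apply f (c *\<^sub>C b)) = cmod z / norm b"
      by (simp add: cdual_scaleC_arg flip: z_def)
    then show ?thesis using b(2) b0 by (simp add: z_def pos_le_divide_eq)
  qed
  ultimately show ?thesis using that by blast
qed

text \<open>Gliding hump. If every truncation missed \<open>f\<close> by more than \<open>e\<close>,
  there would be elements \<open>Y i\<close>, with separated rows on fresh paths, at which
  \<open>f\<close> has real part at least \<open>e\<close>. Adding \<open>N\<close> of them gives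
  \<open>N * e \<le> norm f * (sqrt N + 2)\<close>, which fails for large \<open>N\<close>.\<close>

lemma cdual_truncate_approx:
  assumes e: "0 < e"
  shows "\<exists>n. norm (f - cdual_truncate n f) \<le> e"
proof (rule ccontr)
  assume "\<not> ?thesis"
  then have gt: "e < norm (f - cdual_truncate n f)" for n by (simp add: not_le)
  have "\<exists>a. of_alg a \<in> alg0 \<and> norm a \<le> 1 \<and> e \<le> Re (cdual_apply (f - cdual_truncate n f) a)" for n
    using norming_element[OF less_imp_le[OF e] gt[of n]] by metis
  then obtain X where X: "\<And>n. of_alg (X n) \<in> alg0" "\<And>n. norm (X n) \<le> 1"
    "\<And>n. e \<le> Re (cdual_apply (f - cdual_truncate n f) (X n))" by metis
  have "\<exists>m. \<forall>l\<ge>m. truncate l (of_alg (X n)) = of_alg (X n)" for n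
    using X(1)[of n] alg0_finite_support unfolding finite_support_def by blast
  then obtain m where m: "\<And>n l. m n \<le> l \<Longrightarrow> truncate l (of_alg (X n)) = of_alg (X n)" by metis
  \<comment> \<open>The next cut-off lies beyond the support of the element chosen for the present
    one.\<close>
  define n where "n = rec_nat 0 (\<lambda>_ p. max p (m p))"
  have nS: "n (Suc i) = max (n i) (m (n i))" for i by (simp add: n_def)
  have inc: "incseq n" by (rule incseq_SucI) (simp add: nS)
  define x where "x i = of_alg (X (n i))" for i
  define Y where "Y i = X (n i) - alg_truncate (n i) (X (n i))" for i
  have Y: "of_alg (Y i) = x i - truncate (n i) (x i)" for i
    by (simp add: Y_def x_def minus_alg.rep_eq of_alg_truncate)
  have fix_next: "truncate (n (Suc i)) (x i) = x i" for i
    unfolding x_def by (rule m) (simp add: nS)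
  have sumY: "norm (\<Sum>i<N. Y i) \<le> sqrt (real N) + 2" for N
    unfolding norm_alg.rep_eq of_alg_sum
  proof (rule norm_sum_row_separated_le[of x])
    show "path_invariant (x i)" "norm (x i) \<le> 1" for i
      using path_invariant_of_alg X(2)[of "n i"] by (simp_all add: x_def norm_alg.rep_eq)
    show "path_invariant (of_alg (Y i))" for i by (rule path_invariant_of_alg)
    show "incseq n" by (rule inc)
    fix i k and t :: word assume kt: "fresh k t" "1 \<le> k" "k \<le> length t"
    \<comment> \<open>On fresh paths truncation cuts by the length of the target, so
      \<open>Y i\<close> keeps the rows from \<open>n i\<close> up to, but excluding,
      \<open>n (Suc i)\<close>.\<close>
    have tr: "entry (truncate l (x i)) k t = (if length t < l then entry (x i) k t else 0)" for l
      using entry_truncate[of "x i" k t l] path_invariant_of_alg kt fresh_mem_paths_iff[OF kt]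
      by (simp add: x_def)
    show "entry (of_alg (Y i)) k t =
        (if n i \<le> length t \<and> length t < n (Suc i) then entry (x i) k t else 0)"
      using tr[of "n i"] tr[of "n (Suc i)"] unfolding fix_next Y entry_diff by auto
  qed
  have lower: "real N * e \<le> norm f * (sqrt (real N) + 2)" for N
  proof -
    have "e \<le> Re (cdual_apply f (Y i))" for i
    proof -
      have "cdual_apply f (Y i) + cdual_apply f (alg_truncate (n i) (X (n i))) = cdual_apply f (X (n i))"
        using cdual_add_arg[of f "Y i" "alg_truncate (n i) (X (n i))"] by (simp add: Y_def)
      then have "cdual_apply (f - cdual_truncate (n i) f) (X (n i)) = cdual_apply f (Y i)"
        by (simp add: minus_cdual.rep_eq cdual_truncate_apply diff_eq_eq)
      then show ?thesis using X(3)[of "n i"] by simp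
    qed
    then have "(\<Sum>i<N. e) \<le> (\<Sum>i<N. Re (cdual_apply f (Y i)))" by (intro sum_mono)
    also have "\<dots> = Re (cdual_apply f (\<Sum>i<N. Y i))" by (simp add: cdual_sum_arg Re_sum)
    also have "\<dots> \<le> norm f * norm (\<Sum>i<N. Y i)"
      using complex_Re_le_cmod cdual_bound order_trans by blast
    also have "\<dots> \<le> norm f * (sqrt (real N) + 2)" by (intro mult_left_mono sumY) simp
    finally show ?thesis by simp
  qed
  obtain j :: nat where j: "3 * norm f / e < real j" using reals_Archimedean2 by blast
  have j1: "1 \<le> real j"
  proof -
    have "0 \<le> 3 * norm f / e" using e by simp
    then have "0 < real j" using j by linarith
    then show ?thesis by simp
  qed
  \<comment> \<open>The choice \<open>N = j * j\<close> removes the square root.\<close>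
  have "real j * (real j * e) \<le> norm f * (real j + 2)"
    using lower[of "j * j"] by (simp add: real_sqrt_mult mult_ac)
  also have "\<dots> \<le> norm f * (3 * real j)" using j1 by (intro mult_left_mono) auto
  finally have "real j * (real j * e) \<le> real j * (3 * norm f)" by (simp add: mult_ac)
  then have "real j * e \<le> 3 * norm f" using j1 by (simp only: mult_le_cancel_left)
  then show False using j e by (simp add: field_simps)
qed

text \<open>By \<open>cdual_truncate_approx\<close> the coordinates span a dense subspace of the
  dual, so they determine an element of the bidual.\<close>

lemma bidual_eq_0I:
  fixes \<Phi> :: "alg cdual cdual"
  assumes "\<And>k t. 1 \<le> k \<Longrightarrow> k \<le> length t \<Longrightarrow> cdual_apply \<Phi> (coord k t) = 0"
  shows "\<Phi> = 0"
proof (rule cdual_eqI)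
  fix f
  have "cmod (cdual_apply \<Phi> f) \<le> 0 + e" if "0 < e" for e
  proof -
    define d where "d = e / (norm \<Phi> + 1)"
    have pos: "0 < norm \<Phi> + 1" using norm_ge_zero[of \<Phi>] by linarith
    then obtain n where n: "norm (f - cdual_truncate n f) \<le> d"
      using cdual_truncate_approx[of d f] \<open>0 < e\<close> by (auto simp: d_def)
    have "cdual_apply \<Phi> (coord (length ws) (origin ws)) = 0" if "ws \<in> paths n" for ws
      using that origin[OF that] Nil_notin_paths[OF that] by (intro assms) (auto simp: Suc_le_eq)
    then have "cdual_apply \<Phi> (cdual_truncate n f) = 0"
      by (simp add: cdual_truncate_def cdual_sum_arg cdual_scaleC_arg)
    then have "cdual_apply \<Phi> f = cdual_apply \<Phi> (f - cdual_truncate n f)"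
      using cdual_add_arg[of \<Phi> "f - cdual_truncate n f" "cdual_truncate n f"] by simp
    then have "cmod (cdual_apply \<Phi> f) \<le> norm \<Phi> * norm (f - cdual_truncate n f)"
      using cdual_bound by metis
    also have "\<dots> \<le> (norm \<Phi> + 1) * d" using n by (intro mult_mono) auto
    also have "\<dots> = e" using pos by (simp add: d_def)
    finally show ?thesis by simp
  qed
  then have "cmod (cdual_apply \<Phi> f) \<le> 0" by (rule field_le_epsilon)
  then show "cdual_apply \<Phi> f = cdual_apply 0 f" by (simp add: zero_cdual.rep_eq)
qed

section \<open>The bidual as an algebra of matrices along a run\<close>

text \<open>This is \<open>entry_mult\<close> read as a statement on functionals: the span of the
  coordinates is stable under the module action.\<close>

lemma dual_act_coord:
  assumes "k \<le> length t"
  shows "dual_act (coord k t) a = (\<Sum>i=1..<k. entry (of_alg a) i t *\<^sub>C coord (k - i) (drop i t))"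
  by (rule cdual_eqI)
    (simp add: times_alg.rep_eq entry_mult[OF path_invariant_of_alg path_invariant_of_alg assms]
      cdual_sum scaleC_cdual.rep_eq scaleC_complex_def)

lemma bidual_act_coord:
  assumes "k \<le> length t"
  shows "bidual_act \<Psi> (coord k t) =
    (\<Sum>i=1..<k. cdual_apply \<Psi> (coord (k - i) (drop i t)) *\<^sub>C coord i t)"
  by (rule cdual_eqI)
    (simp add: dual_act_coord[OF assms] cdual_sum cdual_sum_arg cdual_scaleC_arg
      scaleC_cdual.rep_eq scaleC_complex_def mult.commute)

text \<open>Elements of the bidual multiply like matrices of their coordinates, the left factor
  taking the part of the path next to the target.\<close>

lemma arens_coord:
  assumes "k \<le> length t"
  shows "cdual_apply (arens \<Phi> \<Psi>) (coord k t) =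
    (\<Sum>i=1..<k. cdual_apply \<Psi> (coord (k - i) (drop i t)) * cdual_apply \<Phi> (coord i t))"
  by (simp add: bidual_act_coord[OF assms] cdual_sum_arg cdual_scaleC_arg)

lemma coord_cong:
  assumes "k \<le> length t" "k \<le> length t'" "path_colours k t = path_colours k t'"
  shows "coord k t = coord k t'"
  by (rule cdual_eqI) (simp add: path_invariantD[OF path_invariant_of_alg assms])

section \<open>The matrix of a bidual element along a run\<close>

definition run :: "word \<Rightarrow> nat \<Rightarrow> word" where
  "run u i = replicate i gen_g @ gen_h # u"

lemma length_run [simp]: "length (run u i) = Suc (i + length u)"
  by (simp add: run_def)

lemma drop_run: "i \<le> m \<Longrightarrow> drop i (run u m) = run u (m - i)"
  by (simp add: run_def)

lemma run_eq_iff [simp]: "run u i = run u j \<longleftrightarrow> i = j"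
  by (auto simp: run_def replicate_h_eq_iff)

lemma run_in_colours_iff: "run u i \<in> colours \<longleftrightarrow> Suc (length u) dvd i"
  by (simp add: run_def replicate_h_in_colours_iff)

text \<open>The source index comes first and the target second, the reverse of the usual matrix of
  an operator; hence the factors change places in \<open>run_entry_arens\<close>.\<close>

definition run_entry :: "word \<Rightarrow> alg cdual cdual \<Rightarrow> nat \<Rightarrow> nat \<Rightarrow> complex" where
  "run_entry u \<Phi> i j = cdual_apply \<Phi> (coord (j - i) (run u j))"

lemma run_entry_arens:
  assumes "i \<le> j"
  shows "run_entry u (arens \<Phi> \<Psi>) i j =
    (\<Sum>c\<in>{i<..<j}. run_entry u \<Psi> i c * run_entry u \<Phi> c j)"
proof -
  have "run_entry u (arens \<Phi> \<Psi>) i j = (\<Sum>d=1..<j - i.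
      cdual_apply \<Psi> (coord (j - i - d) (drop d (run u j))) * cdual_apply \<Phi> (coord d (run u j)))"
    unfolding run_entry_def by (rule arens_coord) simp
  also have "\<dots> = (\<Sum>c\<in>{i<..<j}. run_entry u \<Psi> i c * run_entry u \<Phi> c j)"
  proof (rule sum.reindex_bij_witness[of _ "\<lambda>c. j - c" "\<lambda>d. j - d"])
    fix d assume d: "d \<in> {1..<j - i}"
    then have "d \<le> j" "j - i - d = j - d - i" "j - (j - d) = d" by auto
    then show "run_entry u \<Psi> i (j - d) * run_entry u \<Phi> (j - d) j =
        cdual_apply \<Psi> (coord (j - i - d) (drop d (run u j))) * cdual_apply \<Phi> (coord d (run u j))"
      by (simp only: run_entry_def drop_run)
  qed auto
  finally show ?thesis .
qed

text \<open>Every word of the run has weight \<open>1 / 2 ^ Suc (depth u)\<close>, so the norms of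
  the coordinates grow at most geometrically with the number of steps.\<close>

lemma run_entry_le:
  assumes "i \<le> j"
  shows "cmod (run_entry u \<Phi> i j) \<le> norm \<Phi> * 2 ^ (Suc (depth u) * (j - i))"
proof -
  have "wt (drop d (run u j)) = 1 / 2 ^ Suc (depth u)" if "d < j - i" for d
    unfolding drop_run[OF order_trans[OF less_imp_le[OF that] diff_le_self]] wt_def
    unfolding run_def depth_run ..
  then have "path_weight (j - i) (run u j) = (\<Prod>d<j - i. 1 / 2 ^ Suc (depth u))"
    unfolding path_weight_def by (intro prod.cong refl) blast
  then have pw: "path_weight (j - i) (run u j) = 1 / 2 ^ (Suc (depth u) * (j - i))"
    by (simp only: prod_constant card_lessThan power_one_over power_mult)
  have "norm (coord (j - i) (run u j)) \<le> 2 ^ (Suc (depth u) * (j - i))"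
  proof (rule norm_cdual_le)
    fix a
    have "cmod (entry (of_alg a) (j - i) (run u j)) * path_weight (j - i) (run u j) \<le> norm a"
      unfolding norm_alg.rep_eq by (rule entry_bound) simp
    then have "cmod (entry (of_alg a) (j - i) (run u j)) \<le> norm a * 2 ^ (Suc (depth u) * (j - i))"
      unfolding pw by (simp add: pos_divide_le_eq del: power_Suc mult_Suc)
    then show "cmod (cdual_apply (coord (j - i) (run u j)) a)
        \<le> 2 ^ (Suc (depth u) * (j - i)) * norm a"
      by (simp add: mult.commute del: mult_Suc)
  qed simp
  then have "norm \<Phi> * norm (coord (j - i) (run u j)) \<le> norm \<Phi> * 2 ^ (Suc (depth u) * (j - i))"
    by (intro mult_left_mono) simp_all
  then show ?thesis
    unfolding run_entry_def by (rule order_trans[OF cdual_bound])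
qed

section \<open>Signed series and triangular systems\<close>

lemma cnj_sgn_mult: "cnj (sgn z) * z = complex_of_real (cmod z)"
proof (cases "z = 0")
  case False
  have "cnj z * z = (complex_of_real (cmod z))\<^sup>2" 
    by (metis complex_norm_square mult.commute of_real_power)
  then show ?thesis using False by (simp add: sgn_eq power2_eq_square)
qed simp

text \<open>The hypothesis makes \<open>\<Sum>j. cmod (f (a j))\<close> finite for every functional \<open>f\<close>, so no weak-star
  compactness is needed.\<close>

lemma signed_series_in_bidual:
  fixes a :: "nat \<Rightarrow> 'a::complex_normed_vector" and \<sigma> :: "nat \<Rightarrow> complex"
  assumes C: "\<And>\<theta> N. (\<And>j. cmod (\<theta> j) \<le> 1) \<Longrightarrow> norm (\<Sum>j<N. \<theta> j *\<^sub>C a j) \<le> C"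
    and \<sigma>: "\<And>j. cmod (\<sigma> j) \<le> 1"
  obtains \<Psi> where "\<And>f. (\<lambda>j. \<sigma> j * cdual_apply f (a j)) sums cdual_apply \<Psi> f"
proof -
  have C0: "0 \<le> C" using C[of "\<lambda>_. 0" 0] by simp
  have part: "(\<Sum>j<N. cmod (cdual_apply f (a j))) \<le> C * norm f" for f N
  proof -
    \<comment> \<open>These phases align all terms, so one bounded sum controls the series of
      absolute values.\<close>
    define \<theta> where "\<theta> j = cnj (sgn (cdual_apply f (a j)))" for j
    have "\<theta> j * cdual_apply f (a j) = complex_of_real (cmod (cdual_apply f (a j)))" for j
      unfolding \<theta>_def by (rule cnj_sgn_mult)
    then have "complex_of_real (\<Sum>j<N. cmod (cdual_apply f (a j))) = cdual_apply f (\<Sum>j<N. \<theta> j *\<^sub>C a j)"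
      by (simp add: cdual_sum_arg cdual_scaleC_arg)
    then have "(\<Sum>j<N. cmod (cdual_apply f (a j))) \<le> norm f * norm (\<Sum>j<N. \<theta> j *\<^sub>C a j)"
      using cdual_bound[of f "\<Sum>j<N. \<theta> j *\<^sub>C a j"] by (metis abs_ge_self norm_of_real order_trans)
    also have "\<dots> \<le> norm f * C"
      by (intro mult_left_mono C) (auto simp: \<theta>_def norm_sgn)
    finally show ?thesis by (simp add: mult.commute)
  qed
  have le: "cmod (\<sigma> j * cdual_apply f (a j)) \<le> cmod (cdual_apply f (a j))" for f j
    using \<sigma>[of j] by (simp add: norm_mult mult_left_le_one_le)
  have abs: "summable (\<lambda>j. cmod (cdual_apply f (a j)))" for f
    by (rule bounded_imp_summable[of _ "C * norm f"]) (use part[of f "Suc _"] in \<open>auto simp: lessThan_Suc_atMost\<close>)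
  have summ: "summable (\<lambda>j. \<sigma> j * cdual_apply f (a j))" for f
    by (rule summable_comparison_test'[OF abs]) (rule le)
  have "bounded_clinear (\<lambda>f. \<Sum>j. \<sigma> j * cdual_apply f (a j))"
  proof (rule bounded_clinearI)
    show "(\<Sum>j. \<sigma> j * cdual_apply (f + g) (a j)) =
        (\<Sum>j. \<sigma> j * cdual_apply f (a j)) + (\<Sum>j. \<sigma> j * cdual_apply g (a j))" for f g
      using suminf_add[OF summ summ, of f g] by (simp add: plus_cdual.rep_eq distrib_left)
    show "(\<Sum>j. \<sigma> j * cdual_apply (c *\<^sub>C f) (a j)) = c *\<^sub>C (\<Sum>j. \<sigma> j * cdual_apply f (a j))" for c f
      using suminf_mult[OF summ, of c f] by (simp add: scaleC_cdual.rep_eq scaleC_complex_def mult_ac)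
    fix f
    have "norm (\<Sum>j. \<sigma> j * cdual_apply f (a j)) \<le> (\<Sum>j. cmod (cdual_apply f (a j)))"
      by (rule norm_suminf_le[OF le abs])
    also have "\<dots> \<le> C * norm f" by (rule suminf_le_const[OF abs part])
    finally show "norm (\<Sum>j. \<sigma> j * cdual_apply f (a j)) \<le> norm f * C" by (simp add: mult.commute)
  qed
  then have "(\<lambda>j. \<sigma> j * cdual_apply f (a j)) sums
      cdual_apply (Cdual (\<lambda>f. \<Sum>j. \<sigma> j * cdual_apply f (a j))) f" for f
    by (simp add: cdual_apply_Cdual summable_sums summ)
  then show ?thesis by (rule that)
qed

text \<open>Twice \<open>y\<close> is the difference of \<open>x + y\<close> and
  \<open>x - y\<close>.\<close>

lemma norm_le_norm_add_or_diff:
  fixes x y :: "'a::real_normed_vector"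
  shows "norm y \<le> norm (x + y) \<or> norm y \<le> norm (x - y)"
  using norm_triangle_ineq4[of "x + y" "x - y"] by (simp flip: scaleR_2) linarith

text \<open>Each sign is chosen so that the sum defining the next term avoids cancellation.\<close>

lemma sign_choice:
  fixes \<phi> :: "nat \<Rightarrow> nat \<Rightarrow> complex" and \<mu> \<alpha> :: complex
  assumes diag: "\<And>j. \<phi> j j = \<alpha>"
  obtains \<beta> \<sigma> where "\<beta> 0 = 1" "\<And>j. cmod (\<sigma> j) = 1"
    "\<And>j. \<beta> (Suc j) = \<sigma> j * \<mu> * (\<Sum>i\<le>j. \<beta> i * \<phi> i j)"
    "\<And>j. (cmod \<mu> * cmod \<alpha>) ^ j \<le> cmod (\<beta> j)"
proof -
  \<comment> \<open>\<open>r\<close> is the candidate for \<open>\<beta> m\<close>. As the diagonal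
    of \<open>\<phi>\<close> is \<open>\<alpha>\<close>, the product \<open>r * \<alpha>\<close> is
    the last term of the sum defining the next value; the inequality says that the earlier terms do
    not cancel it.\<close>
  define P where "P \<beta> m r \<longleftrightarrow> (case m of 0 \<Rightarrow> r = 1
    | Suc j \<Rightarrow> (\<exists>s\<in>{1, -1}. r = s * \<mu> * (\<Sum>i\<le>j. \<beta> i * \<phi> i j)) \<and>
        cmod (r * \<alpha>) \<le> cmod ((\<Sum>i\<le>j. \<beta> i * \<phi> i (Suc j)) + r * \<alpha>))"
    for \<beta> :: "nat \<Rightarrow> complex" and m and r :: complex
  have "\<exists>\<beta>. \<forall>m. P \<beta> m (\<beta> m)"
  proof (rule dependent_wf_choice[OF wf_less])
    fix f g :: "nat \<Rightarrow> complex" and m r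
    assume eq: "\<And>z. (z, m) \<in> {(x, y). x < y} \<Longrightarrow> f z = g z"
    then have "(\<Sum>i\<le>j. f i * c i) = (\<Sum>i\<le>j. g i * c i)" if "m = Suc j" for j and c :: "nat \<Rightarrow> complex"
      using that by (intro sum.cong) auto
    then show "P f m r = P g m r" by (simp add: P_def split: nat.split)
  next
    fix m and f :: "nat \<Rightarrow> complex"
    show "\<exists>r. P f m r"
    proof (cases m)
      case 0
      then show ?thesis by (simp add: P_def)
    next
      case (Suc j)
      define r where "r = \<mu> * (\<Sum>i\<le>j. f i * \<phi> i j)"
      consider "cmod (r * \<alpha>) \<le> cmod ((\<Sum>i\<le>j. f i * \<phi> i (Suc j)) + r * \<alpha>)"
        | "cmod (r * \<alpha>) \<le> cmod ((\<Sum>i\<le>j. f i * \<phi> i (Suc j)) - r * \<alpha>)"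
        using norm_le_norm_add_or_diff by blast
      then show ?thesis
      proof cases
        case 1
        then have "P f m r" by (simp add: P_def Suc r_def)
        then show ?thesis ..
      next
        case 2
        then have "P f m (- r)" by (simp add: P_def Suc r_def)
        then show ?thesis ..
      qed
    qed
  qed
  then obtain \<beta> where \<beta>: "\<And>m. P \<beta> m (\<beta> m)" by blast
  have b0: "\<beta> 0 = 1" using \<beta>[of 0] by (simp add: P_def)
  have "\<exists>s. cmod s = 1 \<and> \<beta> (Suc j) = s * \<mu> * (\<Sum>i\<le>j. \<beta> i * \<phi> i j)" for j
    using \<beta>[of "Suc j"] unfolding P_def by (auto intro: exI[of _ "-1"] exI[of _ 1])
  then obtain \<sigma> where \<sigma>: "\<And>j. cmod (\<sigma> j) = 1"
    "\<And>j. \<beta> (Suc j) = \<sigma> j * \<mu> * (\<Sum>i\<le>j. \<beta> i * \<phi> i j)" by metis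
  have S: "cmod (\<beta> j) * cmod \<alpha> \<le> cmod (\<Sum>i\<le>j. \<beta> i * \<phi> i j)" for j
  proof (cases j)
    case 0
    then show ?thesis by (simp add: diag norm_mult)
  next
    case (Suc m)
    then show ?thesis using \<beta>[of j] by (simp add: P_def norm_mult diag)
  qed
  have "(cmod \<mu> * cmod \<alpha>) ^ j \<le> cmod (\<beta> j)" for j
  proof (induction j)
    case 0
    then show ?case by (simp add: b0)
  next
    case (Suc j)
    have "(cmod \<mu> * cmod \<alpha>) ^ Suc j \<le> cmod \<mu> * cmod \<alpha> * cmod (\<beta> j)"
      unfolding power_Suc using Suc by (intro mult_left_mono) auto
    also have "\<dots> \<le> cmod \<mu> * cmod (\<Sum>i\<le>j. \<beta> i * \<phi> i j)"
      using mult_left_mono[OF S[of j] norm_ge_zero[of \<mu>]] by (simp add: mult_ac)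
    also have "\<dots> = cmod (\<beta> (Suc j))" by (simp add: \<sigma> norm_mult)
    finally show ?case .
  qed
  then show ?thesis by (rule that[OF b0 \<sigma>])
qed

text \<open>In matrix form \<open>B = Q + Q B\<close>, and the row vector \<open>\<beta>\<close>
  satisfies \<open>\<beta> Q = \<beta> - \<beta> 0 e\<close> with \<open>e\<close> the first unit
  row. Multiplying by \<open>\<beta>\<close> from the left, the terms \<open>\<beta> B\<close>
  cancel and \<open>\<beta> 0 e B = \<beta> Q\<close> remains.\<close>

lemma quasi_inverse_first_row:
  fixes B Q :: "nat \<Rightarrow> nat \<Rightarrow> 'a::comm_ring" and \<beta> :: "nat \<Rightarrow> 'a"
  assumes B: "\<And>i. i < m \<Longrightarrow> B i m = Q i m + (\<Sum>j\<in>{i<..<m}. Q i j * B j m)"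
    and \<beta>: "\<And>j. 1 \<le> j \<Longrightarrow> j \<le> m \<Longrightarrow> \<beta> j = (\<Sum>i<j. \<beta> i * Q i j)" and m: "1 \<le> m"
  shows "\<beta> 0 * B 0 m = \<beta> m"
proof -
  have "(\<Sum>i<m. \<beta> i * B i m) = (\<Sum>i<m. \<beta> i * Q i m) + (\<Sum>i<m. \<Sum>j\<in>{i<..<m}. \<beta> i * Q i j * B j m)"
    unfolding sum.distrib[symmetric]
  proof (rule sum.cong[OF refl])
    fix i assume "i \<in> {..<m}"
    then show "\<beta> i * B i m = \<beta> i * Q i m + (\<Sum>j\<in>{i<..<m}. \<beta> i * Q i j * B j m)"
      by (subst B) (simp_all add: distrib_left sum_distrib_left mult.assoc)
  qed
  also have "(\<Sum>i<m. \<Sum>j\<in>{i<..<m}. \<beta> i * Q i j * B j m) = (\<Sum>j<m. \<Sum>i<j. \<beta> i * Q i j * B j m)"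
    unfolding sum.Sigma[OF finite_lessThan ballI[OF finite_lessThan]]
      sum.Sigma[OF finite_lessThan ballI[OF finite_greaterThanLessThan]]
    by (rule sum.reindex_bij_witness[of _ prod.swap prod.swap]) auto
  \<comment> \<open>For \<open>j = 0\<close> the inner sum is empty; for the other \<open>j\<close>
    the recursion collapses it to \<open>\<beta> j\<close>.\<close>
  also have "\<dots> = (\<Sum>j\<in>{1..<m}. \<beta> j * B j m)"
  proof (rule sum.mono_neutral_cong_right)
    fix j assume "j \<in> {1..<m}"
    then show "(\<Sum>i<j. \<beta> i * Q i j * B j m) = \<beta> j * B j m"
      by (subst \<beta>[of j]) (simp_all add: sum_distrib_right)
  qed (auto simp: not_le)
  also have "(\<Sum>i<m. \<beta> i * Q i m) = \<beta> m" using m by (intro \<beta>[symmetric]) simp_all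
  also have "(\<Sum>i<m. \<beta> i * B i m) = \<beta> 0 * B 0 m + (\<Sum>j\<in>{1..<m}. \<beta> j * B j m)"
  proof -
    have "{..<m} = insert 0 {1..<m}" using m by auto
    then show ?thesis by simp
  qed
  finally show ?thesis by simp
qed

section \<open>Semisimplicity\<close>

text \<open>The step onto a new colour of the run, followed by the first \<open>l\<close> colours of \<open>u\<close>.\<close>

definition separator :: "word \<Rightarrow> nat \<Rightarrow> nat \<Rightarrow> word list" where
  "separator u l j = path_colours (Suc l) (run u (Suc j * Suc (length u) + l))"

lemma separator_in_paths: "\<exists>n. separator u l j \<in> paths n"
  unfolding separator_def by (rule exI, rule pathsI[OF _ _ lessI]) simp_all

lemma fresh_separator: "fresh (Suc l) (run u (Suc j * Suc (length u) + l))"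
  unfolding fresh_def
proof (intro exI conjI)
  show "drop l (run u (Suc j * Suc (length u) + l)) \<in> colours"
    unfolding drop_run[OF le_add2] diff_add_inverse2 run_in_colours_iff by (rule dvd_triv_right)
qed simp

text \<open>The last colour of a separator is a word longer than \<open>u\<close>, whereas off the
  multiples of \<open>Suc (length u)\<close> the run shows only colours of suffixes of
  \<open>u\<close>. So on this run a separator occurs at its own place only.\<close>

lemma path_colours_eq_separator_iff:
  assumes "c \<le> b"
  shows "path_colours (b - c) (run u b) = separator u l j \<longleftrightarrow>
    b = Suc j * Suc (length u) + l \<and> c + Suc l = b"
proof
  let ?n = "Suc (length u)"
  assume eq: "path_colours (b - c) (run u b) = separator u l j"
  have bc: "b - c = Suc l" using path_colours_eqD[OF eq[unfolded separator_def]] by blast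
  have "colour (drop l (run u b)) = colour (drop l (run u (Suc j * ?n + l)))"
    using path_colours_eqD[OF eq[unfolded separator_def]] bc by auto
  moreover have "drop l (run u b) = run u (b - l)" using bc by (intro drop_run) simp
  moreover have "drop l (run u (Suc j * ?n + l)) = run u (Suc j * ?n)"
    by (simp add: drop_run del: mult_Suc)
  moreover have "run u (Suc j * ?n) \<in> colours" unfolding run_in_colours_iff by (rule dvd_triv_right)
  ultimately have col: "colour (run u (b - l)) = run u (Suc j * ?n)" by simp
  have "b - l = Suc j * ?n"
  proof (cases "?n dvd b - l")
    case True
    then have "run u (b - l) \<in> colours" by (simp add: run_in_colours_iff)
    then show ?thesis using col by simp
  next
    case False
    let ?v = "drop (length u - (b - l) mod ?n) u"
    have nz: "(b - l) mod ?n \<noteq> 0" using False by (simp add: dvd_eq_mod_eq_0)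
    have ml: "(b - l) mod ?n \<le> length u" using mod_less_divisor[of ?n "b - l"] by linarith
    have "length u - (b - l) mod ?n < length u" using nz ml by linarith
    then have "?v \<noteq> []" by simp
    then have "length (colour ?v) \<le> length ?v" using colour_mem by blast
    moreover have "colour (run u (b - l)) = colour ?v"
      using colour_run[of "b - l" u] nz by (simp add: run_def)
    ultimately have "length (run u (Suc j * ?n)) \<le> length ?v"
      unfolding col[symmetric] by (simp only:)
    also have "\<dots> \<le> length u" by simp
    finally show ?thesis by simp
  qed
  then show "b = Suc j * ?n + l \<and> c + Suc l = b" using bc by linarith
next
  assume "b = Suc j * Suc (length u) + l \<and> c + Suc l = b"
  then show "path_colours (b - c) (run u b) = separator u l j"
    unfolding separator_def by (metis diff_add_inverse)
qed

lemma separator_eq_iff: "separator u l i = separator u l j \<longleftrightarrow> i = j"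
proof
  let ?b = "Suc i * Suc (length u) + l"
  have b: "?b - (?b - Suc l) = Suc l" by simp
  assume "separator u l i = separator u l j"
  then have "path_colours (?b - (?b - Suc l)) (run u ?b) = separator u l j"
    unfolding b separator_def[of u l i] .
  then have "?b = Suc j * Suc (length u) + l"
    using path_colours_eq_separator_iff[of "?b - Suc l" ?b] by simp
  then have "Suc i * Suc (length u) = Suc j * Suc (length u)" by linarith
  then show "i = j" using mult_cancel2 by (metis nat.distinct(1) nat.inject)
qed simp

text \<open>All entries lie on the diagonal \<open>k = Suc l\<close>, each carries at most one
  \<open>\<theta> j\<close>, and fresh or not they sit on runs of \<open>gen_g\<close>. So
  \<open>norm_le_of_g_runs\<close> gives a bound independent of \<open>N\<close> and
  \<open>\<theta>\<close>.\<close>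

lemma norm_sum_separators_le:
  assumes \<theta>: "\<And>j. cmod (\<theta> j) \<le> 1"
  shows "norm (\<Sum>j<N. \<theta> j *\<^sub>C alg_monomial (separator u l j)) \<le> 2 ^ Suc l"
proof -
  have ofm: "of_alg (alg_monomial (separator u l j)) = monomial (separator u l j)" for j
    using separator_in_paths of_alg_monomial by blast
  define z where "z = (\<Sum>j<N. \<theta> j *\<^sub>C monomial (separator u l j))"
  have z: "entry z k t = (\<Sum>j<N. if path_colours k t = separator u l j then \<theta> j else 0)"
    if "k \<le> length t" for k t
    unfolding z_def entry_sum entry_scaleC
  proof (rule sum.cong[OF refl])
    fix j
    have "separator u l j \<noteq> []" using separator_in_paths Nil_notin_paths by blast
    then show "\<theta> j * entry (monomial (separator u l j)) k t =
        (if path_colours k t = separator u l j then \<theta> j else 0)"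
      by (simp add: entry_monomial that)
  qed
  have "norm z \<le> 2 ^ Suc l"
  proof (rule norm_le_of_g_runs)
    show "strictly_lower z"
      unfolding z_def by (intro strictly_lower_sum strictly_lower_scaleC strictly_lower_monomial)
    fix k and t :: word assume k: "1 \<le> k" "k \<le> length t"
    have nz: "\<exists>j<N. path_colours k t = separator u l j" if "entry z k t \<noteq> 0"
    proof (rule ccontr)
      assume "\<not> ?thesis"
      then have "entry z k t = 0" unfolding z[OF k(2)] by (intro sum.neutral) auto
      with that show False ..
    qed
    have kl: "k = Suc l" if "path_colours k t = separator u l j" for j
      using path_colours_eqD[OF that[unfolded separator_def]] by blast
    show "take k t = replicate k gen_g" if "entry z k t \<noteq> 0"
    proof (cases "fresh k t")
      case True
      obtain j where j: "path_colours k t = separator u l j" using nz[OF \<open>entry z k t \<noteq> 0\<close>] by blast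
      let ?m = "Suc j * Suc (length u) + l"
      have "t = run u ?m"
        using True fresh_separator[of l u j] k j unfolding kl[OF j] separator_def
        by (intro fresh_path_unique[of "Suc l"]) simp_all
      \<comment> \<open>The offset \<open>Suc j\<close> leaves enough letters \<open>gen_g\<close>,
        so the path ends before the letter \<open>gen_h\<close> is removed.\<close>
      moreover have "Suc l \<le> ?m" by simp
      ultimately show ?thesis unfolding kl[OF j] by (simp add: run_def min_def del: replicate_Suc)
    next
      case False
      then show ?thesis using k by (rule not_fresh_run)
    qed
    show "cmod (entry z k t) * path_weight k t \<le> 2 ^ Suc l / 2 ^ k"
    proof (cases "entry z k t = 0")
      case False
      then obtain j where j: "j < N" "path_colours k t = separator u l j" using nz by blast
      have "entry z k t = \<theta> j"
        using j(1) unfolding z[OF k(2)] j(2) separator_eq_iff by simp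
      then have "cmod (entry z k t) * path_weight k t \<le> 1 * 1"
        using \<theta>[of j] path_weight_le_1 path_weight_nonneg by (intro mult_mono) auto
      then show ?thesis unfolding kl[OF j(2)] by simp
    qed simp
  qed simp
  then show ?thesis by (simp only: norm_alg.rep_eq of_alg_sum scaleC_alg.rep_eq ofm z_def)
qed

text \<open>Along the run \<open>\<Phi>\<close> leads from \<open>\<zeta> i\<close> to
  \<open>\<zeta> j + k\<close> with entry \<open>\<phi> i j\<close>, and \<open>\<Psi>\<close>
  crosses a separator from \<open>\<zeta> j + k\<close> to \<open>\<zeta> (Suc j)\<close> with entry
  \<open>\<sigma> j\<close>. The run entries of a quasi-inverse therefore solve a triangular system,
  and its first row is the sequence \<open>\<beta>\<close> of \<open>sign_choice\<close>.\<close>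

lemma not_left_quasi_regular_multiple:
  fixes X :: "alg bidual"
  assumes k: "1 \<le> k" "k \<le> length u" and nz: "cdual_apply (of_bidual X) (coord k u) \<noteq> 0"
  obtains Y where "\<And>b. b - b * (Y * X) \<noteq> Y * X"
proof -
  define \<Phi> where "\<Phi> = of_bidual X"
  define \<alpha> where "\<alpha> = cdual_apply \<Phi> (coord k u)"
  define n where "n = length u"
  define l where "l = n - k"
  \<comment> \<open>In the \<open>j\<close>-th period of the run, \<open>\<zeta> j\<close>
    corresponds to \<open>drop k u\<close> and \<open>\<zeta> j + k\<close> to
    \<open>u\<close>.\<close>
  define \<zeta> where "\<zeta> j = j * Suc n + l" for j
  \<comment> \<open>\<open>D\<close> is the factor by which the reciprocal weights grow over one
    period; \<open>\<mu>\<close> is scaled so that \<open>\<beta> j\<close> has modulus at least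
    \<open>(2 * D) ^ j\<close>.\<close>
  define D :: real where "D = 2 ^ (Suc (depth u) * Suc n)"
  define \<mu> where "\<mu> = complex_of_real (2 * D / cmod \<alpha>)"
  have lk: "l + k = n" using k by (simp add: l_def n_def)
  have D0: "0 < D" by (simp add: D_def)
  have \<alpha>0: "\<alpha> \<noteq> 0" using nz by (simp add: \<alpha>_def \<Phi>_def)
  then have \<mu>\<alpha>: "cmod \<mu> * cmod \<alpha> = 2 * D" using D0 by (simp add: \<mu>_def norm_divide norm_mult)
  have \<zeta>_mono: "strict_mono \<zeta>" by (rule strict_monoI_Suc) (simp add: \<zeta>_def)
  have \<zeta>_Suc: "c + Suc l = \<zeta> (Suc j) \<longleftrightarrow> c = \<zeta> j + k" for c j
    using lk by (auto simp: \<zeta>_def)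
  define \<phi> where "\<phi> i j = run_entry u \<Phi> (\<zeta> i) (\<zeta> j + k)" for i j
  \<comment> \<open>The residue of \<open>\<zeta> j + k\<close> is \<open>n\<close>, so the last
    \<open>k\<close> steps up to this position show the colours of the path of length
    \<open>k\<close> that ends at \<open>u\<close>.\<close>
  have diag: "\<phi> j j = \<alpha>" for j
  proof -
    have m: "\<zeta> j + k = n + Suc n * j" using lk by (simp add: \<zeta>_def)
    have "(\<zeta> j + k) mod Suc n = n" unfolding m by (simp only: mod_mult_self2) simp
    then have "path_colours k (run u (\<zeta> j + k)) = path_colours k u"
      using path_colours_run[of k "\<zeta> j + k" u] k(2) by (simp add: run_def n_def)
    then have "coord k (run u (\<zeta> j + k)) = coord k u" by (intro coord_cong) (simp_all add: k)
    then show ?thesis by (simp add: \<phi>_def run_entry_def \<alpha>_def)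
  qed
  obtain \<beta> \<sigma> where \<beta>0: "\<beta> 0 = 1" and \<sigma>: "\<And>j. cmod (\<sigma> j) = 1"
    and \<beta>: "\<And>j. \<beta> (Suc j) = \<sigma> j * \<mu> * (\<Sum>i\<le>j. \<beta> i * \<phi> i j)"
    and \<beta>_ge: "\<And>j. (cmod \<mu> * cmod \<alpha>) ^ j \<le> cmod (\<beta> j)"
    using sign_choice[of \<phi> \<alpha> \<mu>, OF diag] by blast
  obtain \<Psi> where \<Psi>: "\<And>f. (\<lambda>j. \<sigma> j * cdual_apply f (alg_monomial (separator u l j))) sums cdual_apply \<Psi> f"
    using signed_series_in_bidual[of "\<lambda>j. alg_monomial (separator u l j)" "2 ^ Suc l" \<sigma>,
        OF norm_sum_separators_le eq_refl[OF \<sigma>]] by blast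
  have sums: "(\<lambda>j. if b = \<zeta> (Suc j) \<and> c + Suc l = b then \<sigma> j else 0) sums run_entry u \<Psi> c b"
    if "c \<le> b" for b c
  proof -
    have "\<sigma> j * cdual_apply (coord (b - c) (run u b)) (alg_monomial (separator u l j)) =
        (if b = \<zeta> (Suc j) \<and> c + Suc l = b then \<sigma> j else 0)" for j
    proof -
      obtain m where m: "separator u l j \<in> paths m" using separator_in_paths by blast
      have "entry (monomial (separator u l j)) (b - c) (run u b) =
          (if path_colours (b - c) (run u b) = separator u l j then 1 else 0)"
        by (rule entry_monomial[OF Nil_notin_paths[OF m]]) simp
      then show ?thesis
        using of_alg_monomial[OF m] path_colours_eq_separator_iff[OF that, of u l j]
        by (simp add: \<zeta>_def n_def)
    qed
    then show ?thesis using \<Psi>[of "coord (b - c) (run u b)"] unfolding run_entry_def by simp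
  qed
  \<comment> \<open>A separator is entered from the last position of the preceding period.\<close>
  have \<Psi>_zeta: "run_entry u \<Psi> c (\<zeta> (Suc j)) = (if c = \<zeta> j + k then \<sigma> j else 0)"
    if "c \<le> \<zeta> (Suc j)" for c j
  proof -
    have "(\<lambda>i. if \<zeta> (Suc j) = \<zeta> (Suc i) \<and> c + Suc l = \<zeta> (Suc j) then \<sigma> i else 0) =
        (\<lambda>i. if i = j then if c = \<zeta> j + k then \<sigma> i else 0 else 0)"
      unfolding \<zeta>_Suc strict_mono_eq[OF \<zeta>_mono] by auto
    then have "(\<lambda>i. if i = j then if c = \<zeta> j + k then \<sigma> i else 0 else 0) sums
        run_entry u \<Psi> c (\<zeta> (Suc j))"
      using sums[OF that] by (simp only:)
    then show ?thesis by (rule sums_unique2[OF _ sums_single])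
  qed
  have \<Psi>_0: "run_entry u \<Psi> c b = 0" if "c \<le> b" "\<And>j. b \<noteq> \<zeta> (Suc j)" for b c
    using sums[OF that(1)] that(2) sums_unique2[OF _ sums_zero] by simp
  define Q where "Q = arens (\<mu> *\<^sub>C \<Psi>) \<Phi>"
  have Q: "run_entry u Q a b = (\<Sum>c\<in>{a<..<b}. run_entry u \<Phi> a c * (\<mu> * run_entry u \<Psi> c b))"
    if "a \<le> b" for a b
    unfolding Q_def run_entry_arens[OF that] by (simp add: run_entry_def scaleC_cdual.rep_eq scaleC_complex_def)
  have Q_zeta: "run_entry u Q (\<zeta> i) (\<zeta> (Suc j)) = \<sigma> j * \<mu> * \<phi> i j" if "i \<le> j" for i j
  proof -
    have "\<zeta> i \<le> \<zeta> j" using that \<zeta>_mono by (simp add: strict_mono_less_eq)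
    then have mem: "\<zeta> j + k \<in> {\<zeta> i<..<\<zeta> (Suc j)}" using k lk by (simp add: \<zeta>_def)
    have le: "\<zeta> i \<le> \<zeta> (Suc j)" using mem by simp
    have "run_entry u Q (\<zeta> i) (\<zeta> (Suc j)) =
        (\<Sum>c\<in>{\<zeta> i<..<\<zeta> (Suc j)}. if c = \<zeta> j + k then \<sigma> j * \<mu> * \<phi> i j else 0)"
      unfolding Q[OF le]
      by (rule sum.cong[OF refl]) (simp add: \<Psi>_zeta \<phi>_def)
    then show ?thesis using mem by simp
  qed
  have Q_0: "run_entry u Q a b = 0" if "a \<le> b" "\<And>j. b \<noteq> \<zeta> (Suc j)" for a b
    unfolding Q[OF that(1)] using that(2) by (intro sum.neutral) (auto simp: \<Psi>_0)
  have no_quasi_inverse: False if BQ: "B = Q + arens B Q" for B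
  proof -
    \<comment> \<open>In the order of \<open>run_entry\<close> the equation reads
      \<open>B = Q + Q B\<close>. Entries of \<open>Q\<close> vanish unless the target is some
      \<open>\<zeta> (Suc j)\<close>, so the system closes up on these positions.\<close>
    have B: "run_entry u B (\<zeta> i) (\<zeta> m) = run_entry u Q (\<zeta> i) (\<zeta> m) +
        (\<Sum>j\<in>{i<..<m}. run_entry u Q (\<zeta> i) (\<zeta> j) * run_entry u B (\<zeta> j) (\<zeta> m))"
      if "i < m" for i m
    proof -
      have le: "\<zeta> i \<le> \<zeta> m" using that \<zeta>_mono by (simp add: strict_mono_less_eq)
      have "run_entry u B (\<zeta> i) (\<zeta> m) =
          run_entry u Q (\<zeta> i) (\<zeta> m) + run_entry u (arens B Q) (\<zeta> i) (\<zeta> m)"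
        using arg_cong[OF BQ, of "\<lambda>\<Xi>. run_entry u \<Xi> (\<zeta> i) (\<zeta> m)"]
        by (simp add: run_entry_def plus_cdual.rep_eq)
      also have "run_entry u (arens B Q) (\<zeta> i) (\<zeta> m) = (\<Sum>c\<in>{\<zeta> i<..<\<zeta> m}.
          run_entry u Q (\<zeta> i) c * run_entry u B c (\<zeta> m))"
        by (rule run_entry_arens[OF le])
      also have "\<dots> = (\<Sum>c\<in>\<zeta> ` {i<..<m}. run_entry u Q (\<zeta> i) c * run_entry u B c (\<zeta> m))"
      proof (rule sum.mono_neutral_right)
        show "\<zeta> ` {i<..<m} \<subseteq> {\<zeta> i<..<\<zeta> m}" using strict_mono_less[OF \<zeta>_mono] by auto
        show "\<forall>c\<in>{\<zeta> i<..<\<zeta> m} - \<zeta> ` {i<..<m}. run_entry u Q (\<zeta> i) c * run_entry u B c (\<zeta> m) = 0"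
        proof
          fix c assume c: "c \<in> {\<zeta> i<..<\<zeta> m} - \<zeta> ` {i<..<m}"
          have "c \<noteq> \<zeta> (Suc j)" for j
          proof
            assume cj: "c = \<zeta> (Suc j)"
            then have "\<zeta> i < \<zeta> (Suc j)" "\<zeta> (Suc j) < \<zeta> m" using c by auto
            then have "Suc j \<in> {i<..<m}"
              unfolding strict_mono_less[OF \<zeta>_mono] greaterThanLessThan_iff by (rule conjI)
            then show False using c cj by blast
          qed
          then have "run_entry u Q (\<zeta> i) c = 0" using c by (intro Q_0) auto
          then show "run_entry u Q (\<zeta> i) c * run_entry u B c (\<zeta> m) = 0" by simp
        qed
      qed simp
      also have "\<dots> = (\<Sum>j\<in>{i<..<m}. run_entry u Q (\<zeta> i) (\<zeta> j) * run_entry u B (\<zeta> j) (\<zeta> m))"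
        using strict_mono_eq[OF \<zeta>_mono] by (subst sum.reindex) (auto intro: inj_onI)
      finally show ?thesis .
    qed
    have row: "\<beta> j = (\<Sum>i<j. \<beta> i * run_entry u Q (\<zeta> i) (\<zeta> j))" if "1 \<le> j" for j
    proof -
      obtain j' where j': "j = Suc j'" using \<open>1 \<le> j\<close> by (cases j) auto
      have "(\<Sum>i<j. \<beta> i * run_entry u Q (\<zeta> i) (\<zeta> j)) = (\<Sum>i\<le>j'. \<sigma> j' * \<mu> * (\<beta> i * \<phi> i j'))"
        unfolding j' lessThan_Suc_atMost by (intro sum.cong refl) (simp add: Q_zeta mult_ac)
      then show ?thesis unfolding j' \<beta> by (simp add: sum_distrib_left)
    qed
    \<comment> \<open>The first row forces modulus at least \<open>(2 * D) ^ m\<close>, while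
      \<open>run_entry_le\<close> allows at most \<open>norm B * D ^ m\<close>.\<close>
    have le: "2 ^ m \<le> norm B" if m: "1 \<le> m" for m
    proof -
      have "run_entry u B (\<zeta> 0) (\<zeta> m) = \<beta> m"
        using quasi_inverse_first_row[of m "\<lambda>i j. run_entry u B (\<zeta> i) (\<zeta> j)"
            "\<lambda>i j. run_entry u Q (\<zeta> i) (\<zeta> j)" \<beta>, OF B row m] \<beta>0 by simp
      moreover have "cmod (run_entry u B (\<zeta> 0) (\<zeta> m)) \<le> norm B * 2 ^ (Suc (depth u) * (\<zeta> m - \<zeta> 0))"
        by (rule run_entry_le) (simp add: \<zeta>_def)
      moreover have "(2::real) ^ (Suc (depth u) * (\<zeta> m - \<zeta> 0)) = D ^ m"
      proof -
        have "\<zeta> m - \<zeta> 0 = Suc n * m" by (simp add: \<zeta>_def)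
        then show ?thesis unfolding D_def power_mult[symmetric] by (simp only: mult.assoc)
      qed
      ultimately have "(2 * D) ^ m \<le> norm B * D ^ m" using \<beta>_ge[of m] unfolding \<mu>\<alpha> by simp
      then show ?thesis using D0 by (simp add: power_mult_distrib)
    qed
    obtain m where "norm B < 2 ^ m" using real_arch_pow[of 2 "norm B"] by auto
    also have "\<dots> \<le> 2 ^ Suc m" by simp
    also have "\<dots> \<le> norm B" by (rule le) simp
    finally show False by simp
  qed
  show ?thesis
  proof (rule that[of "Bidual (\<mu> *\<^sub>C \<Psi>)"], rule notI)
    fix b assume eq: "b - b * (Bidual (\<mu> *\<^sub>C \<Psi>) * X) = Bidual (\<mu> *\<^sub>C \<Psi>) * X"
    have q: "of_bidual (Bidual (\<mu> *\<^sub>C \<Psi>) * X) = Q"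
      by (simp add: times_bidual.rep_eq Q_def \<Phi>_def Bidual_inverse)
    have "of_bidual b - arens (of_bidual b) Q = Q"
      using arg_cong[OF eq, of of_bidual] by (simp only: minus_bidual.rep_eq times_bidual.rep_eq[of b] q)
    then have "of_bidual b = Q + arens (of_bidual b) Q" by (simp only: diff_eq_eq)
    then show False by (rule no_quasi_inverse)
  qed
qed

theorem mainTheorem4:
  shows "semisimple TYPE(alg bidual)"
proof -
  have "X = 0" if "X \<in> jacobson_radical" for X :: "alg bidual"
  proof -
    \<comment> \<open>A nonzero coordinate would yield a \<open>Y\<close> such that
      \<open>Y * X\<close> has no left quasi-inverse, and \<open>X\<close> would lie outside the
      radical.\<close>
    have "cdual_apply (of_bidual X) (coord k t) = 0" if "1 \<le> k" "k \<le> length t" for k t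
      using not_left_quasi_regular_multiple[OF that] not_in_jacobson_radical
        \<open>X \<in> jacobson_radical\<close> by metis
    then have "of_bidual X = of_bidual 0"
      unfolding zero_bidual.rep_eq by (rule bidual_eq_0I)
    then show ?thesis by (simp only: of_bidual_inject)
  qed
  moreover have "(0 :: alg bidual) \<in> jacobson_radical"
    by (auto simp: jacobson_radical_def maximal_modular_left_ideal_def modular_left_ideal_def
        intro: left_ideal_zero)
  ultimately show ?thesis unfolding semisimple_def by blast
qed

end
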